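(* Let $0<\theta_1<\theta_2<\pi$ and let $f:\mathbb R\to\mathbb R$ be an even, $2\pi$-periodic function of class $C^4$ with $f\in\mathcal A^+([\theta_1,\theta_2])$. Let $[a,b]\subset\,]\theta_1,\theta_2[$ with $a<b$. For integers $N,k$ with $\frac{k\pi}{N+2}\in[\theta_1,\theta_2]$ put $$\tilde\lambda_N^{(k)}=f\Big(\frac{k\pi}{N+2}\Big)+\frac{c_1\big(\frac{k\pi}{N+2}\big)}{N+2}+\frac{c_2\big(\frac{k\pi}{N+2}\big)}{(N+2)^2}.$$ Then there exist a constant $C>0$ and an integer $N_0$ such that for all $N\ge N_0$ the following two statements hold. 1. For every eigenvalue $\lambda$ of $T_N(f)$ in $[f(a),f(b)]$ there is a single integer $k\in[k_{\theta_1,N},k_{\theta_2,N}]$ such that $|\lambda-\tilde\lambda_N^{(k)}|\le \frac{C}{(N+2)^3}$. 2. For every integer $k\in[k_{a,N},k_{b,N}]$ the matrix $T_N(f)$ has a single eigenvalue $\lambda$ in $[f(\theta_1),f(\theta_2)]$ such that $|\lambda-\tilde\lambda_N^{(k)}|\le\frac{C}{(N+2)^3}$.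
   Context: For $h\in L^1(\mathbb R/2\pi\mathbb Z)$, $T_N(h)$ is the $(N+1)\times(N+1)$ Toeplitz matrix with entries $(T_N(h))_{k+1,l+1}=\hat h(k-l)$, $0\le k,l\le N$, where $\hat h(u)=\frac1{2\pi}\int_0^{2\pi}h(\theta)e^{-iu\theta}d\theta$. For $[\theta_1,\theta_2]\subset\,]0,\pi[$, $f\in\mathcal A^+([\theta_1,\theta_2])$ means: $f$ is real-valued, differentiable, $2\pi$-periodic and even, $f'(\theta)>0$ for all $\theta\in[\theta_1,\theta_2]$, and for $\theta\in[0,\pi]$ one has $f(\theta)\in[f(\theta_1),f(\theta_2)]\iff\theta\in[\theta_1,\theta_2]$. Define $H(t,\theta)=\dfrac{f(t)-f(\theta)}{(1-\cos t)-(1-\cos\theta)}$ for $t\in[0,2\pi]$, $\theta\in[\theta_1,\theta_2]$, extended by continuity where $\cos t=\cos\theta$ (value $f'(\theta)/\sin\theta$); $H$ is positive. For $\theta\in[\theta_1,\theta_2]$ set $$\rho(\theta)=\frac1{4\pi}\,\mathrm{P.V.}\!\int_0^{2\pi}\frac{\ln H(t,\theta)}{\tan\frac{t-\theta}2}dt-\frac1{4\pi}\,\mathrm{P.V.}\!\int_0^{2\pi}\frac{\ln H(t,\theta)}{\tan\frac{t+\theta}2}dt$$ (Cauchy principal values), and $$c_1(t)=f'(t)\rho(t),\qquad c_2(t)=f'(t)\rho'(t)\rho(t)+\tfrac12 f''(t)\rho(t)^2 .$$ For an interval $[\alpha,\beta]\subset[\theta_1,\theta_2]$, $k_{\alpha,N}=\min\{k\in\mathbb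 Z:\frac{k\pi}{N+2}\in[\alpha,\beta]\}$ and $k_{\beta,N}=\max\{k\in\mathbb Z:\frac{k\pi}{N+2}\in[\alpha,\beta]\}$; $k_{a,N},k_{b,N}$ refer to $[\alpha,\beta]=[a,b]$ and $k_{\theta_1,N},k_{\theta_2,N}$ refer to $[\alpha,\beta]=[\theta_1,\theta_2]$. *)

theory Defs
  imports "HOL-Analysis.Analysis" "Jordan_Normal_Form.Char_Poly"
begin

definition fourier_coeff :: "(real \<Rightarrow> complex) \<Rightarrow> int \<Rightarrow> complex" where
  "fourier_coeff h u =
     1 / (2 * of_real pi) * integral {0..2 * pi} (\<lambda>t. h t * exp (- \<i> * of_int u * of_real t))"

definition toeplitz :: "nat \<Rightarrow> (real \<Rightarrow> complex) \<Rightarrow> complex mat" where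
  "toeplitz N h = Matrix.mat (N + 1) (N + 1) (\<lambda>(k, l). fourier_coeff h (int k - int l))"

definition C_class :: "nat \<Rightarrow> (real \<Rightarrow> real) \<Rightarrow> bool" where
  "C_class n f \<longleftrightarrow>
     (\<forall>j<n. \<forall>x. ((deriv ^^ j) f) differentiable (at x)) \<and> continuous_on UNIV ((deriv ^^ n) f)"

definition A_plus :: "real \<Rightarrow> real \<Rightarrow> (real \<Rightarrow> real) set" where
  "A_plus \<theta>1 \<theta>2 = {f.
     (\<forall>x. f differentiable (at x)) \<and>
     (\<forall>x. f (x + 2 * pi) = f x) \<and>
     (\<forall>x. f (- x) = f x) \<and>
     (\<forall>\<theta>\<in>{\<theta>1..\<theta>2}. deriv f \<theta> > 0) \<and>
     (\<forall>\<theta>\<in>{0..pi}. f \<theta> \<in> {f \<theta>1..f \<theta>2} \<longleftrightarrow> \<theta> \<in> {\<theta>1..\<theta>2})}"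

definition H_quot :: "(real \<Rightarrow> real) \<Rightarrow> real \<Rightarrow> real \<Rightarrow> real" where
  "H_quot f t \<theta> =
     (if cos t = cos \<theta> then deriv f \<theta> / sin \<theta>
      else (f t - f \<theta>) / ((1 - cos t) - (1 - cos \<theta>)))"

text \<open>Cauchy principal value of the integral of \<open>g\<close> over \<open>[a, b]\<close>, with a single
  singularity at the interior point \<open>s\<close>.\<close>

definition pv_integral :: "real \<Rightarrow> real \<Rightarrow> real \<Rightarrow> (real \<Rightarrow> real) \<Rightarrow> real" where
  "pv_integral a b s g = Lim (at_right 0) (\<lambda>\<epsilon>. integral ({a..b} - ball s \<epsilon>) g)"

text \<open>For \<open>\<theta>\<close> in \<open>]0, \<pi>[\<close>, the only zero of \<open>tan ((t + \<theta>) / 2)\<close> with \<open>t\<close> in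
  \<open>[0, 2\<pi>]\<close> is \<open>t = 2\<pi> - \<theta>\<close>. Where the tangent has a pole, its value, and hence that
  of the quotient, is \<open>0\<close>, which is also the limit of the quotient.\<close>

definition rho :: "(real \<Rightarrow> real) \<Rightarrow> real \<Rightarrow> real" where
  "rho f \<theta> =
     1 / (4 * pi) * pv_integral 0 (2 * pi) \<theta> (\<lambda>t. ln (H_quot f t \<theta>) / tan ((t - \<theta>) / 2))
   - 1 / (4 * pi) * pv_integral 0 (2 * pi) (2 * pi - \<theta>) (\<lambda>t. ln (H_quot f t \<theta>) / tan ((t + \<theta>) / 2))"

definition c1 :: "(real \<Rightarrow> real) \<Rightarrow> real \<Rightarrow> real" where
  "c1 f t = deriv f t * rho f t"

text \<open>As \<open>rho f\<close> is only meaningful on \<open>[\<theta>1, \<theta>2]\<close>, its derivative is taken within this interval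
  (so it is one-sided at the end points).\<close>

definition c2 :: "real \<Rightarrow> real \<Rightarrow> (real \<Rightarrow> real) \<Rightarrow> real \<Rightarrow> real" where
  "c2 \<theta>1 \<theta>2 f t =
     deriv f t * vector_derivative (rho f) (at t within {\<theta>1..\<theta>2}) * rho f t
   + 1 / 2 * deriv (deriv f) t * (rho f t)\<^sup>2"

definition grid :: "nat \<Rightarrow> int \<Rightarrow> real" where
  "grid N k = of_int k * pi / (of_nat N + 2)"

definition k_min :: "real \<Rightarrow> real \<Rightarrow> nat \<Rightarrow> int" where
  "k_min \<alpha> \<beta> N = Min {k. grid N k \<in> {\<alpha>..\<beta>}}"

definition k_max :: "real \<Rightarrow> real \<Rightarrow> nat \<Rightarrow> int" where
  "k_max \<alpha> \<beta> N = Max {k. grid N k \<in> {\<alpha>..\<beta>}}"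

definition lambda_approx :: "real \<Rightarrow> real \<Rightarrow> (real \<Rightarrow> real) \<Rightarrow> nat \<Rightarrow> int \<Rightarrow> real" where
  "lambda_approx \<theta>1 \<theta>2 f N k =
     f (grid N k) + c1 f (grid N k) / (of_nat N + 2)
       + c2 \<theta>1 \<theta>2 f (grid N k) / (of_nat N + 2)\<^sup>2"

end

theory Submission
  imports Defs
begin

text \<open>
  Fix \<theta> and write f(t) - f(\<theta>) = (cos \<theta> - cos t) H(t,\<theta>) with H(.,\<theta>) = |D|^2 and D(z) = exp (\<Sum>k. b k z^k)
  on the unit circle. If p is an eigenvector of T_N(f) for f(\<theta>), then q(z) = (1 - 2 z cos \<theta> + z^2) p(z) has
  degree at most n = N + 2, vanishes at exp(i\<theta>), and H q is orthogonal to z, ..., z^(n-1). Up to O(n^(-2)), this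
  orthogonality forces q to be a combination \<alpha> (1/D) + \<beta> z^n cnj(1/D). Since 1/D has argument \<rho>(\<theta>)/2 at
  exp(i\<theta>), the condition q(exp(i\<theta>)) = 0 becomes sin(n\<theta> - \<rho>(\<theta>)) = O(n^(-2)), and solving
  n\<theta> - \<rho>(\<theta>) = k\<pi> + O(n^(-2)) to second order gives the expansion.

  Conversely, an exact solution of sin(n\<theta> - \<rho>(\<theta>)) = 0 yields an approximate eigenvector, hence a nearby
  eigenvalue. Two distinct eigenvalues belonging to the same k would, by interlacing, have an eigenvalue f(\<psi>)
  of T_(N-1)(f) nearby, and subtracting the phase conditions for n and n - 1 would put \<psi> close to a multiple of \<pi>.
\<close>

section \<open>Approximate eigenvectors of symmetric matrices\<close>

text \<open>Two difficulties shape the proof. The quasi-mode for a given k has residual O(n^(-2)) in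
  each of its N + 1 entries, so it locates an eigenvalue only up to O(n^(-3/2)). This is far from
  the n^(-3) of the theorem, but it is smaller than the grid spacing: it pins down the index k, and
  the phase condition, which every eigenvalue satisfies with error O(n^(-2)), then supplies the
  accuracy. The other difficulty is regularity. The term of second order contains the derivative of
  \<rho>, and the expansion needs a remainder quadratic in the step, so \<rho> has to be C^(1,1).
  For f in C^4 the quotient H is only known to be C^3, and the decay k^(-3) of the coefficients of
  ln H alone would still allow the series of k^2 |b k| to diverge logarithmically. Bessel's
  inequality gives its convergence, with a bound uniform in \<theta>. Uniformity in \<theta> is
  needed throughout. Hence the estimates for a fixed \<theta> live in a locale whose parameters
  include all constants, and these are supplied afterwards independently of \<theta>.\<close>

lemma symmetric_approx_eigenvalue:
  fixes S :: "nat \<Rightarrow> nat \<Rightarrow> real" and x :: "nat \<Rightarrow> real"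
  assumes sym: "\<And>i j. S i j = S j i"
    and x: "\<exists>i<d. x i \<noteq> 0"
    and r: "r \<ge> 0" "(\<Sum>i<d. ((\<Sum>j<d. S i j * x j) - m * x i)\<^sup>2) \<le> r\<^sup>2 * (\<Sum>i<d. (x i)\<^sup>2)"
  shows "\<exists>\<mu> y. \<bar>\<mu> - m\<bar> \<le> r \<and> (\<exists>i<d. y i \<noteq> 0) \<and> (\<forall>i<d. (\<Sum>j<d. S i j * y j) = \<mu> * y i)"
proof -
  define A where "A x i = (\<Sum>j<d. S i j * x j) - m * x i" for x :: "nat \<Rightarrow> real" and i
  define ip where "ip x y = (\<Sum>i<d. x i * y i)" for x y :: "nat \<Rightarrow> real"
  \<comment> \<open>The minimiser z of |Au| on the unit sphere satisfies A (A z) = s^2 z, so A z + s z or z itself is an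
    eigenvector of A for s or -s.\<close>
  define K where "K = Pi UNIV (\<lambda>i. if i < d then {-1..1} else {0::real}) \<inter> {x. ip x x = 1}"
  have ip_add: "ip (\<lambda>i. u i + t * v i) (\<lambda>i. u i + t * v i) = ip u u + 2 * t * ip u v + t\<^sup>2 * ip v v" for u v t
    by (simp add: ip_def sum_distrib_left sum.distrib[symmetric] power2_eq_square algebra_simps)
  have ip_pos: "ip u u > 0" if "\<exists>i<d. u i \<noteq> 0" for u
  proof -
    from that obtain i where "i < d" "u i \<noteq> 0" by auto
    then show ?thesis unfolding ip_def by (intro sum_pos2[where i=i]) (auto simp: zero_less_mult_iff)
  qed
  have A_lin: "A (\<lambda>i. u i + t * v i) i = A u i + t * A v i" for u v t i
    by (simp add: A_def algebra_simps sum.distrib sum_distrib_left)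
  have A_scale: "A (\<lambda>i. t * v i) i = t * A v i" for v t i
    by (simp add: A_def algebra_simps sum_distrib_left)
  have A_cong: "A u i = A v i" if "\<And>i. i < d \<Longrightarrow> u i = v i" "i < d" for u v i
    using that by (simp add: A_def)
  have ip_cong: "ip u v = ip u' v'" if "\<And>i. i < d \<Longrightarrow> u i = u' i" "\<And>i. i < d \<Longrightarrow> v i = v' i" for u v u' v'
    using that by (simp add: ip_def)
  have A_sym: "ip (A u) v = ip u (A v)" for u v
  proof -
    have "(\<Sum>i<d. (\<Sum>j<d. S i j * u j) * v i) = (\<Sum>i<d. \<Sum>j<d. S i j * u j * v i)"
      by (simp add: sum_distrib_right)
    also have "\<dots> = (\<Sum>j<d. \<Sum>i<d. S i j * u j * v i)" by (rule sum.swap)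
    also have "\<dots> = (\<Sum>j<d. u j * (\<Sum>i<d. S j i * v i))"
      by (simp add: sum_distrib_left sym mult_ac)
    finally show ?thesis by (simp add: ip_def A_def algebra_simps sum_subtractf)
  qed
  \<comment> \<open>Vectors are functions on all of nat that vanish beyond \<open>d\<close>, so
    compactness of the cube is Tychonoff's theorem in the product topology.\<close>
  have "compact (Pi UNIV (\<lambda>i. if i < d then {-1..1} else {0::real}))"
    using compactin_PiE[of "\<lambda>_::nat. euclidean::real topology" UNIV "\<lambda>i. if i < d then {-1..1} else {0}"]
    by (simp add: euclidean_product_topology PiE_UNIV_domain)
  moreover have "closed {x. ip x x = 1}"
    unfolding ip_def by (intro closed_Collect_eq continuous_intros) auto
  ultimately have K: "compact K" unfolding K_def by (rule compact_Int_closed)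
  have norm_K: "\<exists>t>0. (\<lambda>i. if i < d then t * u i else 0) \<in> K \<and> t\<^sup>2 * ip u u = 1" if "\<exists>i<d. u i \<noteq> 0" for u
  proof (intro exI[of _ "1 / sqrt (ip u u)"] conjI)
    have p: "ip u u > 0" using ip_pos[OF that] .
    then show "1 / sqrt (ip u u) > 0" by simp
    show *: "(1 / sqrt (ip u u))\<^sup>2 * ip u u = 1" using p by (simp add: power_divide)
    have "\<bar>u i\<bar> \<le> sqrt (ip u u)" if "i < d" for i
    proof -
      have "(u i)\<^sup>2 \<le> ip u u" unfolding ip_def power2_eq_square
        by (rule member_le_sum[of i "{..<d}" "\<lambda>i. u i * u i"]) (use that in auto)
      then show ?thesis by (simp add: real_le_rsqrt)
    qed
    then have b: "- 1 \<le> 1 / sqrt (ip u u) * u i \<and> 1 / sqrt (ip u u) * u i \<le> 1" if "i < d" for i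
      using p that by (force simp: field_simps abs_le_iff)
    have "ip (\<lambda>i. if i < d then t * u i else 0) (\<lambda>i. if i < d then t * u i else 0) = t\<^sup>2 * ip u u" for t
      unfolding ip_def by (simp add: sum_distrib_left power2_eq_square algebra_simps)
    then show "(\<lambda>i. if i < d then 1 / sqrt (ip u u) * u i else 0) \<in> K"
      using b * unfolding K_def by (auto simp: Pi_iff simp del: times_divide_eq_left)
  qed
  have "K \<noteq> {}" using norm_K[OF x] by auto
  moreover have "continuous_on K (\<lambda>x. ip (A x) (A x))"
    unfolding ip_def A_def by (intro continuous_intros continuous_on_subset[OF continuous_on_product_coordinates]) auto
  ultimately obtain z where z: "z \<in> K" and zmin: "\<And>y. y \<in> K \<Longrightarrow> ip (A z) (A z) \<le> ip (A y) (A y)"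
    using continuous_attains_inf[OF K] by blast
  have z1: "ip z z = 1" using z by (simp add: K_def)
  define s2 where "s2 = ip (A z) (A z)"
  have s2: "s2 \<ge> 0" unfolding s2_def ip_def by (intro sum_nonneg) auto
  \<comment> \<open>Homogeneity carries minimality from the unit sphere to every vector.\<close>
  have ge: "s2 * ip u u \<le> ip (A u) (A u)" for u
  proof (cases "\<exists>i<d. u i \<noteq> 0")
    case True
    from norm_K[OF this] obtain t where t: "t > 0" "(\<lambda>i. if i < d then t * u i else 0) \<in> K" "t\<^sup>2 * ip u u = 1" by auto
    have "s2 \<le> ip (A (\<lambda>i. if i < d then t * u i else 0)) (A (\<lambda>i. if i < d then t * u i else 0))"
      unfolding s2_def by (rule zmin[OF t(2)])
    also have "\<dots> = ip (\<lambda>i. t * A u i) (\<lambda>i. t * A u i)"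
      by (intro ip_cong; subst A_scale[symmetric]; rule A_cong) auto
    also have "\<dots> = t\<^sup>2 * ip (A u) (A u)"
      by (simp add: ip_def sum_distrib_left power2_eq_square algebra_simps)
    finally have "s2 * (t\<^sup>2 * ip u u) \<le> t\<^sup>2 * ip (A u) (A u)" using t(3) by simp
    then have "t\<^sup>2 * (s2 * ip u u) \<le> t\<^sup>2 * ip (A u) (A u)" by (simp add: algebra_simps)
    then show ?thesis using t(1) by simp
  next
    case False
    then have "ip u u = 0" by (simp add: ip_def)
    moreover have "ip (A u) (A u) \<ge> 0" unfolding ip_def by (intro sum_nonneg) auto
    ultimately show ?thesis by simp
  qed
  have lin0: "b = 0" if "\<And>t::real. 0 \<le> t * b + t\<^sup>2 * c" for b c :: real
  proof (rule ccontr)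
    assume "b \<noteq> 0"
    \<comment> \<open>With e = |c| + 1 the choice t = -b/e gives t b + t^2 |c| = -b^2/e^2, which is
      negative unless b = 0.\<close>
    have "0 \<le> (- b / (\<bar>c\<bar> + 1)) * b + (- b / (\<bar>c\<bar> + 1))\<^sup>2 * c" by (rule that)
    also have "\<dots> \<le> (- b / (\<bar>c\<bar> + 1)) * b + (- b / (\<bar>c\<bar> + 1))\<^sup>2 * \<bar>c\<bar>"
      by (intro add_left_mono mult_left_mono) auto
    also have "\<dots> = - (b\<^sup>2 / (\<bar>c\<bar> + 1)\<^sup>2)"
    proof -
      have "(- b / e) * b + (- b / e)\<^sup>2 * (e - 1) = - (b\<^sup>2 / e\<^sup>2)" if "e > 0" for e
        using that by (simp add: field_simps power2_eq_square)
      from this[of "\<bar>c\<bar> + 1"] show ?thesis by simp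
    qed
    finally have "b\<^sup>2 / (\<bar>c\<bar> + 1)\<^sup>2 \<le> 0" by simp
    moreover have "b\<^sup>2 / (\<bar>c\<bar> + 1)\<^sup>2 > 0" using \<open>b \<noteq> 0\<close> by (intro divide_pos_pos) (auto simp: zero_less_power2)
    ultimately show False by simp
  qed
  \<comment> \<open>First variation: the quadratic polynomial |A(z + ty)|^2 - s2 |z + ty|^2 in t is
    nonnegative and vanishes at t = 0, so its linear coefficient is zero.\<close>
  have crit: "ip (A z) (A y) = s2 * ip z y" for y
  proof -
    have "2 * (ip (A z) (A y) - s2 * ip z y) = 0"
    proof (rule lin0[where c = "ip (A y) (A y) - s2 * ip y y"])
      fix t
      have "s2 * ip (\<lambda>i. z i + t * y i) (\<lambda>i. z i + t * y i) \<le> ip (A (\<lambda>i. z i + t * y i)) (A (\<lambda>i. z i + t * y i))"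
        by (rule ge)
      also have "A (\<lambda>i. z i + t * y i) = (\<lambda>i. A z i + t * A y i)" by (rule ext) (rule A_lin)
      finally show "0 \<le> t * (2 * (ip (A z) (A y) - s2 * ip z y)) + t\<^sup>2 * (ip (A y) (A y) - s2 * ip y y)"
        unfolding ip_add using z1 s2_def by (simp add: algebra_simps)
    qed
    then show ?thesis by simp
  qed
  have AAz: "A (A z) i = s2 * z i" if "i < d" for i
  proof -
    define e where "e j = (if j = i then 1 else 0 :: real)" for j
    have "ip (A (A z)) e = s2 * ip z e" using crit[of e] by (simp add: A_sym)
    then show ?thesis using that by (simp add: ip_def e_def if_distrib cong: if_cong)
  qed
  define s where "s = sqrt s2"
  have ss: "s * s = s2" "s \<ge> 0" using s2 by (auto simp: s_def)
  \<comment> \<open>The given approximate eigenvector \<open>x\<close> is a competitor for the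
    minimum, which is how its residual bounds s.\<close>
  have "s2 * ip x x \<le> r\<^sup>2 * ip x x"
    using ge[of x] r(2) by (simp add: ip_def A_def power2_eq_square)
  then have "s2 \<le> r\<^sup>2" using ip_pos[OF x] by simp
  then have sr: "s \<le> r" using r(1) by (simp add: s_def real_le_lsqrt)
  define y where "y i = A z i + s * z i" for i
  show ?thesis
  proof (cases "\<exists>i<d. y i \<noteq> 0")
    case True
    have "A y i = s * y i" if "i < d" for i
    proof -
      have "A y i = A (A z) i + s * A z i" unfolding y_def by (rule A_lin)
      then show ?thesis using AAz[OF that] by (simp add: y_def ss algebra_simps flip: ss(1))
    qed
    then have "\<forall>i<d. (\<Sum>j<d. S i j * y j) = (m + s) * y i" by (simp add: A_def algebra_simps)
    then show ?thesis using True sr ss(2) by (intro exI[of _ "m + s"] exI[of _ y]) auto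
  next
    case False
    then have "\<forall>i<d. (\<Sum>j<d. S i j * z j) = (m - s) * z i" by (auto simp: y_def A_def algebra_simps)
    moreover have "\<exists>i<d. z i \<noteq> 0" using z1 by (auto simp: ip_def intro: ccontr)
    ultimately show ?thesis using sr ss(2) by (intro exI[of _ "m - s"] exI[of _ z]) auto
  qed
qed

section \<open>Power series with cubically decaying coefficients\<close>

lemma sum_inverse_cubes_le: "(\<Sum>i\<le>k. 1 / (1 + real i) ^ 3) \<le> 2"
proof -
  \<comment> \<open>The subtracted term makes the claim inductive: 1/(2 + k)^3 is at most the
    increment 1/(1 + k) - 1/(2 + k).\<close>
  have "(\<Sum>i\<le>k. 1 / (1 + real i) ^ 3) \<le> 2 - 1 / (1 + real k)"
  proof (induction k)
    case (Suc k)
    have "(1 + real k) * (2 + real k) * 1 \<le> (2 + real k) * (2 + real k) * (2 + real k)"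
      by (intro mult_mono) auto
    then have "1 / (2 + real k) ^ 3 \<le> 1 / ((1 + real k) * (2 + real k))"
      by (intro divide_left_mono) (auto simp: power3_eq_cube)
    also have "\<dots> = 1 / (1 + real k) - 1 / (2 + real k)" by (simp add: field_simps)
    finally show ?case using Suc by (simp add: algebra_simps)
  qed simp
  moreover have "1 / (1 + real k) \<ge> 0" by simp
  ultimately show ?thesis by linarith
qed

text \<open>For t \<le> u + v one has t^3 \<le> 8 (u^3 + v^3); dividing by (tuv)^3 splits the
  product into two sums of inverse cubes, each at most 2, whence 32 = 8 (2 + 2). Sequences of cubic
  decay are therefore closed under convolution, at the price of a factor 32.\<close>

lemma convolution_inverse_cubes_le:
  "(\<Sum>i\<le>k. 1 / (1 + real i) ^ 3 * (1 / (1 + real (k - i)) ^ 3)) \<le> 32 / (1 + real k) ^ 3"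
proof -
  have *: "1 / u ^ 3 * (1 / v ^ 3) \<le> 8 / t ^ 3 * (1 / u ^ 3 + 1 / v ^ 3)"
    if "u > 0" "v > 0" "t > 0" "t \<le> u + v" for u v t :: real
  proof -
    have "t ^ 3 \<le> (u + v) ^ 3" using that by (intro power_mono) auto
    also have "\<dots> = 4 * (u ^ 3 + v ^ 3) - 3 * (u + v) * (u - v)\<^sup>2"
      by (simp add: power2_eq_square power3_eq_cube algebra_simps)
    also have "\<dots> \<le> 8 * (u ^ 3 + v ^ 3)"
      using that by (smt (verit) mult_nonneg_nonneg zero_le_power2 zero_less_power)
    finally show ?thesis using that by (simp add: field_simps)
  qed
  have "(\<Sum>i\<le>k. 1 / (1 + real i) ^ 3 * (1 / (1 + real (k - i)) ^ 3))
      \<le> (\<Sum>i\<le>k. 8 / (1 + real k) ^ 3 * (1 / (1 + real i) ^ 3 + 1 / (1 + real (k - i)) ^ 3))"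
    by (intro sum_mono *) (auto simp: of_nat_diff)
  also have "\<dots> = 8 / (1 + real k) ^ 3 * ((\<Sum>i\<le>k. 1 / (1 + real i) ^ 3) + (\<Sum>i\<le>k. 1 / (1 + real (k - i)) ^ 3))"
    by (simp only: sum_distrib_left[symmetric] sum.distrib)
  also have "(\<Sum>i\<le>k. 1 / (1 + real (k - i)) ^ 3) = (\<Sum>i\<le>k. 1 / (1 + real i) ^ 3)"
    by (rule sum.reindex_bij_witness[of _ "\<lambda>i. k - i" "\<lambda>i. k - i"]) auto
  also have "8 / (1 + real k) ^ 3 * ((\<Sum>i\<le>k. 1 / (1 + real i) ^ 3) + (\<Sum>i\<le>k. 1 / (1 + real i) ^ 3))
      \<le> 8 / (1 + real k) ^ 3 * (2 + 2)"
    by (intro mult_left_mono add_mono sum_inverse_cubes_le) auto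
  finally show ?thesis by simp
qed

lemma summable_inverse_cubes: "summable (\<lambda>k. 1 / (1 + real k) ^ 3)"
proof (rule summableI_nonneg_bounded)
  show "(\<Sum>i<n. 1 / (1 + real i) ^ 3) \<le> 2" for n
  proof -
    have "(\<Sum>i<n. 1 / (1 + real i) ^ 3) \<le> (\<Sum>i\<le>n. 1 / (1 + real i) ^ 3)"
      by (intro sum_mono2) auto
    with sum_inverse_cubes_le[of n] show ?thesis by linarith
  qed
qed auto

text \<open>Domination by a product makes the partial sums over k, as functions of m, dominated by a
  summable sequence, so Tannery's theorem exchanges the limits. It serves to regroup the exponential
  series by powers of z.\<close>

lemma sums_swap_product_bound:
  fixes u :: "nat \<Rightarrow> nat \<Rightarrow> 'a :: {real_normed_algebra, banach}"
  assumes b: "\<And>m k. norm (u m k) \<le> P m * Q k" and P: "summable P" "\<And>m. P m \<ge> 0" and Q: "summable Q" "\<And>k. Q k \<ge> 0"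
  shows "(\<lambda>k. \<Sum>m. u m k) sums (\<Sum>m. \<Sum>k. u m k)"
proof -
  have sm: "summable (\<lambda>m. u m k)" for k
    by (rule summable_comparison_test[OF _ summable_mult2[OF P(1), of "Q k"]]) (use b in auto)
  have sk: "summable (\<lambda>k. u m k)" for m
    by (rule summable_comparison_test[OF _ summable_mult[OF Q(1), of "P m"]]) (use b in auto)
  have bd: "norm (\<Sum>k<K. u m k) \<le> P m * suminf Q" for m K
  proof -
    have "norm (\<Sum>k<K. u m k) \<le> (\<Sum>k<K. P m * Q k)" by (rule sum_norm_le) (use b in auto)
    also have "\<dots> = P m * (\<Sum>k<K. Q k)" by (simp add: sum_distrib_left)
    also have "\<dots> \<le> P m * suminf Q" by (intro mult_left_mono sum_le_suminf Q P) auto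
    finally show ?thesis .
  qed
  have "((\<lambda>K. \<Sum>m. \<Sum>k<K. u m k) \<longlongrightarrow> (\<Sum>m. \<Sum>k. u m k)) sequentially"
  proof (rule tannerys_theorem[where M = "\<lambda>m. P m * suminf Q", THEN conjunct2, THEN conjunct2])
    show "((\<lambda>K. \<Sum>k<K. u m k) \<longlongrightarrow> (\<Sum>k. u m k)) sequentially" for m
      using sk[of m] by (rule summable_LIMSEQ)
    show "\<forall>\<^sub>F (m, K) in sequentially \<times>\<^sub>F sequentially. norm (\<Sum>k<K. u m k) \<le> P m * suminf Q"
      using bd by (intro always_eventually) auto
  qed (use P summable_mult2 in auto)
  then show ?thesis unfolding sums_def by (simp add: suminf_sum sm)
qed

primrec cauchy_power :: "(nat \<Rightarrow> real) \<Rightarrow> nat \<Rightarrow> nat \<Rightarrow> real" where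
  "cauchy_power b 0 = (\<lambda>k. if k = 0 then 1 else 0)"
| "cauchy_power b (Suc m) = (\<lambda>k. \<Sum>i\<le>k. b i * cauchy_power b m (k - i))"

lemma cauchy_power_bound:
  assumes "\<And>k. \<bar>b k\<bar> \<le> M / (1 + real k) ^ 3"
  shows "\<bar>cauchy_power b m k\<bar> \<le> (32 * M) ^ m / (1 + real k) ^ 3"
proof (induction m arbitrary: k)
  case (Suc m)
  have M: "M \<ge> 0" using assms[of 0] by simp
  have "\<bar>cauchy_power b (Suc m) k\<bar> \<le> (\<Sum>i\<le>k. \<bar>b i\<bar> * \<bar>cauchy_power b m (k - i)\<bar>)"
    by (simp add: order_trans[OF sum_abs] abs_mult)
  also have "\<dots> \<le> (\<Sum>i\<le>k. (M / (1 + real i) ^ 3) * ((32 * M) ^ m / (1 + real (k - i)) ^ 3))"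
    by (intro sum_mono mult_mono assms Suc) (use M in auto)
  also have "\<dots> = M * (32 * M) ^ m * (\<Sum>i\<le>k. 1 / (1 + real i) ^ 3 * (1 / (1 + real (k - i)) ^ 3))"
    by (simp add: sum_distrib_left)
  also have "\<dots> \<le> M * (32 * M) ^ m * (32 / (1 + real k) ^ 3)"
    by (intro mult_left_mono convolution_inverse_cubes_le) (use M in auto)
  finally show ?case by (simp add: mult_ac)
qed simp

lemma cauchy_power_sums:
  fixes z :: complex
  assumes b: "\<And>k. \<bar>b k\<bar> \<le> M / (1 + real k) ^ 3" and z: "norm z \<le> 1"
  shows "(\<lambda>k. of_real (cauchy_power b m k) * z ^ k) sums (\<Sum>k. of_real (b k) * z ^ k) ^ m"
proof (induction m)
  case 0
  have "(\<lambda>k. of_real (cauchy_power b 0 k) * z ^ k) = (\<lambda>k. if k = 0 then 1 else 0)" by auto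
  then show ?case using sums_If_finite[of "\<lambda>k. k = 0" "\<lambda>_. 1::complex"] by simp
next
  case (Suc m)
  have sumc: "summable (\<lambda>k. norm (of_real (c k) * z ^ k))" if "\<And>k. \<bar>c k\<bar> \<le> M' / (1 + real k) ^ 3" for c :: "nat \<Rightarrow> real" and M'
  proof (rule summable_comparison_test[OF _ summable_mult[OF summable_inverse_cubes, of M']])
    have "\<bar>c k\<bar> * norm z ^ k \<le> M' / (1 + real k) ^ 3 * 1" for k
      using order_trans[OF abs_ge_zero that[of k]] by (intro mult_mono that power_le_one z) auto
    then show "\<exists>N. \<forall>n\<ge>N. norm (norm (of_real (c n) * z ^ n)) \<le> M' * (1 / (1 + real n) ^ 3)"
      by (simp add: norm_mult norm_power)
  qed
  have "(\<lambda>k. \<Sum>i\<le>k. (of_real (b i) * z ^ i) * (of_real (cauchy_power b m (k - i)) * z ^ (k - i)))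
      sums ((\<Sum>k. of_real (b k) * z ^ k) * (\<Sum>k. of_real (cauchy_power b m k) * z ^ k))"
    by (intro Cauchy_product_sums sumc[OF b] sumc[OF cauchy_power_bound[OF b]])
  also have "(\<lambda>k. \<Sum>i\<le>k. (of_real (b i) * z ^ i) * (of_real (cauchy_power b m (k - i)) * z ^ (k - i)))
      = (\<lambda>k. of_real (cauchy_power b (Suc m) k) * z ^ k)"
  proof (rule ext)
    fix k
    have "(\<Sum>i\<le>k. (of_real (b i) * z ^ i) * (of_real (cauchy_power b m (k - i)) * z ^ (k - i)))
       = (\<Sum>i\<le>k. of_real (b i) * of_real (cauchy_power b m (k - i)) * z ^ k)"
      by (intro sum.cong refl) (auto simp: mult_ac simp flip: power_add)
    then show "(\<Sum>i\<le>k. (of_real (b i) * z ^ i) * (of_real (cauchy_power b m (k - i)) * z ^ (k - i)))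
       = of_real (cauchy_power b (Suc m) k) * z ^ k"
      by (simp add: sum_distrib_right)
  qed
  also have "(\<Sum>k. of_real (cauchy_power b m k) * z ^ k) = (\<Sum>k. of_real (b k) * z ^ k) ^ m"
    using Suc by (simp add: sums_iff)
  finally show ?case by simp
qed

text \<open>The m-th power of the series costs a factor (32 M)^m, which the 1/m! of the exponential
  absorbs. Hence exponentiation preserves cubic decay, with a constant that depends on
  \<open>M\<close> alone. Applied to -b and to b it yields the Taylor coefficients of 1/D and of
  D.\<close>

lemma exp_power_series:
  assumes b: "\<And>k. \<bar>b k\<bar> \<le> M / (1 + real k) ^ 3"
  obtains d :: "nat \<Rightarrow> real" where "\<And>k. \<bar>d k\<bar> \<le> exp (32 * M) / (1 + real k) ^ 3"
    "\<And>z::complex. norm z \<le> 1 \<Longrightarrow> (\<lambda>k. of_real (d k) * z ^ k) sums exp (\<Sum>k. of_real (b k) * z ^ k)"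
proof
  define d where "d k = (\<Sum>m. cauchy_power b m k / fact m)" for k
  have M: "M \<ge> 0" using b[of 0] by simp
  have P: "(\<lambda>m. (32 * M) ^ m / fact m) sums exp (32 * M)"
    using exp_converges[of "32 * M"] by (simp add: field_simps)
  have bd: "\<bar>cauchy_power b m k / fact m\<bar> \<le> (32 * M) ^ m / fact m * (1 / (1 + real k) ^ 3)" for m k
    using divide_right_mono[OF cauchy_power_bound[OF b, of m k], of "fact m"] by (simp add: abs_divide field_simps)
  have sd: "summable (\<lambda>m. \<bar>cauchy_power b m k / fact m\<bar>)" for k
    by (rule summable_comparison_test[OF _ summable_mult2[OF sums_summable[OF P], of "1 / (1 + real k) ^ 3"]])
       (use bd in auto)
  show "\<bar>d k\<bar> \<le> exp (32 * M) / (1 + real k) ^ 3" for k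
  proof -
    have "\<bar>d k\<bar> \<le> (\<Sum>m. \<bar>cauchy_power b m k / fact m\<bar>)" unfolding d_def by (rule summable_rabs[OF sd])
    also have "\<dots> \<le> (\<Sum>m. (32 * M) ^ m / fact m * (1 / (1 + real k) ^ 3))"
      by (intro suminf_le bd sd summable_mult2 sums_summable[OF P])
    also have "\<dots> = exp (32 * M) * (1 / (1 + real k) ^ 3)"
      using sums_mult2[OF P, of "1 / (1 + real k) ^ 3"] by (simp only: sums_iff)
    finally show ?thesis by simp
  qed
  show "(\<lambda>k. of_real (d k) * z ^ k) sums exp (\<Sum>k. of_real (b k) * z ^ k)" if z: "norm z \<le> 1" for z :: complex
  proof -
    define u where "u m k = of_real (cauchy_power b m k / fact m) * z ^ k" for m k
    have "(\<lambda>k. \<Sum>m. u m k) sums (\<Sum>m. \<Sum>k. u m k)"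
    proof (rule sums_swap_product_bound)
      show "norm (u m k) \<le> (32 * M) ^ m / fact m * (1 / (1 + real k) ^ 3)" for m k
      proof -
        have "norm (u m k) = \<bar>cauchy_power b m k / fact m\<bar> * norm z ^ k"
          unfolding u_def norm_mult norm_power norm_of_real ..
        also have "\<dots> \<le> (32 * M) ^ m / fact m * (1 / (1 + real k) ^ 3) * 1"
          by (intro mult_mono bd power_le_one z) (use M in auto)
        finally show ?thesis by simp
      qed
      show "summable (\<lambda>m. (32 * M) ^ m / fact m)" using P by (rule sums_summable)
      show "summable (\<lambda>k. 1 / (1 + real k) ^ 3)" by (rule summable_inverse_cubes)
    qed (use M in auto)
    moreover have "(\<Sum>m. u m k) = of_real (d k) * z ^ k" for k
    proof -
      have "summable (\<lambda>m. cauchy_power b m k / fact m)" by (rule summable_rabs_cancel[OF sd])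
      then have "(\<Sum>m. of_real (cauchy_power b m k / fact m)) = (of_real (d k) :: complex)"
        unfolding d_def by (rule suminf_of_real[symmetric])
      moreover have "summable (\<lambda>m. (of_real (cauchy_power b m k / fact m) :: complex))"
        using \<open>summable (\<lambda>m. cauchy_power b m k / fact m)\<close> by (rule summable_of_real)
      ultimately show ?thesis unfolding u_def by (simp only: suminf_mult2[symmetric])
    qed
    moreover have "(\<Sum>k. u m k) = (\<Sum>k. of_real (b k) * z ^ k) ^ m /\<^sub>R fact m" for m
    proof -
      have "(\<lambda>k. (1 / fact m) *\<^sub>R (of_real (cauchy_power b m k) * z ^ k)) sums ((1 / fact m) *\<^sub>R (\<Sum>k. of_real (b k) * z ^ k) ^ m)"
        by (intro sums_scaleR_right cauchy_power_sums[OF b z])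
      moreover have "(\<lambda>k. (1 / fact m) *\<^sub>R (of_real (cauchy_power b m k) * z ^ k)) = u m"
        by (auto simp: u_def scaleR_conv_of_real)
      ultimately show ?thesis by (simp add: sums_iff inverse_eq_divide)
    qed
    ultimately show ?thesis by (simp add: exp_def)
  qed
qed

text \<open>One of the three factors is bounded below by n, and the other two are compared with a
  telescoping series. The shift by 2 is what remains of 1 + l when a tail starts at l = n +
  1.\<close>

lemma tail_inverse_cubes:
  assumes "n \<ge> 1"
  shows "summable (\<lambda>i. 1 / (real n + 2 + real i) ^ 3)" "(\<Sum>i. 1 / (real n + 2 + real i) ^ 3) \<le> 1 / (real n)\<^sup>2"
proof -
  have *: "(\<Sum>i<K. 1 / (real n + 2 + real i) ^ 3) \<le> 1 / (real n)\<^sup>2" for K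
  proof -
    have n: "real n \<ge> 1" using assms by simp
    have "(\<Sum>i<K. 1 / (real n + 2 + real i) ^ 3) \<le> (\<Sum>i<K. 1 / real n * (1 / (real n + real i) - 1 / (real n + real (Suc i))))"
    proof (rule sum_mono)
      fix i
      have "1 / (real n + 2 + real i) ^ 3 \<le> 1 / (real n * ((real n + real i) * (real n + real (Suc i))))"
        unfolding power3_eq_cube by (intro divide_left_mono) (use n in \<open>auto simp: mult.assoc intro!: mult_mono mult_pos_pos\<close>)
      also have "\<dots> = 1 / real n * (1 / (real n + real i) - 1 / (real n + real (Suc i)))"
        using n by (simp add: field_simps)
      finally show "1 / (real n + 2 + real i) ^ 3 \<le> 1 / real n * (1 / (real n + real i) - 1 / (real n + real (Suc i)))" .
    qed
    also have "\<dots> = 1 / real n * (1 / real n - 1 / (real n + real K))"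
      using sum_lessThan_telescope'[of "\<lambda>i. 1 / (real n + real i)" K] by (simp only: sum_distrib_left[symmetric]) simp
    also have "\<dots> \<le> 1 / real n * (1 / real n)" by (intro mult_left_mono) auto
    finally show ?thesis by (simp add: power2_eq_square)
  qed
  show s: "summable (\<lambda>i. 1 / (real n + 2 + real i) ^ 3)"
    by (rule summableI_nonneg_bounded[OF _ *]) auto
  show "(\<Sum>i. 1 / (real n + 2 + real i) ^ 3) \<le> 1 / (real n)\<^sup>2"
    by (rule suminf_le_const[OF s *])
qed

section \<open>Approximate kernels of positive Toeplitz matrices\<close>

text \<open>The coefficients of (1 - 2 x z + z^2) p(z).\<close>

definition quad_mult :: "real \<Rightarrow> (nat \<Rightarrow> real) \<Rightarrow> nat \<Rightarrow> real" where
  "quad_mult x p l = p l - 2 * x * (if l \<ge> 1 then p (l - 1) else 0) + (if l \<ge> 2 then p (l - 2) else 0)"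

lemma sum_shift1: "(\<Sum>l\<le>N + 2. F l * (if l \<ge> 1 then p (l - 1) else 0)) = (\<Sum>l\<le>N + 1. F (l + 1) * p l)"
  for F :: "nat \<Rightarrow> 'a::comm_ring"
  by (simp add: sum.atMost_Suc_shift eval_nat_numeral del: sum.atMost_Suc)

lemma sum_shift2: "(\<Sum>l\<le>N + 2. F l * (if l \<ge> 2 then p (l - 2) else 0)) = (\<Sum>l\<le>N. F (l + 2) * p l)"
  for F :: "nat \<Rightarrow> 'a::comm_ring"
  by (simp add: sum.atMost_Suc_shift eval_nat_numeral del: sum.atMost_Suc)

lemma sum_quad_mult:
  fixes F :: "nat \<Rightarrow> 'a::{comm_ring_1, real_algebra_1}"
  assumes "\<And>l. l > N \<Longrightarrow> p l = 0"
  shows "(\<Sum>l\<le>N + 2. F l * of_real (quad_mult x p l)) = (\<Sum>l\<le>N. (F l - 2 * of_real x * F (l + 1) + F (l + 2)) * of_real (p l))"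
proof -
  have s0: "(\<Sum>l\<le>N + 2. F l * of_real (p l)) = (\<Sum>l\<le>N. F l * of_real (p l))"
    by (rule sum.mono_neutral_right) (auto simp: assms)
  have s1: "(\<Sum>l\<le>N + 1. F (l + 1) * of_real (p l)) = (\<Sum>l\<le>N. F (l + 1) * of_real (p l))"
    by (rule sum.mono_neutral_right) (auto simp: assms)
  have "(\<Sum>l\<le>N + 2. F l * of_real (quad_mult x p l)) =
     (\<Sum>l\<le>N + 2. F l * of_real (p l)) - 2 * of_real x * (\<Sum>l\<le>N + 2. F l * (if l \<ge> 1 then of_real (p (l - 1)) else 0))
     + (\<Sum>l\<le>N + 2. F l * (if l \<ge> 2 then of_real (p (l - 2)) else 0))"
    unfolding sum_distrib_left sum.distrib[symmetric] sum_subtractf[symmetric]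
    by (intro sum.cong refl) (auto simp: quad_mult_def algebra_simps)
  also have "\<dots> = (\<Sum>l\<le>N. F l * of_real (p l)) - 2 * of_real x * (\<Sum>l\<le>N. F (l + 1) * of_real (p l)) + (\<Sum>l\<le>N. F (l + 2) * of_real (p l))"
    using sum_shift1[of F "\<lambda>l. of_real (p l)" N] sum_shift2[of F "\<lambda>l. of_real (p l)" N] s0 s1 by simp
  also have "\<dots> = (\<Sum>l\<le>N. (F l - 2 * of_real x * F (l + 1) + F (l + 2)) * of_real (p l))"
    unfolding sum_distrib_left sum.distrib[symmetric] sum_subtractf[symmetric]
    by (intro sum.cong refl) (auto simp: algebra_simps)
  finally show ?thesis .
qed

text \<open>On the unit circle cos \<theta> - cos t = -(1 - 2 z cos \<theta> + z^2) / (2z). The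
  factor 1/z is the shift of the row index: rows 0, ..., N of the system for f - f(\<theta>) become
  rows 1, ..., n - 1 of the Toeplitz system of H, so that its first and last rows carry no
  information.\<close>

lemma toeplitz_quad_mult:
  fixes g :: "int \<Rightarrow> real"
  assumes "\<And>l. l > N \<Longrightarrow> p l = 0"
  shows "(\<Sum>l\<le>N. (x * g (int k - int l) - (g (int k - int l - 1) + g (int k - int l + 1)) / 2) * p l)
       = - (\<Sum>l\<le>N + 2. g (int (k + 1) - int l) * quad_mult x p l) / 2"
proof -
  have "(\<Sum>l\<le>N + 2. g (int (k + 1) - int l) * quad_mult x p l)
      = (\<Sum>l\<le>N. (g (int (k + 1) - int l) - 2 * x * g (int (k + 1) - int (l + 1)) + g (int (k + 1) - int (l + 2))) * p l)"
    using sum_quad_mult[of N p "\<lambda>l. g (int (k + 1) - int l)" x, OF assms] by simp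
  moreover have "- (\<Sum>l\<le>N. (g (int (k + 1) - int l) - 2 * x * g (int (k + 1) - int (l + 1)) + g (int (k + 1) - int (l + 2))) * p l) / 2
      = (\<Sum>l\<le>N. (x * g (int k - int l) - (g (int k - int l - 1) + g (int k - int l + 1)) / 2) * p l)"
    unfolding sum_negf[symmetric] sum_divide_distrib
    by (intro sum.cong refl) (simp add: field_simps)
  ultimately show ?thesis by simp
qed

text \<open>The quadratic factor has constant term 1, so p can be recovered from the product
  coefficient by coefficient.\<close>

lemma quad_mult_eq_0_imp:
  assumes "\<And>l. l \<le> N + 2 \<Longrightarrow> quad_mult x p l = 0" "l \<le> N"
  shows "p l = 0"
  using assms(2)
proof (induction l rule: less_induct)
  case (less l)
  have "p (l - 1) = 0" if "l \<ge> 1" using less that by auto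
  moreover have "p (l - 2) = 0" if "l \<ge> 2" using less that by auto
  ultimately show ?case using assms(1)[of l] less.prems by (auto simp: quad_mult_def split: if_splits)
qed

lemma cis_quadratic: "1 - 2 * of_real (cos \<theta>) * cis \<theta> + (cis \<theta>)\<^sup>2 = 0"
  by (simp add: complex_eq_iff power2_eq_square) (simp add: algebra_simps flip: power2_eq_square)

lemma quad_mult_cis:
  assumes "\<And>l. l > N \<Longrightarrow> p l = 0"
  shows "(\<Sum>l\<le>N + 2. of_real (quad_mult (cos \<theta>) p l) * cis \<theta> ^ l) = 0"
proof -
  have "(\<Sum>l\<le>N + 2. cis \<theta> ^ l * of_real (quad_mult (cos \<theta>) p l)) =
     (\<Sum>l\<le>N. (cis \<theta> ^ l - 2 * of_real (cos \<theta>) * cis \<theta> ^ (l + 1) + cis \<theta> ^ (l + 2)) * of_real (p l))"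
    by (rule sum_quad_mult[OF assms])
  also have "\<dots> = (\<Sum>l\<le>N. (cis \<theta> ^ l * (1 - 2 * of_real (cos \<theta>) * cis \<theta> + (cis \<theta>)\<^sup>2)) * of_real (p l))"
    by (intro sum.cong refl) (simp add: algebra_simps power2_eq_square)
  finally show ?thesis unfolding cis_quadratic by (simp add: mult.commute)
qed

text \<open>Here g are the Fourier coefficients of H, d the Taylor coefficients of 1/D, and W = (1/D)(exp(i\<theta>));
  \<open>orth\<close> says that H/D, the complex conjugate of D on the circle, has no positive frequencies.\<close>

locale toeplitz_data =
  fixes g :: "int \<Rightarrow> real" and d :: "nat \<Rightarrow> real" and \<theta> \<rho> w G B c c0 :: real and W :: complex
  assumes g_even: "\<And>j. g (- j) = g j"
    and g_sum: "summable (\<lambda>i. \<bar>g (int i)\<bar>)" "(\<Sum>i. \<bar>g (int i)\<bar>) \<le> G"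
    and c_pos: "c > 0" and c0_pos: "c0 > 0"
    and pos_def: "\<And>n x. c * (\<Sum>i<n. (x i)\<^sup>2) \<le> (\<Sum>i<n. \<Sum>j<n. g (int i - int j) * x i * x j)"
    and d_bound: "\<And>l. \<bar>d l\<bar> \<le> B / (1 + real l) ^ 3" and d_0: "d 0 \<ge> c0"
    and orth: "\<And>k. k \<ge> 1 \<Longrightarrow> (\<lambda>l. g (int k - int l) * d l) sums 0"
    and d_sums: "(\<lambda>l. of_real (d l) * cis \<theta> ^ l) sums W"
    and W_eq: "W = of_real w * cis (\<rho> / 2)" and w_ge: "w \<ge> c0"
begin

lemma B_nonneg: "B \<ge> 0" using d_bound[of 0] by simp

lemma G_nonneg: "G \<ge> 0"
  using g_sum suminf_nonneg[OF g_sum(1)] by simp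

lemma g_le: "\<bar>g j\<bar> \<le> G"
proof -
  have "\<bar>g (int (nat \<bar>j\<bar>))\<bar> \<le> (\<Sum>i. \<bar>g (int i)\<bar>)"
    using sum_le_suminf[OF g_sum(1), of "{nat \<bar>j\<bar>}"] by simp
  moreover have "g (int (nat \<bar>j\<bar>)) = g j" using g_even[of j] by (cases "j \<ge> 0") auto
  ultimately show ?thesis using g_sum(2) by simp
qed

text \<open>By \<open>orth\<close> the truncated sum is minus the tail over l > n. There d is
  O(n^(-3)), and the values of g have distinct indices, so that their absolute values sum to at most
  \<open>G\<close>. No factor n is lost.\<close>

lemma defect_bound:
  assumes "k \<ge> 1" "k \<le> n" "n \<ge> 1"
  shows "\<bar>\<Sum>l\<le>n. g (int k - int l) * d l\<bar> \<le> B * G / real n ^ 3"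
proof -
  have s: "(\<lambda>l. g (int k - int l) * d l) sums 0" using orth assms by simp
  have s2: "summable (\<lambda>i. \<bar>g (int (i + (n + 1 - k)))\<bar>)"
    using summable_ignore_initial_segment[OF g_sum(1)] by simp
  have le: "(\<Sum>i. \<bar>g (int (i + (n + 1 - k)))\<bar>) \<le> G"
  proof -
    have "0 \<le> (\<Sum>i<n + 1 - k. \<bar>g (int i)\<bar>)" by (rule sum_nonneg) simp
    with suminf_minus_initial_segment[OF g_sum(1), of "n + 1 - k"] g_sum(2) show ?thesis by linarith
  qed
  have trm: "\<bar>g (int k - int (i + (n + 1))) * d (i + (n + 1))\<bar> \<le> B / real n ^ 3 * \<bar>g (int (i + (n + 1 - k)))\<bar>" for i
  proof -
    have "int k - int (i + (n + 1)) = - int (i + (n + 1 - k))" using assms by auto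
    then have "\<bar>g (int k - int (i + (n + 1)))\<bar> = \<bar>g (int (i + (n + 1 - k)))\<bar>" using g_even by metis
    moreover have "\<bar>d (i + (n + 1))\<bar> \<le> B / real n ^ 3"
    proof -
      have "B / (1 + real (i + (n + 1))) ^ 3 \<le> B / real n ^ 3"
        using B_nonneg assms by (intro divide_left_mono power_mono) (auto intro!: mult_pos_pos zero_less_power)
      with d_bound[of "i + (n + 1)"] show ?thesis by simp
    qed
    ultimately show ?thesis unfolding abs_mult by (metis abs_ge_zero mult.commute mult_left_mono)
  qed
  have sa: "summable (\<lambda>i. \<bar>g (int k - int (i + (n + 1))) * d (i + (n + 1))\<bar>)"
    by (rule summable_comparison_test[OF _ summable_mult[OF s2, of "B / real n ^ 3"]]) (use trm in auto)
  have "(\<Sum>l\<le>n. g (int k - int l) * d l) = - (\<Sum>i. g (int k - int (i + (n + 1))) * d (i + (n + 1)))"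
    using suminf_split_initial_segment[OF sums_summable[OF s], of "n + 1"] s by (simp add: sums_iff lessThan_Suc_atMost)
  also have "\<bar>\<dots>\<bar> \<le> (\<Sum>i. \<bar>g (int k - int (i + (n + 1))) * d (i + (n + 1))\<bar>)"
    using summable_rabs[OF sa] by simp
  also have "\<dots> \<le> (\<Sum>i. B / real n ^ 3 * \<bar>g (int (i + (n + 1 - k)))\<bar>)"
    by (intro suminf_le trm sa summable_mult s2)
  also have "\<dots> = B / real n ^ 3 * (\<Sum>i. \<bar>g (int (i + (n + 1 - k)))\<bar>)"
    by (rule suminf_mult[OF s2])
  also have "\<dots> \<le> B / real n ^ 3 * G" by (intro mult_left_mono le) (use B_nonneg in auto)
  finally show ?thesis by simp
qed

lemma truncation_bound:
  assumes "n \<ge> 1"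
  shows "norm ((\<Sum>l\<le>n. of_real (d l) * cis \<theta> ^ l) - W) \<le> B / (real n)\<^sup>2"
proof -
  have trm: "norm (of_real (d (i + (n + 1))) * cis \<theta> ^ (i + (n + 1))) \<le> B * (1 / (real n + 2 + real i) ^ 3)" for i
    using d_bound[of "i + (n + 1)"] by (simp add: norm_mult norm_power add_ac)
  have sa: "summable (\<lambda>i. norm (of_real (d (i + (n + 1))) * cis \<theta> ^ (i + (n + 1))))"
    by (rule summable_comparison_test[OF _ summable_mult[OF tail_inverse_cubes(1)[OF assms], of B]]) (use trm in auto)
  have "W = (\<Sum>i. of_real (d (i + (n + 1))) * cis \<theta> ^ (i + (n + 1))) + (\<Sum>l<n + 1. of_real (d l) * cis \<theta> ^ l)"
    using suminf_split_initial_segment[OF sums_summable[OF d_sums], of "n + 1"] sums_unique[OF d_sums] by simp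
  then have "(\<Sum>l\<le>n. of_real (d l) * cis \<theta> ^ l) - W = - (\<Sum>i. of_real (d (i + (n + 1))) * cis \<theta> ^ (i + (n + 1)))"
    unfolding lessThan_Suc_atMost Suc_eq_plus1[symmetric] by simp
  also have "norm \<dots> \<le> (\<Sum>i. norm (of_real (d (i + (n + 1))) * cis \<theta> ^ (i + (n + 1))))"
    using summable_norm[OF sa] by simp
  also have "\<dots> \<le> (\<Sum>i. B * (1 / (real n + 2 + real i) ^ 3))"
    by (intro suminf_le trm sa summable_mult tail_inverse_cubes(1) assms)
  also have "\<dots> = B * (\<Sum>i. 1 / (real n + 2 + real i) ^ 3)"
    by (rule suminf_mult[OF tail_inverse_cubes(1)[OF assms]])
  also have "\<dots> \<le> B * (1 / (real n)\<^sup>2)"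
    by (intro mult_left_mono tail_inverse_cubes(2) assms B_nonneg)
  finally show ?thesis by simp
qed

text \<open>Reversal of the coefficients of a real polynomial is conjugation on the circle, up to
  the factor z^n.\<close>

lemma reversed_sum:
  "(\<Sum>l\<le>n. of_real (d (n - l)) * cis \<theta> ^ l) = cis \<theta> ^ n * cnj (\<Sum>l\<le>n. of_real (d l) * cis \<theta> ^ l)"
proof -
  have "(\<Sum>l\<le>n. of_real (d (n - l)) * cis \<theta> ^ l) = (\<Sum>l\<le>n. of_real (d l) * cis \<theta> ^ (n - l))"
    by (rule sum.reindex_bij_witness[of _ "\<lambda>i. n - i" "\<lambda>i. n - i"]) auto
  also have "\<dots> = (\<Sum>l\<le>n. cis \<theta> ^ n * cnj (of_real (d l) * cis \<theta> ^ l))"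
  proof (intro sum.cong refl)
    fix l assume "l \<in> {..n}"
    then have "cis \<theta> ^ n = cis \<theta> ^ (n - l) * cis \<theta> ^ l" by (simp flip: power_add)
    moreover have "cis \<theta> ^ l * cnj (cis \<theta> ^ l) = 1"
      using complex_norm_square[of "cis \<theta> ^ l"] by (simp add: norm_power)
    ultimately show "of_real (d l) * cis \<theta> ^ (n - l) = cis \<theta> ^ n * cnj (of_real (d l) * cis \<theta> ^ l)"
      by (simp add: mult.assoc mult.left_commute)
  qed
  finally show ?thesis by (simp add: sum_distrib_left)
qed

text \<open>Replacing both truncated series by their limits gives \<alpha> W + \<beta> z^n cnj W at
  z = exp(i\<theta>). Since W has argument \<rho>/2, factoring out W leaves \<alpha> + \<beta>
  exp(i(n\<theta> - \<rho>)), and the phase appears.\<close>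

lemma combination_bound:
  assumes "n \<ge> 1"
  shows "norm ((\<Sum>l\<le>n. of_real (\<alpha> * d l + \<beta> * d (n - l)) * cis \<theta> ^ l) - of_real w * cis (\<rho> / 2) * (\<alpha> + \<beta> * cis (real n * \<theta> - \<rho>)))
     \<le> (\<bar>\<alpha>\<bar> + \<bar>\<beta>\<bar>) * (B / (real n)\<^sup>2)"
proof -
  define A where "A = (\<Sum>l\<le>n. of_real (d l) * cis \<theta> ^ l)"
  have "(\<Sum>l\<le>n. of_real (\<alpha> * d l + \<beta> * d (n - l)) * cis \<theta> ^ l) = \<alpha> * A + \<beta> * (cis \<theta> ^ n * cnj A)"
    unfolding A_def reversed_sum[symmetric] by (simp add: sum_distrib_left algebra_simps sum.distrib)
  moreover have "of_real w * cis (\<rho> / 2) * (\<alpha> + \<beta> * cis (real n * \<theta> - \<rho>)) = \<alpha> * W + \<beta> * (cis \<theta> ^ n * cnj W)"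
  proof -
    have "cis (\<rho> / 2) * cis (real n * \<theta> - \<rho>) = cis \<theta> ^ n * cnj (cis (\<rho> / 2))"
      by (simp only: Complex.DeMoivre cis_mult cis_cnj) simp
    then show ?thesis unfolding W_eq by (simp add: distrib_left mult_ac)
  qed
  ultimately have "(\<Sum>l\<le>n. of_real (\<alpha> * d l + \<beta> * d (n - l)) * cis \<theta> ^ l) - of_real w * cis (\<rho> / 2) * (\<alpha> + \<beta> * cis (real n * \<theta> - \<rho>))
    = \<alpha> * (A - W) + \<beta> * (cis \<theta> ^ n * cnj (A - W))" by (simp add: algebra_simps)
  also have "norm \<dots> \<le> \<bar>\<alpha>\<bar> * norm (A - W) + \<bar>\<beta>\<bar> * norm (A - W)"
    by (rule order_trans[OF norm_triangle_ineq]) (simp add: norm_mult norm_power flip: complex_cnj_diff)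
  also have "\<dots> \<le> (\<bar>\<alpha>\<bar> + \<bar>\<beta>\<bar>) * (B / (real n)\<^sup>2)"
    unfolding distrib_right[symmetric] by (intro mult_left_mono truncation_bound[OF assms, folded A_def]) auto
  finally show ?thesis .
qed

lemma phase_estimate:
  assumes n: "n \<ge> 1" and q: "\<exists>l\<le>n. q l \<noteq> 0"
    and ker: "\<And>k. 1 \<le> k \<Longrightarrow> k < n \<Longrightarrow> (\<Sum>l\<le>n. g (int k - int l) * q l) = 0"
    and root: "(\<Sum>l\<le>n. of_real (q l) * cis \<theta> ^ l) = 0"
    and K: "K = (2 * B + 2 * B * G / c) / c0"
    and large: "B / real n ^ 3 \<le> c0 / 2" "K / (real n)\<^sup>2 \<le> 1 / 2"
  shows "\<bar>sin (real n * \<theta> - \<rho>)\<bar> \<le> 2 * K / (real n)\<^sup>2"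
proof -
  \<comment> \<open>\<alpha> and \<beta> are chosen such that the remainder r vanishes at both ends. Positive definiteness then bounds r
    although nothing is known about the rows 0 and n of the Toeplitz system.\<close>
  define D where "D = (d 0)\<^sup>2 - (d n)\<^sup>2"
  have dn: "\<bar>d n\<bar> \<le> c0 / 2"
  proof -
    have "B / (1 + real n) ^ 3 \<le> B / real n ^ 3"
      using B_nonneg n by (intro divide_left_mono power_mono) (auto intro!: mult_pos_pos zero_less_power)
    with d_bound[of n] large show ?thesis by linarith
  qed
  have "\<bar>d n\<bar> < \<bar>d 0\<bar>" using dn d_0 c0_pos by linarith
  then have D: "D \<noteq> 0" unfolding D_def by (metis abs_square_less_1 eq_iff_diff_eq_0 less_irrefl power2_eq_iff abs_minus_cancel)
  define \<alpha> \<beta> where "\<alpha> = (d 0 * q 0 - d n * q n) / D" and "\<beta> = (d 0 * q n - d n * q 0) / D"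
  define r where "r l = q l - (\<alpha> * d l + \<beta> * d (n - l))" for l
  have r0: "r 0 = 0" "r n = 0"
    unfolding r_def \<alpha>_def \<beta>_def using D by (simp_all add: field_simps) (simp_all add: D_def power2_eq_square algebra_simps)
  \<comment> \<open>The kernel vector q can be scaled freely, so every estimate below is relative to
    the size \<open>m\<close> of its two coefficients.\<close>
  define m where "m = max \<bar>\<alpha>\<bar> \<bar>\<beta>\<bar>"
  have m0: "m \<ge> 0" by (simp add: m_def)
  define E where "E = B * G / real n ^ 3"
  have E0: "E \<ge> 0" unfolding E_def using B_nonneg G_nonneg by simp
  have comb: "(\<Sum>l\<le>n. g (int k - int l) * (\<alpha> * d l + \<beta> * d (n - l)))
      = \<alpha> * (\<Sum>l\<le>n. g (int k - int l) * d l) + \<beta> * (\<Sum>l\<le>n. g (int (n - k) - int l) * d l)" if "k \<le> n" for k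
  proof -
    have "(\<Sum>l\<le>n. g (int k - int l) * d (n - l)) = (\<Sum>l\<le>n. g (int (n - k) - int l) * d l)"
    proof (rule sum.reindex_bij_witness[of _ "\<lambda>i. n - i" "\<lambda>i. n - i"])
      fix l assume "l \<in> {..n}"
      then have "int (n - k) - int (n - l) = - (int k - int l)" using that by auto
      then show "g (int (n - k) - int (n - l)) * d (n - l) = g (int k - int l) * d (n - l)" using g_even by metis
    qed auto
    moreover have "(\<Sum>l\<le>n. g (int k - int l) * (\<alpha> * d l + \<beta> * d (n - l)))
       = \<alpha> * (\<Sum>l\<le>n. g (int k - int l) * d l) + \<beta> * (\<Sum>l\<le>n. g (int k - int l) * d (n - l))"
      unfolding sum_distrib_left sum.distrib[symmetric] by (intro sum.cong refl) (simp add: algebra_simps)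
    ultimately show ?thesis by simp
  qed
  \<comment> \<open>By symmetry the reversed sequence fails row k as the original one fails row n -
    k. For 1 \<le> k < n both indices lie in the range of \<open>defect_bound\<close>.\<close>
  have Tr: "\<bar>\<Sum>l\<le>n. g (int k - int l) * r l\<bar> \<le> 2 * m * E" if k: "1 \<le> k" "k < n" for k
  proof -
    have "(\<Sum>l\<le>n. g (int k - int l) * r l) = - (\<Sum>l\<le>n. g (int k - int l) * (\<alpha> * d l + \<beta> * d (n - l)))"
      unfolding r_def right_diff_distrib sum_subtractf using ker[OF k] by simp
    also have "\<bar>\<dots>\<bar> \<le> \<bar>\<alpha>\<bar> * \<bar>\<Sum>l\<le>n. g (int k - int l) * d l\<bar> + \<bar>\<beta>\<bar> * \<bar>\<Sum>l\<le>n. g (int (n - k) - int l) * d l\<bar>"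
      using k by (subst comb) (auto simp: abs_mult[symmetric] intro: abs_triangle_ineq)
    also have "\<dots> \<le> m * E + m * E"
      unfolding E_def by (intro add_mono mult_mono defect_bound) (use k n in \<open>auto simp: m_def\<close>)
    finally show ?thesis by (simp add: mult_ac)
  qed
  define R where "R = (\<Sum>l\<le>n. \<bar>r l\<bar>)"
  have R0: "R \<ge> 0" unfolding R_def by (intro sum_nonneg) auto
  have "c * (\<Sum>i<n + 1. (r i)\<^sup>2) \<le> (\<Sum>i<n + 1. \<Sum>j<n + 1. g (int i - int j) * r i * r j)" by (rule pos_def)
  also have "\<dots> = (\<Sum>i\<le>n. r i * (\<Sum>j\<le>n. g (int i - int j) * r j))"
    by (simp add: lessThan_Suc_atMost sum_distrib_left mult_ac)
  also have "\<dots> \<le> (\<Sum>i\<le>n. \<bar>r i\<bar> * (2 * m * E))"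
  proof (rule sum_mono)
    fix i assume i: "i \<in> {..n}"
    show "r i * (\<Sum>j\<le>n. g (int i - int j) * r j) \<le> \<bar>r i\<bar> * (2 * m * E)"
    proof (cases "i = 0 \<or> i = n")
      case False
      have "r i * (\<Sum>j\<le>n. g (int i - int j) * r j) \<le> \<bar>r i\<bar> * \<bar>\<Sum>j\<le>n. g (int i - int j) * r j\<bar>"
        by (metis abs_ge_self abs_mult)
      also have "\<dots> \<le> \<bar>r i\<bar> * (2 * m * E)" using False i by (intro mult_left_mono Tr) auto
      finally show ?thesis .
    qed (use r0 in auto)
  qed
  also have "\<dots> = R * (2 * m * E)" by (simp add: R_def sum_distrib_right)
  finally have "c * (\<Sum>i\<le>n. (r i)\<^sup>2) \<le> R * (2 * m * E)" by (simp add: lessThan_Suc_atMost)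
  \<comment> \<open>Positive definiteness controls the square norm of r, while the value of r at
    exp(i\<theta>) needs the sum of absolute values. Cauchy-Schwarz over the n indices 1, ..., n
    costs a factor n in the end and turns the defect O(n^(-3)) into O(n^(-2)).\<close>
  moreover have "R\<^sup>2 \<le> real n * (\<Sum>i\<le>n. (r i)\<^sup>2)"
  proof -
    have e: "{..n} = insert 0 {1..n}" by auto
    have "R = (\<Sum>l\<in>{1..n}. \<bar>r l\<bar>)" unfolding R_def e using r0 by simp
    then have "R\<^sup>2 \<le> real n * (\<Sum>l\<in>{1..n}. \<bar>r l\<bar>\<^sup>2)"
      using Cauchy_Schwarz_ineq_sum[of "\<lambda>_. 1" "\<lambda>l. \<bar>r l\<bar>" "{1..n}"] by simp
    also have "(\<Sum>l\<in>{1..n}. \<bar>r l\<bar>\<^sup>2) = (\<Sum>i\<le>n. (r i)\<^sup>2)" unfolding e using r0 by simp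
    finally show ?thesis .
  qed
  ultimately have "c * R\<^sup>2 \<le> real n * (R * (2 * m * E))"
  proof -
    assume 1: "c * (\<Sum>i\<le>n. (r i)\<^sup>2) \<le> R * (2 * m * E)" and 2: "R\<^sup>2 \<le> real n * (\<Sum>i\<le>n. (r i)\<^sup>2)"
    have "c * R\<^sup>2 \<le> c * (real n * (\<Sum>i\<le>n. (r i)\<^sup>2))" using 2 c_pos by (intro mult_left_mono) auto
    also have "\<dots> = real n * (c * (\<Sum>i\<le>n. (r i)\<^sup>2))" by simp
    also have "\<dots> \<le> real n * (R * (2 * m * E))" using 1 by (intro mult_left_mono) auto
    finally show ?thesis .
  qed
  then have "R * (c * R) \<le> R * (2 * m * E * real n)" by (simp add: power2_eq_square mult_ac)
  then have "c * R \<le> 2 * m * E * real n"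
    using R0 m0 E0 by (cases "R = 0") (auto simp: mult_le_cancel_left)
  also have "\<dots> = m * (2 * B * G) / (real n)\<^sup>2"
    unfolding E_def using n by (simp add: power2_eq_square power3_eq_cube)
  finally have "R \<le> (m * (2 * B * G) / (real n)\<^sup>2) / c"
    using c_pos pos_le_divide_eq[of c R] by (simp only: mult.commute)
  then have R: "R \<le> m * (2 * B * G / c) / (real n)\<^sup>2" by (simp add: mult_ac)
  \<comment> \<open>For m = 0 the remainder r would be q itself and would vanish.\<close>
  have "m \<noteq> 0"
  proof
    assume "m = 0"
    then have "\<alpha> = 0" "\<beta> = 0" "R = 0" using R R0 by (auto simp: m_def max_def split: if_splits)
    then have "\<forall>l\<le>n. r l = 0" unfolding R_def by (subst (asm) sum_nonneg_eq_0_iff) auto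
    then show False using q \<open>\<alpha> = 0\<close> \<open>\<beta> = 0\<close> by (auto simp: r_def)
  qed
  with m0 have m: "m > 0" by simp
  define \<phi> where "\<phi> = real n * \<theta> - \<rho>"
  have w: "w > 0" using w_ge c0_pos by simp
  have "(\<Sum>l\<le>n. of_real (\<alpha> * d l + \<beta> * d (n - l)) * cis \<theta> ^ l) = - (\<Sum>l\<le>n. of_real (r l) * cis \<theta> ^ l)"
    using root unfolding r_def of_real_diff left_diff_distrib sum_subtractf by simp
  then have "norm (\<Sum>l\<le>n. of_real (\<alpha> * d l + \<beta> * d (n - l)) * cis \<theta> ^ l) = norm (\<Sum>l\<le>n. of_real (r l) * cis \<theta> ^ l)"
    by simp
  also have "\<dots> \<le> R" unfolding R_def by (rule sum_norm_le) (simp add: norm_mult norm_power)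
  finally have nR: "norm (\<Sum>l\<le>n. of_real (\<alpha> * d l + \<beta> * d (n - l)) * cis \<theta> ^ l) \<le> R" .
  have nB: "(\<bar>\<alpha>\<bar> + \<bar>\<beta>\<bar>) * (B / (real n)\<^sup>2) \<le> (2 * m) * (B / (real n)\<^sup>2)"
    by (intro mult_right_mono) (use B_nonneg in \<open>auto simp: m_def\<close>)
  have "norm (\<alpha> + \<beta> * cis \<phi>) * c0 \<le> norm (\<alpha> + \<beta> * cis \<phi>) * w" by (intro mult_left_mono w_ge) auto
  also have "\<dots> = norm (of_real w * cis (\<rho> / 2) * (\<alpha> + \<beta> * cis \<phi>))" using w by (simp add: norm_mult mult.commute)
  also have "\<dots> \<le> norm (\<Sum>l\<le>n. of_real (\<alpha> * d l + \<beta> * d (n - l)) * cis \<theta> ^ l) + (\<bar>\<alpha>\<bar> + \<bar>\<beta>\<bar>) * (B / (real n)\<^sup>2)"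
    using combination_bound[OF n, of \<alpha> \<beta>] unfolding \<phi>_def
    by (smt (verit) norm_minus_commute norm_triangle_sub)
  \<comment> \<open>This is the origin of \<open>K\<close>: 2BG/c comes from the remainder r, 2B
    from truncating the two series, and the division by \<open>c0\<close> from the lower bound for
    |W|.\<close>
  also have "\<dots> \<le> m * (2 * B * G / c) / (real n)\<^sup>2 + 2 * m * (B / (real n)\<^sup>2)" using R nR nB by linarith
  also have "\<dots> = m * (K * c0) / (real n)\<^sup>2"
    unfolding K using c0_pos by (simp add: distrib_left add_divide_distrib mult_ac)
  also have "\<dots> = m * (K / (real n)\<^sup>2) * c0" by simp
  finally have main: "norm (\<alpha> + \<beta> * cis \<phi>) \<le> m * (K / (real n)\<^sup>2)"
    by (rule mult_right_le_imp_le[OF _ c0_pos])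
  have "\<bar>\<beta> * sin \<phi>\<bar> \<le> norm (\<alpha> + \<beta> * cis \<phi>)" using abs_Im_le_cmod[of "\<alpha> + \<beta> * cis \<phi>"] by simp
  with main have im: "\<bar>\<beta> * sin \<phi>\<bar> \<le> m * (K / (real n)\<^sup>2)" by simp
  \<comment> \<open>The moduli of \<alpha> and \<beta> must nearly agree, so \<beta> has size at
    least m/2 and may be divided out of \<beta> sin \<phi>, the imaginary part of \<alpha> + \<beta>
    exp(i\<phi>).\<close>
  have "\<bar>\<alpha>\<bar> - \<bar>\<beta>\<bar> \<le> norm (\<alpha> + \<beta> * cis \<phi>)"
    using norm_triangle_ineq2[of "complex_of_real \<alpha>" "- (\<beta> * cis \<phi>)"] by (simp add: norm_mult)
  also have "\<dots> \<le> m * (1 / 2)" using main mult_left_mono[OF large(2) m0] by linarith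
  finally have "m / 2 \<le> \<bar>\<beta>\<bar>" unfolding m_def by linarith
  then have "m / 2 * \<bar>sin \<phi>\<bar> \<le> m * (K / (real n)\<^sup>2)"
  proof -
    assume "m / 2 \<le> \<bar>\<beta>\<bar>"
    then have "m / 2 * \<bar>sin \<phi>\<bar> \<le> \<bar>\<beta>\<bar> * \<bar>sin \<phi>\<bar>" by (intro mult_right_mono) auto
    with im show ?thesis unfolding abs_mult by (rule order_trans[rotated])
  qed
  then have "m * \<bar>sin \<phi>\<bar> \<le> m * (2 * K / (real n)\<^sup>2)" by (simp add: mult_ac)
  then show ?thesis unfolding \<phi>_def by (rule mult_left_le_imp_le[OF _ m])
qed


text \<open>When the phase condition holds exactly, exp(i(n\<theta> - \<rho>)) is 1 or -1, and
  \<beta> of the opposite sign makes 1 + \<beta> exp(i(n\<theta> - \<rho>)) vanish. Then q, with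
  coefficients d l + \<beta> d (n - l), is O(n^(-2)) at exp(i\<theta>), and since q is real also at
  exp(-i\<theta>). Division by the quadratic with these two roots therefore leaves a small
  remainder; \<open>s0\<close> bounds the loss from the factor 1/sin \<theta>.\<close>

lemma quasi_mode:
  assumes N: "N \<ge> 1" and n: "n = N + 2" and ph: "sin (real n * \<theta> - \<rho>) = 0"
    and s0: "s0 > 0" "sin \<theta> \<ge> s0" and large: "B / real n ^ 3 \<le> c0 / 2"
  shows "\<exists>p. c0 / 2 \<le> p 0 \<and> (\<forall>l>N. p l = 0) \<and>
    (\<forall>k\<le>N. \<bar>\<Sum>l\<le>N. (cos \<theta> * g (int k - int l) - (g (int k - int l - 1) + g (int k - int l + 1)) / 2) * p l\<bar>
         \<le> (B * G + 4 * B * G / s0) / (real n)\<^sup>2)"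
proof -
  define \<beta> where "\<beta> = - cos (real n * \<theta> - \<rho>)"
  have \<beta>2: "\<beta>\<^sup>2 = 1" using sin_cos_squared_add[of "real n * \<theta> - \<rho>"] ph by (simp add: \<beta>_def)
  then have \<beta>1: "\<bar>\<beta>\<bar> = 1" by (metis abs_1 power2_eq_1_iff abs_minus_cancel)
  have n1: "n \<ge> 1" "n \<ge> 3" using n N by auto
  have cis1: "1 + \<beta> * cis (real n * \<theta> - \<rho>) = 0"
    using \<beta>2 ph by (simp add: complex_eq_iff \<beta>_def power2_eq_square)
  define q where "q l = d l + \<beta> * d (n - l)" for l
  have qz: "norm (\<Sum>l\<le>n. of_real (q l) * cis \<theta> ^ l) \<le> 2 * B / (real n)\<^sup>2"
    using combination_bound[OF n1(1), of 1 \<beta>] cis1 \<beta>1 by (simp add: q_def)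
  \<comment> \<open>P is the power series quotient of q by 1 - 2 z cos \<theta> + z^2. It becomes a polynomial of degree N once the
    small coefficients beyond N are discarded.\<close>
  define P where "P l = (\<Sum>j\<le>l. q j * sin ((real l + 1 - real j) * \<theta>)) / sin \<theta>" for l
  have s: "sin \<theta> > 0" using s0 by simp
  have im: "\<bar>\<Sum>j\<le>n. q j * sin (x - real j * \<theta>)\<bar> \<le> 2 * B / (real n)\<^sup>2" for x
  proof -
    \<comment> \<open>The sine sums are imaginary parts of a unimodular multiple of cnj (q
      (exp(i\<theta>))), so they inherit its smallness for every offset x.\<close>
    have "(\<Sum>j\<le>n. q j * sin (x - real j * \<theta>)) = Im (cis x * cnj (\<Sum>l\<le>n. of_real (q l) * cis \<theta> ^ l))"
    proof -
      have "cis x * cnj (of_real (q l) * cis \<theta> ^ l) = of_real (q l) * cis (x - real l * \<theta>)" for l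
      proof -
        have "cnj (cis \<theta> ^ l) = cis (- (real l * \<theta>))" unfolding Complex.DeMoivre cis_cnj ..
        then show ?thesis by (simp only: complex_cnj_mult complex_cnj_complex_of_real mult.left_commute[of "cis x"] cis_mult) simp
      qed
      then show ?thesis by (simp only: cnj_sum sum_distrib_left) simp
    qed
    also have "\<bar>\<dots>\<bar> \<le> norm (cis x * cnj (\<Sum>l\<le>n. of_real (q l) * cis \<theta> ^ l))" by (rule abs_Im_le_cmod)
    also have "\<dots> = norm (\<Sum>l\<le>n. of_real (q l) * cis \<theta> ^ l)" by (simp only: norm_mult complex_mod_cnj norm_cis mult_1)
    finally show ?thesis using qz by simp
  qed
  have Pb: "\<bar>P l\<bar> \<le> 2 * B / (real n)\<^sup>2 / s0" if l: "l = n - 1 \<or> l = n" for l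
  proof -
    \<comment> \<open>For l = n - 1 the additional summand j = n contains sin 0, so both top
      coefficients are full sine sums.\<close>
    have "(\<Sum>j\<le>l. q j * sin ((real l + 1 - real j) * \<theta>)) = (\<Sum>j\<le>n. q j * sin ((real l + 1) * \<theta> - real j * \<theta>))"
      using l
    proof
      assume "l = n - 1"
      with n1 obtain l' where "n = Suc l" by (cases n) auto
      then show ?thesis by (simp add: algebra_simps)
    qed (simp add: algebra_simps)
    then have "\<bar>P l\<bar> \<le> 2 * B / (real n)\<^sup>2 / sin \<theta>"
      using divide_right_mono[OF im[of "(real l + 1) * \<theta>"], of "sin \<theta>"] s by (simp add: P_def abs_divide)
    also have "\<dots> \<le> 2 * B / (real n)\<^sup>2 / s0"
      using s0 B_nonneg by (intro divide_left_mono) auto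
    finally show ?thesis .
  qed
  have P0: "P 0 = q 0" using s by (simp add: P_def)
  have P1: "P (Suc 0) = q 1 + 2 * cos \<theta> * q 0"
    using s sin_double[of \<theta>] by (simp add: P_def field_simps)
  \<comment> \<open>The recursion that expresses (1 - 2 z cos \<theta> + z^2) P = q. The numbers
    sin((m + 1)\<theta>)/sin \<theta> in P are the power series coefficients of the inverse of the
    quadratic.\<close>
  have Prec: "P (l + 2) = q (l + 2) + 2 * cos \<theta> * P (l + 1) - P l" for l
  proof -
    have sr: "sin ((x + 2) * \<theta>) = 2 * cos \<theta> * sin ((x + 1) * \<theta>) - sin (x * \<theta>)" for x
    proof -
      have "sin ((x + 1) * \<theta> + \<theta>) + sin ((x + 1) * \<theta> - \<theta>) = 2 * cos \<theta> * sin ((x + 1) * \<theta>)"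
        by (simp add: sin_add sin_diff)
      then show ?thesis by (simp add: algebra_simps)
    qed
    \<comment> \<open>Separating the range of summation from the frequency lets the three-term
      recurrence of the sine act with a fixed range; the boundary summands then contribute sin 0 or
      sin(-\<theta>).\<close>
    define T where "T i x = (\<Sum>j\<le>i. q j * sin ((x - real j) * \<theta>))" for i x
    have T: "T i (x + 2) = 2 * cos \<theta> * T i (x + 1) - T i x" for i x
    proof -
      have "sin ((x + 2 - real j) * \<theta>) = 2 * cos \<theta> * sin ((x + 1 - real j) * \<theta>) - sin ((x - real j) * \<theta>)" for j
        using sr[of "x - real j"] by (simp add: algebra_simps)
      then show ?thesis unfolding T_def sum_distrib_left sum_subtractf[symmetric]
        by (intro sum.cong refl) (simp only: right_diff_distrib mult_ac)
    qed
    have TS: "T (Suc i) x = T i x + q (Suc i) * sin ((x - real (Suc i)) * \<theta>)" for i x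
      by (simp add: T_def)
    have PT: "P i = T i (real i + 1) / sin \<theta>" for i by (simp add: P_def T_def)
    have "T (l + 2) (real (l + 2) + 1) = 2 * cos \<theta> * T (l + 2) (real (l + 1) + 1) - T (l + 2) (real l + 1)"
      using T[of "l + 2" "real l + 1"] by (simp add: add_ac)
    also have "T (l + 2) (real (l + 1) + 1) = T (l + 1) (real (l + 1) + 1)"
      using TS[of "l + 1" "real (l + 1) + 1"] by simp
    also have "T (l + 2) (real l + 1) = T l (real l + 1) - q (l + 2) * sin \<theta>"
      using TS[of "l + 1" "real l + 1"] TS[of l "real l + 1"] by (simp add: algebra_simps)
    finally have E: "T (l + 2) (real (l + 2) + 1)
      = 2 * cos \<theta> * T (l + 1) (real (l + 1) + 1) - (T l (real l + 1) - q (l + 2) * sin \<theta>)" .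
    show ?thesis unfolding PT E using s by (simp add: diff_divide_distrib)
  qed
  define p where "p l = (if l \<le> N then P l else 0)" for l
  \<comment> \<open>Cutting P off after degree N = n - 2 changes its product with the quadratic only
    in the degrees n - 1 and n.\<close>
  define h where "h l = (if l = n - 1 then - P (n - 1) else if l = n then 2 * cos \<theta> * P (n - 1) - P n else 0)" for l
  have qm: "quad_mult (cos \<theta>) p l = q l + h l" if l: "l \<le> n" for l
  proof -
    consider "l = 0" | "l = 1" | i where "l = i + 2"
      by (metis One_nat_def Suc_1 add_2_eq_Suc' less_2_cases not_less le_Suc_ex add.commute)
    then show ?thesis
    proof cases
      case 1
      then show ?thesis using n N P0 by (simp add: quad_mult_def p_def h_def)
    next
      case 2
      then show ?thesis using n N P0 P1 by (simp add: quad_mult_def p_def h_def)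
    next
      case 3
      have "l \<le> N \<or> l = N + 1 \<or> l = N + 2" using l n by auto
      then show ?thesis
        using 3 n N Prec[of i] by (auto simp: quad_mult_def p_def h_def)
    qed
  qed
  have hs: "(\<Sum>l\<le>n. F l * h l) = - F (n - 1) * P (n - 1) + F n * (2 * cos \<theta> * P (n - 1) - P n)" for F
  proof -
    obtain n' where n': "n = Suc (Suc n')" using n by auto
    have "(\<Sum>l\<le>n'. F l * h l) = 0" by (rule sum.neutral) (auto simp: h_def n')
    then show ?thesis by (simp add: n' h_def)
  qed
  \<comment> \<open>The constant coefficient of p is d 0 + \<beta> d n; the smallness of d n keeps
    it, and with it the norm of the quasi-mode, away from zero.\<close>
  have "\<bar>d n\<bar> \<le> c0 / 2"
  proof -
    have "B / (1 + real n) ^ 3 \<le> B / real n ^ 3"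
      using B_nonneg n by (intro divide_left_mono power_mono) (auto intro!: mult_pos_pos zero_less_power)
    with d_bound[of n] large show ?thesis by linarith
  qed
  then have "\<bar>\<beta> * d n\<bar> \<le> c0 / 2" using \<beta>1 by (simp add: abs_mult)
  then have "c0 / 2 \<le> p 0" using d_0 by (simp add: p_def P0 q_def)
  moreover have "\<bar>\<Sum>l\<le>N. (cos \<theta> * g (int k - int l) - (g (int k - int l - 1) + g (int k - int l + 1)) / 2) * p l\<bar>
         \<le> (B * G + 4 * B * G / s0) / (real n)\<^sup>2" if k: "k \<le> N" for k
  proof -
    define Q where "Q = 2 * B / (real n)\<^sup>2 / s0"
    have Q: "\<bar>P (n - 1)\<bar> \<le> Q" "\<bar>P n\<bar> \<le> Q" unfolding Q_def using Pb by auto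
    have Q0: "Q \<ge> 0" using Q(1) by linarith
    have "(\<Sum>l\<le>N. (cos \<theta> * g (int k - int l) - (g (int k - int l - 1) + g (int k - int l + 1)) / 2) * p l)
        = - (\<Sum>l\<le>n. g (int (k + 1) - int l) * quad_mult (cos \<theta>) p l) / 2"
      unfolding n by (rule toeplitz_quad_mult) (simp add: p_def)
    also have "(\<Sum>l\<le>n. g (int (k + 1) - int l) * quad_mult (cos \<theta>) p l)
        = (\<Sum>l\<le>n. g (int (k + 1) - int l) * d l) + \<beta> * (\<Sum>l\<le>n. g (int (k + 1) - int l) * d (n - l))
          + (\<Sum>l\<le>n. g (int (k + 1) - int l) * h l)"
      unfolding sum_distrib_left sum.distrib[symmetric]
      by (intro sum.cong refl) (simp add: qm q_def algebra_simps)
    also have "(\<Sum>l\<le>n. g (int (k + 1) - int l) * d (n - l)) = (\<Sum>l\<le>n. g (int (n - (k + 1)) - int l) * d l)"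
    proof (rule sum.reindex_bij_witness[of _ "\<lambda>i. n - i" "\<lambda>i. n - i"])
      fix l assume "l \<in> {..n}"
      then have "int (n - (k + 1)) - int (n - l) = - (int (k + 1) - int l)" using k n by auto
      then show "g (int (n - (k + 1)) - int (n - l)) * d (n - l) = g (int (k + 1) - int l) * d (n - l)" using g_even by metis
    qed auto
    finally have eq: "(\<Sum>l\<le>N. (cos \<theta> * g (int k - int l) - (g (int k - int l - 1) + g (int k - int l + 1)) / 2) * p l)
      = - ((\<Sum>l\<le>n. g (int (k + 1) - int l) * d l) + \<beta> * (\<Sum>l\<le>n. g (int (n - (k + 1)) - int l) * d l)
          + (\<Sum>l\<le>n. g (int (k + 1) - int l) * h l)) / 2" .
    have cube: "B * G / real n ^ 3 \<le> B * G / (real n)\<^sup>2"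
      using n1 B_nonneg G_nonneg by (intro divide_left_mono power_increasing) auto
    have e1: "\<bar>\<Sum>l\<le>n. g (int (k + 1) - int l) * d l\<bar> \<le> B * G / (real n)\<^sup>2"
      using defect_bound[of "k + 1" n] k n cube by linarith
    have "\<bar>\<Sum>l\<le>n. g (int (n - (k + 1)) - int l) * d l\<bar> \<le> B * G / (real n)\<^sup>2"
      by (rule order_trans[OF defect_bound cube]) (use k n in auto)
    then have e2: "\<bar>\<beta> * (\<Sum>l\<le>n. g (int (n - (k + 1)) - int l) * d l)\<bar> \<le> B * G / (real n)\<^sup>2"
      using \<beta>1 by (simp add: abs_mult)
    have "\<bar>2 * cos \<theta> * P (n - 1) - P n\<bar> \<le> 2 * (\<bar>cos \<theta>\<bar> * \<bar>P (n - 1)\<bar>) + \<bar>P n\<bar>"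
      using abs_triangle_ineq4[of "2 * cos \<theta> * P (n - 1)" "P n"] by (simp add: abs_mult)
    also have "\<dots> \<le> 2 * (1 * Q) + Q" by (intro add_mono mult_left_mono mult_mono Q) auto
    finally have h2: "\<bar>2 * cos \<theta> * P (n - 1) - P n\<bar> \<le> 3 * Q" by simp
    have "\<bar>g (int (k + 1) - int (n - 1)) * P (n - 1)\<bar> \<le> G * Q"
      unfolding abs_mult by (intro mult_mono g_le Q G_nonneg) auto
    moreover have "\<bar>g (int (k + 1) - int n) * (2 * cos \<theta> * P (n - 1) - P n)\<bar> \<le> G * (3 * Q)"
      unfolding abs_mult by (intro mult_mono g_le h2 G_nonneg) auto
    ultimately have e3: "\<bar>\<Sum>l\<le>n. g (int (k + 1) - int l) * h l\<bar> \<le> 4 * (G * Q)"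
      unfolding hs by linarith
    have tri: "\<bar>- (x + y + z) / 2\<bar> \<le> (\<bar>x\<bar> + \<bar>y\<bar> + \<bar>z\<bar>) / 2" for x y z :: real
    proof -
      have "\<bar>x + y + z\<bar> \<le> \<bar>x\<bar> + \<bar>y\<bar> + \<bar>z\<bar>" by linarith
      moreover have "\<bar>- s / 2\<bar> = \<bar>s\<bar> / 2" for s :: real by simp
      ultimately show ?thesis by (simp only: divide_right_mono)
    qed
    have "\<bar>\<Sum>l\<le>N. (cos \<theta> * g (int k - int l) - (g (int k - int l - 1) + g (int k - int l + 1)) / 2) * p l\<bar>
      \<le> (\<bar>\<Sum>l\<le>n. g (int (k + 1) - int l) * d l\<bar> + \<bar>\<beta> * (\<Sum>l\<le>n. g (int (n - (k + 1)) - int l) * d l)\<bar>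
          + \<bar>\<Sum>l\<le>n. g (int (k + 1) - int l) * h l\<bar>) / 2" unfolding eq by (rule tri)
    also have "\<dots> \<le> (B * G / (real n)\<^sup>2 + B * G / (real n)\<^sup>2 + 4 * (G * Q)) / 2"
      by (intro divide_right_mono add_mono e1 e2 e3) simp
    also have "\<dots> = (B * G + 4 * B * G / s0) / (real n)\<^sup>2"
      unfolding Q_def using n1 s0 by (simp add: field_simps)
    finally show ?thesis .
  qed
  ultimately show ?thesis by (intro exI[of _ p]) (auto simp: p_def)
qed

end

section \<open>Cosine series\<close>

lemma sums_integral_bounded:
  fixes u :: "nat \<Rightarrow> real \<Rightarrow> real"
  assumes c: "\<And>k. continuous_on {a..b} (u k)" and M: "\<And>k t. t \<in> {a..b} \<Longrightarrow> \<bar>u k t\<bar> \<le> M k" "summable M"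
  shows "(\<lambda>k. integral {a..b} (u k)) sums integral {a..b} (\<lambda>t. \<Sum>k. u k t)"
    and "continuous_on {a..b} (\<lambda>t. \<Sum>k. u k t)"
proof -
  have u: "uniform_limit {a..b} (\<lambda>n t. \<Sum>k<n. u k t) (\<lambda>t. \<Sum>k. u k t) sequentially"
    by (rule Weierstrass_m_test[OF _ M(2)]) (use M in auto)
  have cp: "continuous_on {a..b} (\<lambda>t. \<Sum>k<n. u k t)" for n by (intro continuous_on_sum c)
  obtain I J where I: "\<And>n. ((\<lambda>t. \<Sum>k<n. u k t) has_integral I n) {a..b}"
    and J: "((\<lambda>t. \<Sum>k. u k t) has_integral J) {a..b}" and IJ: "I \<longlonglongrightarrow> J"
    using uniform_limit_integral[OF u cp] by auto
  have "I = (\<lambda>n. \<Sum>k<n. integral {a..b} (u k))"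
  proof (rule ext)
    fix n
    have "I n = integral {a..b} (\<lambda>t. \<Sum>k<n. u k t)" using I[of n] by (simp add: integral_unique)
    also have "\<dots> = (\<Sum>k<n. integral {a..b} (u k))"
      by (rule integral_sum) (auto intro: integrable_continuous_interval c)
    finally show "I n = (\<Sum>k<n. integral {a..b} (u k))" .
  qed
  then show "(\<lambda>k. integral {a..b} (u k)) sums integral {a..b} (\<lambda>t. \<Sum>k. u k t)"
    using IJ integral_unique[OF J] unfolding sums_def by simp
  show "continuous_on {a..b} (\<lambda>t. \<Sum>k. u k t)"
    by (rule uniform_limit_theorem[OF _ u]) (auto intro!: always_eventually cp)
qed

section \<open>Orthogonality and Bessel's inequality\<close>

lemma has_integral_cos_multiple:
  assumes "m \<noteq> (0::int)"
  shows "((\<lambda>t. cos (of_int m * t)) has_integral 0) {0..pi}"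
    and "((\<lambda>t. cos (of_int m * t)) has_integral 0) {0..2 * pi}"
proof -
  have *: "((\<lambda>t. cos (of_int m * t)) has_integral (sin (of_int m * b) / of_int m - sin (of_int m * 0) / of_int m)) {0..b}" if "b \<ge> 0" for b :: real
    by (rule fundamental_theorem_of_calculus[OF that])
       (use assms in \<open>auto intro!: derivative_eq_intros simp: has_real_derivative_iff_has_vector_derivative[symmetric]\<close>)
  have "sin (of_int m * pi) = 0" using sin_zero_iff_int2 by blast
  with *[of pi] show "((\<lambda>t. cos (of_int m * t)) has_integral 0) {0..pi}" by simp
  have "sin (of_int m * (2 * pi)) = 0"
    unfolding sin_zero_iff_int2 by (intro exI[of _ "m * 2"]) simp
  with *[of "2 * pi"] show "((\<lambda>t. cos (of_int m * t)) has_integral 0) {0..2 * pi}" by simp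
qed

lemma integral_cos_cos:
  "integral {0..pi} (\<lambda>t. cos (real j * t) * cos (real k * t)) = (if j = k then if j = 0 then pi else pi / 2 else 0)"
proof -
  have e: "(\<lambda>t. cos (real j * t) * cos (real k * t)) = (\<lambda>t. (cos (of_int (int j - int k) * t) + cos (of_int (int j + int k) * t)) / 2)"
    by (auto simp: cos_add cos_diff algebra_simps)
  have c: "((\<lambda>t. cos (of_int m * t)) has_integral (if m = 0 then pi else 0)) {0..pi}" for m :: int
    using has_integral_cos_multiple(1)[of m] has_integral_const_real[of "1::real" 0 pi] by auto
  have "((\<lambda>t. (cos (of_int (int j - int k) * t) + cos (of_int (int j + int k) * t)) / 2) has_integral
      ((if int j - int k = 0 then pi else 0) + (if int j + int k = 0 then pi else 0)) / 2) {0..pi}"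
    by (intro has_integral_divide has_integral_add c)
  then show ?thesis unfolding e by (subst integral_unique) auto
qed

lemma integral_sin_sin:
  assumes "j \<ge> 1" "k \<ge> 1"
  shows "integral {0..pi} (\<lambda>t. sin (real j * t) * sin (real k * t)) = (if j = k then pi / 2 else 0)"
proof -
  have e: "(\<lambda>t. sin (real j * t) * sin (real k * t)) = (\<lambda>t. (cos (of_int (int j - int k) * t) - cos (of_int (int j + int k) * t)) / 2)"
    by (auto simp: cos_add cos_diff algebra_simps)
  have c: "((\<lambda>t. cos (of_int m * t)) has_integral (if m = 0 then pi else 0)) {0..pi}" for m :: int
    using has_integral_cos_multiple(1)[of m] has_integral_const_real[of "1::real" 0 pi] by auto
  have "((\<lambda>t. (cos (of_int (int j - int k) * t) - cos (of_int (int j + int k) * t)) / 2) has_integral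
      ((if int j - int k = 0 then pi else 0) - (if int j + int k = 0 then pi else 0)) / 2) {0..pi}"
    by (intro has_integral_divide has_integral_diff c)
  then show ?thesis unfolding e using assms by (subst integral_unique) auto
qed

lemma bessel_inequality:
  fixes \<phi> :: "nat \<Rightarrow> real \<Rightarrow> real"
  assumes h: "continuous_on {a..b} h" and \<phi>: "\<And>k. continuous_on {a..b} (\<phi> k)" and "\<gamma> > 0"
    and orth: "\<And>j k. j \<in> I \<Longrightarrow> k \<in> I \<Longrightarrow> integral {a..b} (\<lambda>t. \<phi> j t * \<phi> k t) = (if j = k then \<gamma> else 0)"
    and "finite I"
  shows "(\<Sum>k\<in>I. (integral {a..b} (\<lambda>t. h t * \<phi> k t))\<^sup>2) \<le> \<gamma> * integral {a..b} (\<lambda>t. (h t)\<^sup>2)"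
proof -
  define c where "c k = integral {a..b} (\<lambda>t. h t * \<phi> k t)" for k
  have io: "f integrable_on {a..b}" if "continuous_on {a..b} f" for f :: "real \<Rightarrow> real"
    using that by (rule integrable_continuous_interval)
  define s where "s t = (\<Sum>k\<in>I. c k / \<gamma> * \<phi> k t)" for t
  have s: "continuous_on {a..b} s" unfolding s_def by (intro continuous_intros \<phi>)
  have int_s: "integral {a..b} (\<lambda>t. w t * s t) = (\<Sum>k\<in>I. c k / \<gamma> * integral {a..b} (\<lambda>t. w t * \<phi> k t))"
    if "continuous_on {a..b} w" for w
  proof -
    have "integral {a..b} (\<lambda>t. w t * s t) = integral {a..b} (\<lambda>t. \<Sum>k\<in>I. c k / \<gamma> * (w t * \<phi> k t))"
      by (simp add: s_def sum_distrib_left mult_ac)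
    also have "\<dots> = (\<Sum>k\<in>I. integral {a..b} (\<lambda>t. c k / \<gamma> * (w t * \<phi> k t)))"
      by (rule integral_sum[OF \<open>finite I\<close>]) (intro io continuous_intros that \<phi>)
    finally show ?thesis by simp
  qed
  have "integral {a..b} (\<lambda>t. \<phi> j t * s t) = c j" if "j \<in> I" for j
  proof -
    have "integral {a..b} (\<lambda>t. \<phi> j t * s t) = (\<Sum>k\<in>I. if j = k then c k else 0)"
      unfolding int_s[OF \<phi>] using \<open>\<gamma> > 0\<close> that by (intro sum.cong refl) (auto simp: orth)
    then show ?thesis using that \<open>finite I\<close> by simp
  qed
  then have ss: "integral {a..b} (\<lambda>t. s t * s t) = (\<Sum>k\<in>I. c k / \<gamma> * c k)"
    unfolding int_s[OF s] by (intro sum.cong refl) (simp add: mult.commute)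
  have hs: "integral {a..b} (\<lambda>t. h t * s t) = (\<Sum>k\<in>I. c k / \<gamma> * c k)"
    unfolding int_s[OF h] c_def ..
  have "0 \<le> integral {a..b} (\<lambda>t. (h t - s t)\<^sup>2)"
    by (intro integral_nonneg io continuous_intros h s) auto
  also have "(\<lambda>t. (h t - s t)\<^sup>2) = (\<lambda>t. ((h t)\<^sup>2 - 2 * (h t * s t)) + s t * s t)"
    by (auto simp: power2_eq_square algebra_simps)
  also have "integral {a..b} \<dots> = integral {a..b} (\<lambda>t. (h t)\<^sup>2 - 2 * (h t * s t)) + integral {a..b} (\<lambda>t. s t * s t)"
    by (intro integral_add io continuous_intros h s)
  also have "integral {a..b} (\<lambda>t. (h t)\<^sup>2 - 2 * (h t * s t)) = integral {a..b} (\<lambda>t. (h t)\<^sup>2) - integral {a..b} (\<lambda>t. 2 * (h t * s t))"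
    by (intro integral_diff io continuous_intros h s)
  finally have "(\<Sum>k\<in>I. c k / \<gamma> * c k) \<le> integral {a..b} (\<lambda>t. (h t)\<^sup>2)" by (simp add: ss hs)
  moreover have "(\<Sum>k\<in>I. c k / \<gamma> * c k) = (\<Sum>k\<in>I. (c k)\<^sup>2) / \<gamma>"
    by (simp add: sum_divide_distrib power2_eq_square)
  ultimately have "(\<Sum>k\<in>I. (c k)\<^sup>2) / \<gamma> \<le> integral {a..b} (\<lambda>t. (h t)\<^sup>2)" by simp
  then show ?thesis unfolding c_def using \<open>\<gamma> > 0\<close> by (simp add: field_simps)
qed

lemma bessel_sin:
  assumes "continuous_on {0..pi} h"
  shows "(\<Sum>k=1..K. (integral {0..pi} (\<lambda>t. h t * sin (real k * t)))\<^sup>2) \<le> pi / 2 * integral {0..pi} (\<lambda>t. (h t)\<^sup>2)"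
  by (rule bessel_inequality[OF assms]) (auto intro!: continuous_intros simp: integral_sin_sin)

lemma bessel_cos:
  assumes "continuous_on {0..pi} h"
  shows "(\<Sum>k=1..K. (integral {0..pi} (\<lambda>t. h t * cos (real k * t)))\<^sup>2) \<le> pi / 2 * integral {0..pi} (\<lambda>t. (h t)\<^sup>2)"
  by (rule bessel_inequality[OF assms]) (auto intro!: continuous_intros simp: integral_cos_cos)

section \<open>Integration by parts on the half period\<close>

lemma ibp_cos:
  assumes "\<And>t. t \<in> {0..pi} \<Longrightarrow> (h has_real_derivative h' t) (at t)" "continuous_on {0..pi} h'"
  shows "real k * integral {0..pi} (\<lambda>t. h t * cos (real k * t)) = - integral {0..pi} (\<lambda>t. h' t * sin (real k * t))"
proof -
  have h: "continuous_on {0..pi} h" using assms(1) by (meson DERIV_isCont continuous_at_imp_continuous_on)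
  have "((\<lambda>t. h' t * sin (real k * t) + real k * (h t * cos (real k * t))) has_integral
      (h pi * sin (real k * pi) - h 0 * sin (real k * 0))) {0..pi}"
  proof (rule fundamental_theorem_of_calculus)
    fix t assume t: "t \<in> {0..pi}"
    have "((\<lambda>t. h t * sin (real k * t)) has_real_derivative h' t * sin (real k * t) + real k * (h t * cos (real k * t))) (at t)"
      by (rule derivative_eq_intros assms(1)[OF t] refl)+ (simp add: algebra_simps)
    then show "((\<lambda>t. h t * sin (real k * t)) has_vector_derivative h' t * sin (real k * t) + real k * (h t * cos (real k * t))) (at t within {0..pi})"
      by (simp add: has_real_derivative_iff_has_vector_derivative has_vector_derivative_at_within)
  qed simp
  then have "integral {0..pi} (\<lambda>t. h' t * sin (real k * t) + real k * (h t * cos (real k * t))) = 0"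
    by (simp add: integral_unique)
  also have "integral {0..pi} (\<lambda>t. h' t * sin (real k * t) + real k * (h t * cos (real k * t)))
     = integral {0..pi} (\<lambda>t. h' t * sin (real k * t)) + real k * integral {0..pi} (\<lambda>t. h t * cos (real k * t))"
    by (subst integral_add) (auto intro!: integrable_continuous_interval continuous_intros assms h)
  finally show ?thesis by simp
qed

lemma ibp_sin:
  assumes "\<And>t. t \<in> {0..pi} \<Longrightarrow> (h has_real_derivative h' t) (at t)" "continuous_on {0..pi} h'" "h 0 = 0" "h pi = 0"
  shows "real k * integral {0..pi} (\<lambda>t. h t * sin (real k * t)) = integral {0..pi} (\<lambda>t. h' t * cos (real k * t))"
proof -
  have h: "continuous_on {0..pi} h" using assms(1) by (meson DERIV_isCont continuous_at_imp_continuous_on)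
  have "((\<lambda>t. h' t * cos (real k * t) - real k * (h t * sin (real k * t))) has_integral
      (h pi * cos (real k * pi) - h 0 * cos (real k * 0))) {0..pi}"
  proof (rule fundamental_theorem_of_calculus)
    fix t assume t: "t \<in> {0..pi}"
    have "((\<lambda>t. h t * cos (real k * t)) has_real_derivative h' t * cos (real k * t) - real k * (h t * sin (real k * t))) (at t)"
      by (rule derivative_eq_intros assms(1)[OF t] refl)+ (simp add: algebra_simps)
    then show "((\<lambda>t. h t * cos (real k * t)) has_vector_derivative h' t * cos (real k * t) - real k * (h t * sin (real k * t))) (at t within {0..pi})"
      by (simp add: has_real_derivative_iff_has_vector_derivative has_vector_derivative_at_within)
  qed simp
  then have "integral {0..pi} (\<lambda>t. h' t * cos (real k * t) - real k * (h t * sin (real k * t))) = 0"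
    using assms by (simp add: integral_unique)
  also have "integral {0..pi} (\<lambda>t. h' t * cos (real k * t) - real k * (h t * sin (real k * t)))
     = integral {0..pi} (\<lambda>t. h' t * cos (real k * t)) - real k * integral {0..pi} (\<lambda>t. h t * sin (real k * t))"
    by (subst integral_diff) (auto intro!: integrable_continuous_interval continuous_intros assms h)
  finally show ?thesis by simp
qed

text \<open>The product formula for cosines shows that multiplication by cos t preserves the
  vanishing of all cosine coefficients, hence the induction with \<open>u\<close> arbitrary.\<close>

lemma integral_mult_cos_power_eq_0:
  assumes "continuous_on {0..pi} u" "\<And>k. integral {0..pi} (\<lambda>t. u t * cos (real k * t)) = 0"
  shows "integral {0..pi} (\<lambda>t. u t * cos t ^ j) = 0"
  using assms
proof (induction j arbitrary: u)
  case 0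
  then show ?case using "0.prems"(2)[of 0] by simp
next
  case (Suc j)
  have "integral {0..pi} (\<lambda>t. (u t * cos t) * cos t ^ j) = 0"
  proof (rule Suc.IH)
    show "continuous_on {0..pi} (\<lambda>t. u t * cos t)" by (intro continuous_intros Suc.prems)
    fix k :: nat
    show "integral {0..pi} (\<lambda>t. u t * cos t * cos (real k * t)) = 0"
    proof (cases k)
      case 0
      then show ?thesis using Suc.prems(2)[of 1] by simp
    next
      case (Suc m)
      have "(\<lambda>t. u t * cos t * cos (real k * t)) = (\<lambda>t. (u t * cos (real (m + 2) * t) + u t * cos (real m * t)) / 2)"
      proof
        fix t
        have "cos (real (m + 2) * t) = cos (real k * t + t)" "cos (real m * t) = cos (real k * t - t)"
          using Suc by (simp_all add: algebra_simps)
        then have "cos (real (m + 2) * t) + cos (real m * t) = 2 * (cos t * cos (real k * t))"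
          by (simp add: cos_add cos_diff)
        then show "u t * cos t * cos (real k * t) = (u t * cos (real (m + 2) * t) + u t * cos (real m * t)) / 2"
          by (simp only: distrib_left[symmetric])
      qed
      moreover have "integral {0..pi} (\<lambda>t. (u t * cos (real (m + 2) * t) + u t * cos (real m * t)) / 2) = 0"
        using Suc.prems(2)[of "m + 2"] Suc.prems(2)[of m]
        by (subst integral_divide, subst integral_add)
           (auto intro!: integrable_continuous_interval continuous_intros Suc.prems)
      ultimately show ?thesis by simp
    qed
  qed
  then show ?case by (simp add: mult.assoc)
qed

text \<open>In the variable x = cos t the Weierstrass theorem provides a polynomial p with |u -
  p(cos t)| < e. As u is orthogonal to p(cos t), the integral of u^2 equals that of u (u - p(cos t))
  and is at most e times the integral of |u|.\<close>

lemma cos_coeffs_zero_imp_zero: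
  fixes u :: "real \<Rightarrow> real"
  assumes u: "continuous_on {0..pi} u" "\<And>k. integral {0..pi} (\<lambda>t. u t * cos (real k * t)) = 0" and t: "t \<in> {0..pi}"
  shows "u t = 0"
proof -
  have "continuous_on {-1..1} (\<lambda>x. u (arccos x))"
    by (rule continuous_on_compose2[OF u(1)]) (auto intro!: continuous_intros arccos_lbound arccos_ubound)
  define I where "I = integral {0..pi} (\<lambda>t. (u t)\<^sup>2)"
  define J where "J = integral {0..pi} (\<lambda>t. \<bar>u t\<bar>)"
  have J0: "J \<ge> 0" unfolding J_def by (intro integral_nonneg integrable_continuous_interval continuous_intros u) auto
  have le: "I \<le> e * J" if "e > 0" for e
  proof -
    obtain p where p: "real_polynomial_function p" "\<And>x. x \<in> {-1..1} \<Longrightarrow> \<bar>u (arccos x) - p x\<bar> < e"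
      using Stone_Weierstrass_real_polynomial_function[OF compact_Icc
        \<open>continuous_on {-1..1} (\<lambda>x. u (arccos x))\<close> \<open>e > 0\<close>] by blast
    obtain a n where pa: "p = (\<lambda>x. \<Sum>i\<le>n. a i * x ^ i)" using p(1) real_polynomial_function_iff_sum by blast
    have "integral {0..pi} (\<lambda>t. u t * p (cos t)) = integral {0..pi} (\<lambda>t. \<Sum>i\<le>n. a i * (u t * cos t ^ i))"
      by (simp add: pa sum_distrib_left mult_ac)
    also have "\<dots> = (\<Sum>i\<le>n. a i * integral {0..pi} (\<lambda>t. u t * cos t ^ i))"
      by (subst integral_sum) (auto intro!: integrable_continuous_interval continuous_intros u)
    also have "\<dots> = 0" by (simp add: integral_mult_cos_power_eq_0[OF u])
    finally have z: "integral {0..pi} (\<lambda>t. u t * p (cos t)) = 0" .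
    have pc: "continuous_on {0..pi} (\<lambda>t. p (cos t))" unfolding pa by (intro continuous_intros)
    have "I = integral {0..pi} (\<lambda>t. (u t)\<^sup>2 - u t * p (cos t))"
      unfolding I_def by (subst integral_diff) (auto intro!: integrable_continuous_interval continuous_intros u pc simp: z)
    also have "\<dots> \<le> integral {0..pi} (\<lambda>t. e * \<bar>u t\<bar>)"
    proof (rule integral_le)
      fix t assume t: "t \<in> {0..pi}"
      have "(u t)\<^sup>2 - u t * p (cos t) = u t * (u t - p (cos t))" by (simp add: power2_eq_square algebra_simps)
      also have "\<dots> \<le> \<bar>u t\<bar> * \<bar>u t - p (cos t)\<bar>" by (metis abs_ge_self abs_mult)
      also have "\<bar>u t\<bar> * \<bar>u t - p (cos t)\<bar> \<le> \<bar>u t\<bar> * e"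
        using p(2)[of "cos t"] t by (intro mult_left_mono) (auto simp: arccos_cos)
      finally show "(u t)\<^sup>2 - u t * p (cos t) \<le> e * \<bar>u t\<bar>" by (simp only: mult.commute)
    qed (auto intro!: integrable_continuous_interval continuous_intros u pc)
    also have "\<dots> = e * J" unfolding J_def by simp
    finally show ?thesis .
  qed
  have "I \<le> 0"
  proof (rule field_le_epsilon)
    fix e :: real assume "e > 0"
    have "I \<le> e / (J + 1) * J" by (rule le) (use \<open>e > 0\<close> J0 in auto)
    also have "\<dots> \<le> e" using \<open>e > 0\<close> J0 by (simp add: field_simps)
    finally show "I \<le> 0 + e" by simp
  qed
  moreover have "I \<ge> 0" unfolding I_def by (intro integral_nonneg integrable_continuous_interval continuous_intros u) auto
  ultimately have "((\<lambda>t. (u t)\<^sup>2) has_integral 0) (cbox 0 pi)"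
    using integrable_integral[OF integrable_continuous_interval, of 0 pi "\<lambda>t. (u t)\<^sup>2"] u unfolding I_def
    by (auto intro!: continuous_intros)
  then have "(u t)\<^sup>2 = 0"
    using has_integral_0_cbox_imp_0[of 0 pi "\<lambda>t. (u t)\<^sup>2" t] t pi_gt_zero
      continuous_on_power[OF u(1), of 2] by (simp add: box_real not_le)
  then show ?thesis by simp
qed

text \<open>The extra 1/2 for k = 0 allows the uniform formula h t = \<Sum>k. 2 c k cos(kt), that
  is, h is twice the real part of \<Sum>k. c k z^k. For h = ln H this makes exp (\<Sum>k. c k z^k)
  the factor D with |D|^2 = H.\<close>

definition cos_coeff :: "(real \<Rightarrow> real) \<Rightarrow> nat \<Rightarrow> real" where
  "cos_coeff h k = (if k = 0 then 1 / 2 else 1) / pi * integral {0..pi} (\<lambda>t. h t * cos (real k * t))"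

text \<open>Absolute summability makes the sum of the series continuous with the same cosine
  coefficients as h, and continuous functions are determined by these.\<close>

lemma cos_series_expansion:
  assumes h: "continuous_on {0..pi} h" and s: "summable (\<lambda>k. \<bar>cos_coeff h k\<bar>)" and t: "t \<in> {0..pi}"
  shows "(\<lambda>k. 2 * cos_coeff h k * cos (real k * t)) sums h t"
proof -
  define v where "v t = (\<Sum>k. 2 * cos_coeff h k * cos (real k * t))" for t
  have M: "\<bar>2 * cos_coeff h k * cos (real k * t) * cos (real j * t)\<bar> \<le> 2 * \<bar>cos_coeff h k\<bar>" for j k t
  proof -
    have "\<bar>cos (real k * t)\<bar> * \<bar>cos (real j * t)\<bar> \<le> 1 * 1" by (intro mult_mono) auto
    then have "2 * \<bar>cos_coeff h k\<bar> * (\<bar>cos (real k * t)\<bar> * \<bar>cos (real j * t)\<bar>) \<le> 2 * \<bar>cos_coeff h k\<bar> * 1"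
      by (intro mult_left_mono) auto
    then show ?thesis by (simp add: abs_mult mult_ac)
  qed
  have M': "\<bar>2 * cos_coeff h k * cos (real k * t)\<bar> \<le> 2 * \<bar>cos_coeff h k\<bar>" for k t
    using M[of k t 0] by simp
  have s2: "summable (\<lambda>k. 2 * \<bar>cos_coeff h k\<bar>)" using s by (rule summable_mult)
  have vs: "summable (\<lambda>k. 2 * cos_coeff h k * cos (real k * t))" for t
    by (rule summable_comparison_test[OF _ s2]) (use M' in auto)
  have vc: "continuous_on {0..pi} v" unfolding v_def
    by (rule sums_integral_bounded(2)[OF _ _ s2]) (auto intro!: continuous_intros M')
  have "h t - v t = 0"
  proof (rule cos_coeffs_zero_imp_zero[OF _ _ t])
    show "continuous_on {0..pi} (\<lambda>t. h t - v t)" by (intro continuous_intros h vc)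
    fix j
    have "(\<lambda>k. integral {0..pi} (\<lambda>t. 2 * cos_coeff h k * cos (real k * t) * cos (real j * t))) sums
        integral {0..pi} (\<lambda>t. \<Sum>k. 2 * cos_coeff h k * cos (real k * t) * cos (real j * t))"
      by (rule sums_integral_bounded(1)[OF _ _ s2]) (auto intro!: continuous_intros M)
    also have "(\<lambda>t. \<Sum>k. 2 * cos_coeff h k * cos (real k * t) * cos (real j * t)) = (\<lambda>t. v t * cos (real j * t))"
      unfolding v_def using vs by (subst suminf_mult2) auto
    also have "(\<lambda>k. integral {0..pi} (\<lambda>t. 2 * cos_coeff h k * cos (real k * t) * cos (real j * t)))
        = (\<lambda>k. if k = j then 2 * cos_coeff h j * (if j = 0 then pi else pi / 2) else 0)"
      by (rule ext) (simp add: mult.assoc integral_cos_cos)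
    finally have "integral {0..pi} (\<lambda>t. v t * cos (real j * t)) = 2 * cos_coeff h j * (if j = 0 then pi else pi / 2)"
      by (rule sums_unique2) (rule sums_single[of j "\<lambda>_. 2 * cos_coeff h j * (if j = 0 then pi else pi / 2)"])
    also have "\<dots> = integral {0..pi} (\<lambda>t. h t * cos (real j * t))" by (simp add: cos_coeff_def)
    finally show "integral {0..pi} (\<lambda>t. (h t - v t) * cos (real j * t)) = 0"
      by (simp add: left_diff_distrib, subst integral_diff) (auto intro!: integrable_continuous_interval continuous_intros h vc)
  qed
  then show ?thesis using summable_sums[OF vs[of t]] unfolding v_def by simp
qed

section \<open>Principal values and conjugate series\<close>

lemma integral_shift_real:
  fixes f :: "real \<Rightarrow> real"
  assumes "continuous_on {a + c..b + c} f"
  shows "integral {a..b} (\<lambda>x. f (x + c)) = integral {a + c..b + c} f"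
proof -
  have "(f has_integral integral {a + c..b + c} f) (cbox (a + c) (b + c))"
    using assms by (simp add: integrable_continuous_interval integrable_integral)
  then have "((f \<circ> ((+) c)) has_integral integral {a + c..b + c} f) (cbox a b)"
    by (simp only: has_integral_shift_cbox_iff)
  then show ?thesis by (simp add: o_def add.commute integral_unique)
qed

lemma integral_reflect_real:
  fixes f :: "real \<Rightarrow> real"
  assumes "continuous_on {a..b} f"
  shows "integral {a..b} (\<lambda>x. f (a + b - x)) = integral {a..b} f"
proof -
  have "(f has_integral integral {a..b} f) (cbox a b)"
    using assms by (simp add: integrable_continuous_interval integrable_integral)
  from has_integral_affinity[OF this, of "-1" "a + b"]
  have "((\<lambda>x. f (a + b - x)) has_integral integral {a..b} f) ((\<lambda>x. a + b - x) ` {a..b})"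
    by (simp add: algebra_simps)
  also have "(\<lambda>x. a + b - x) ` {a..b} = {a..b}"
    by (auto simp: image_iff intro!: bexI[of _ "a + b - x" for x])
  finally show ?thesis by (rule integral_unique)
qed

text \<open>The trigonometric polynomial sin (k s) cot (s/2).\<close>

definition conj_kernel :: "nat \<Rightarrow> real \<Rightarrow> real" where
  "conj_kernel k s = (\<Sum>j<k. cos (real j * s) + cos (real (Suc j) * s))"

lemma conj_kernel_eq: "sin (real k * s) * cos (s / 2) = sin (s / 2) * conj_kernel k s"
proof (induction k)
  case (Suc k)
  define u where "u = (real k + 1 / 2) * s"
  have k: "real k * s = u - s / 2" "real (Suc k) * s = u + s / 2" by (auto simp: u_def algebra_simps)
  have "sin (u + s / 2) * cos (s / 2) - sin (u - s / 2) * cos (s / 2) = sin (s / 2) * (cos (u - s / 2) + cos (u + s / 2))"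
    by (simp add: sin_add sin_diff cos_add cos_diff algebra_simps)
  then show ?case using Suc unfolding conj_kernel_def sum.lessThan_Suc k by (simp add: algebra_simps)
qed (simp add: conj_kernel_def)

lemma conj_kernel_bound: "\<bar>conj_kernel k s\<bar> \<le> 2 * real k"
proof -
  have "\<bar>conj_kernel k s\<bar> \<le> (\<Sum>j<k. 2)" unfolding conj_kernel_def
  proof (rule order_trans[OF sum_abs], rule sum_mono)
    fix j
    show "\<bar>cos (real j * s) + cos (real (Suc j) * s)\<bar> \<le> 2"
      using abs_cos_le_one[of "real j * s"] abs_cos_le_one[of "real (Suc j) * s"] by linarith
  qed
  then show ?thesis by simp
qed

lemma conj_kernel_cont: "continuous_on S (conj_kernel k)"
  unfolding conj_kernel_def by (intro continuous_intros)

lemma integral_conj_kernel: "integral {0..2 * pi} (conj_kernel k) = (if k = 0 then 0 else 2 * pi)"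
proof -
  have c: "((\<lambda>s. cos (real j * s)) has_integral (if j = 0 then 2 * pi else 0)) {0..2 * pi}" for j
    using has_integral_cos_multiple(2)[of "int j"] has_integral_const_real[of "1::real" 0 "2 * pi"] by auto
  have "(conj_kernel k has_integral (\<Sum>j<k. (if j = 0 then 2 * pi else 0) + (if Suc j = 0 then 2 * pi else 0))) {0..2 * pi}"
    unfolding conj_kernel_def by (intro has_integral_sum has_integral_add c) auto
  then show ?thesis by (cases k) (auto simp: integral_unique sum.lessThan_Suc_shift simp del: sum.lessThan_Suc)
qed

text \<open>Two end pieces of length \<epsilon> are missing, and the kernel is bounded by 2k. That
  the error is linear in k is what asks for summability of k |b k| below.\<close>

lemma integral_conj_kernel_truncated:
  assumes "0 < \<epsilon>" "\<epsilon> < pi"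
  shows "\<bar>integral {\<epsilon>..2 * pi - \<epsilon>} (conj_kernel k) - integral {0..2 * pi} (conj_kernel k)\<bar> \<le> 4 * real k * \<epsilon>"
proof -
  have i: "conj_kernel k integrable_on {a..b}" for a b by (intro integrable_continuous_interval conj_kernel_cont)
  have "integral {0..2 * pi} (conj_kernel k) = integral {0..\<epsilon>} (conj_kernel k) + integral {\<epsilon>..2 * pi} (conj_kernel k)"
    by (rule Henstock_Kurzweil_Integration.integral_combine[symmetric]) (use assms i in auto)
  also have "integral {\<epsilon>..2 * pi} (conj_kernel k) = integral {\<epsilon>..2 * pi - \<epsilon>} (conj_kernel k) + integral {2 * pi - \<epsilon>..2 * pi} (conj_kernel k)"
    by (rule Henstock_Kurzweil_Integration.integral_combine[symmetric]) (use assms i in auto)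
  finally have e: "integral {\<epsilon>..2 * pi - \<epsilon>} (conj_kernel k) - integral {0..2 * pi} (conj_kernel k)
     = - (integral {0..\<epsilon>} (conj_kernel k) + integral {2 * pi - \<epsilon>..2 * pi} (conj_kernel k))" by simp
  have b: "\<bar>integral {a..b} (conj_kernel k)\<bar> \<le> 2 * real k * (b - a)" if "a \<le> b" for a b
    using integral_bound[OF that conj_kernel_cont, of k "2 * real k"] conj_kernel_bound by simp
  show ?thesis unfolding e using b[of 0 \<epsilon>] b[of "2 * pi - \<epsilon>" "2 * pi"] assms by (simp add: algebra_simps)
qed

text \<open>After the shift s = t - \<theta> each term cos(k(s + \<theta>)) cot(s/2) splits into
  cos(ks) cot(s/2), which is odd about s = \<pi> and integrates to zero on the symmetric truncated
  interval, and a multiple of the trigonometric polynomial sin(ks) cot(s/2). The principal value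
  thus becomes an ordinary integral term by term, and the truncation error O(k \<epsilon>) of the
  k-th term is summable.\<close>

lemma pv_integral_cot_eqI:
  assumes \<theta>: "0 < \<theta>" "\<theta> < 2 * pi"
    and u: "\<And>t. (\<lambda>k. 2 * b k * cos (real k * t)) sums u t"
    and b: "summable (\<lambda>k. \<bar>b k\<bar>)" "summable (\<lambda>k. real k * \<bar>b k\<bar>)"
  shows "pv_integral 0 (2 * pi) \<theta> (\<lambda>t. u t / tan ((t - \<theta>) / 2)) = 2 * pi * (\<Sum>k. - 2 * b k * sin (real k * \<theta>))"
proof -
  define \<psi> where "\<psi> t = u t / tan ((t - \<theta>) / 2)" for t
  define V where "V = (\<Sum>k. - 2 * b k * sin (real k * \<theta>) * (if k = 0 then 0 else 2 * pi))"
  define CC where "CC = (\<Sum>k. 8 * (real k * \<bar>b k\<bar>))"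
  have sV: "summable (\<lambda>k. - 2 * b k * sin (real k * \<theta>))"
  proof (rule summable_comparison_test[OF _ summable_mult[OF b(1), of 2]])
    show "\<exists>N. \<forall>n\<ge>N. norm (- 2 * b n * sin (real n * \<theta>)) \<le> 2 * \<bar>b n\<bar>"
      by (auto simp: abs_mult intro!: mult_left_le)
  qed
  have uc: "continuous_on {x..y} u" for x y
  proof -
    have "continuous_on {x..y} (\<lambda>t. \<Sum>k. 2 * b k * cos (real k * t))"
      by (rule sums_integral_bounded(2)[OF _ _ summable_mult[OF b(1), of 2]])
         (auto intro!: continuous_intros mult_left_le simp: abs_mult)
    then show ?thesis using u by (simp add: sums_iff)
  qed
  have per: "u (t + 2 * pi) = u t" for t
  proof -
    have "cos (real k * (t + 2 * pi)) = cos (real k * t)" for k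
      using cos_int_2pin[of "int k"] sin_int_2pin[of "int k"] by (simp add: distrib_left cos_add mult_ac)
    then show ?thesis using sums_unique2[OF u[of "t + 2 * pi"]] u[of t] by simp
  qed
  have main: "\<bar>integral ({0..2 * pi} - ball \<theta> \<epsilon>) \<psi> - V\<bar> \<le> CC * \<epsilon>" if \<epsilon>: "0 < \<epsilon>" "\<epsilon> < \<theta>" "\<epsilon> < 2 * pi - \<theta>" "\<epsilon> < pi" for \<epsilon>
  proof -
    define ct where "ct s = cos (s / 2) / sin (s / 2)" for s :: real
    have sinpos: "sin (s / 2) > 0" if "s \<in> {\<epsilon>..2 * pi - \<epsilon>}" for s
      using that \<epsilon> by (intro sin_gt_zero) auto
    have ctc: "continuous_on {\<epsilon>..2 * pi - \<epsilon>} ct" unfolding ct_def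
    proof (intro continuous_intros)
      show "\<forall>s\<in>{\<epsilon>..2 * pi - \<epsilon>}. sin (s / 2) \<noteq> 0" using sinpos by (metis less_irrefl)
    qed auto
    define \<eta> where "\<eta> t = u t * ct (t - \<theta>)" for t
    have \<psi>\<eta>: "\<psi> t = \<eta> t" for t by (simp add: \<psi>_def \<eta>_def ct_def tan_def)
    have ct_per: "ct (s + 2 * pi) = ct s" for s
      by (simp add: ct_def add_divide_distrib)
    have \<eta>per: "\<eta> (t + 2 * pi) = \<eta> t" for t using per[of t] ct_per[of "t - \<theta>"] by (simp add: \<eta>_def algebra_simps)
    have \<eta>c: "continuous_on {\<theta> + \<epsilon>..\<theta> + 2 * pi - \<epsilon>} \<eta>"
      unfolding \<eta>_def by (intro continuous_intros uc continuous_on_compose2[OF ctc]) auto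
    have \<eta>c0: "continuous_on {0..\<theta> - \<epsilon>} \<eta>"
    proof -
      have "continuous_on {0..\<theta> - \<epsilon>} (\<lambda>t. \<eta> (t + 2 * pi))"
        by (rule continuous_on_compose2[OF \<eta>c]) (use \<epsilon> \<theta> in \<open>auto intro!: continuous_intros\<close>)
      then show ?thesis by (simp add: \<eta>per)
    qed
    have set: "{0..2 * pi} - ball \<theta> \<epsilon> = {0..\<theta> - \<epsilon>} \<union> {\<theta> + \<epsilon>..2 * pi}"
      using \<epsilon> \<theta> by (auto simp: ball_def dist_real_def abs_if split: if_splits)
    have "integral ({0..2 * pi} - ball \<theta> \<epsilon>) \<psi> = integral {0..\<theta> - \<epsilon>} \<eta> + integral {\<theta> + \<epsilon>..2 * pi} \<eta>"
      unfolding set \<psi>\<eta>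
    proof (rule integral_Un)
      show "\<eta> integrable_on {0..\<theta> - \<epsilon>}" by (rule integrable_continuous_interval[OF \<eta>c0])
      show "\<eta> integrable_on {\<theta> + \<epsilon>..2 * pi}"
        by (rule integrable_continuous_interval, rule continuous_on_subset[OF \<eta>c]) (use \<epsilon> \<theta> in auto)
      have "{0..\<theta> - \<epsilon>} \<inter> {\<theta> + \<epsilon>..2 * pi} = {}" using \<epsilon> by auto
      then show "negligible ({0..\<theta> - \<epsilon>} \<inter> {\<theta> + \<epsilon>..2 * pi})" by simp
    qed
    \<comment> \<open>Periodicity moves the piece left of the singularity behind the right one;
      together they form a single interval of length 2\<pi> - 2\<epsilon>.\<close>
    also have "integral {0..\<theta> - \<epsilon>} \<eta> = integral {0..\<theta> - \<epsilon>} (\<lambda>t. \<eta> (t + 2 * pi))" by (simp add: \<eta>per)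
    also have "\<dots> = integral {0 + 2 * pi..\<theta> - \<epsilon> + 2 * pi} \<eta>"
      by (rule integral_shift_real, rule continuous_on_subset[OF \<eta>c]) (use \<epsilon> \<theta> in auto)
    also have "integral {0 + 2 * pi..\<theta> - \<epsilon> + 2 * pi} \<eta> + integral {\<theta> + \<epsilon>..2 * pi} \<eta> = integral {\<theta> + \<epsilon>..\<theta> - \<epsilon> + 2 * pi} \<eta>"
      using Henstock_Kurzweil_Integration.integral_combine[of "\<theta> + \<epsilon>" "2 * pi" "\<theta> - \<epsilon> + 2 * pi" \<eta>] integrable_continuous_interval[OF \<eta>c] \<epsilon> \<theta>
      by (simp add: algebra_simps)
    also have "\<dots> = integral {\<epsilon> + \<theta>..2 * pi - \<epsilon> + \<theta>} \<eta>" by (simp add: algebra_simps)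
    also have "\<dots> = integral {\<epsilon>..2 * pi - \<epsilon>} (\<lambda>s. \<eta> (s + \<theta>))"
      by (rule integral_shift_real[symmetric]) (use \<eta>c in \<open>simp add: algebra_simps\<close>)
    also have "(\<lambda>s. \<eta> (s + \<theta>)) = (\<lambda>s. \<Sum>k. 2 * b k * cos (real k * (s + \<theta>)) * ct s)"
      using sums_mult2[OF u] by (auto simp: \<eta>_def sums_iff)
    finally have I1: "integral ({0..2 * pi} - ball \<theta> \<epsilon>) \<psi> = integral {\<epsilon>..2 * pi - \<epsilon>} (\<lambda>s. \<Sum>k. 2 * b k * cos (real k * (s + \<theta>)) * ct s)" .
    obtain m where m: "\<And>s. s \<in> {\<epsilon>..2 * pi - \<epsilon>} \<Longrightarrow> \<bar>ct s\<bar> \<le> m"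
      using compact_imp_bounded[OF compact_continuous_image[OF ctc compact_Icc]] unfolding bounded_iff
      by (metis imageI real_norm_def)
    have "(\<lambda>k. integral {\<epsilon>..2 * pi - \<epsilon>} (\<lambda>s. 2 * b k * cos (real k * (s + \<theta>)) * ct s)) sums
        integral {\<epsilon>..2 * pi - \<epsilon>} (\<lambda>s. \<Sum>k. 2 * b k * cos (real k * (s + \<theta>)) * ct s)"
    proof (rule sums_integral_bounded(1))
      show "continuous_on {\<epsilon>..2 * pi - \<epsilon>} (\<lambda>s. 2 * b k * cos (real k * (s + \<theta>)) * ct s)" for k
        by (intro continuous_intros ctc)
      show "\<bar>2 * b k * cos (real k * (s + \<theta>)) * ct s\<bar> \<le> 2 * \<bar>b k\<bar> * m" if "s \<in> {\<epsilon>..2 * pi - \<epsilon>}" for k s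
      proof -
        have "\<bar>cos (real k * (s + \<theta>))\<bar> * \<bar>ct s\<bar> \<le> 1 * m" by (intro mult_mono m that) auto
        from mult_left_mono[OF this, of "2 * \<bar>b k\<bar>"] show ?thesis by (simp add: abs_mult mult_ac)
      qed
      show "summable (\<lambda>k. 2 * \<bar>b k\<bar> * m)" by (intro summable_mult2 summable_mult b)
    qed
    moreover have "integral {\<epsilon>..2 * pi - \<epsilon>} (\<lambda>s. 2 * b k * cos (real k * (s + \<theta>)) * ct s)
       = - 2 * b k * sin (real k * \<theta>) * integral {\<epsilon>..2 * pi - \<epsilon>} (conj_kernel k)" for k
    proof -
      define e where "e s = cos (real k * s) * ct s" for s
      have ec: "continuous_on {\<epsilon>..2 * pi - \<epsilon>} e" unfolding e_def by (intro continuous_intros ctc)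
      \<comment> \<open>The reflection s to 2\<pi> - s fixes cos(ks) and changes the sign of
        cot(s/2).\<close>
      have odd: "e (\<epsilon> + (2 * pi - \<epsilon>) - s) = - e s" for s
      proof -
        have "cos (real k * (2 * pi - s)) = cos (real k * s)"
          using cos_int_2pin[of "int k"] sin_int_2pin[of "int k"] by (simp add: right_diff_distrib cos_diff mult_ac)
        moreover have "(2 * pi - s) / 2 = pi - s / 2" by simp
        then have "ct (2 * pi - s) = - ct s" unfolding ct_def by (simp only: cos_pi_minus sin_pi_minus minus_divide_left)
        ultimately show ?thesis by (simp add: e_def)
      qed
      have "integral {\<epsilon>..2 * pi - \<epsilon>} e = - integral {\<epsilon>..2 * pi - \<epsilon>} e"
        using integral_reflect_real[OF ec] unfolding odd by simp
      then have e0: "integral {\<epsilon>..2 * pi - \<epsilon>} e = 0" by simp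
      have "integral {\<epsilon>..2 * pi - \<epsilon>} (\<lambda>s. 2 * b k * cos (real k * (s + \<theta>)) * ct s)
         = integral {\<epsilon>..2 * pi - \<epsilon>} (\<lambda>s. (2 * b k * cos (real k * \<theta>)) * e s + (- 2 * b k * sin (real k * \<theta>)) * conj_kernel k s)"
      proof (rule integral_cong)
        fix s assume s: "s \<in> {\<epsilon>..2 * pi - \<epsilon>}"
        have "sin (real k * s) * ct s = conj_kernel k s"
          using conj_kernel_eq[of k s] sinpos[OF s] by (simp add: ct_def field_simps)
        then show "2 * b k * cos (real k * (s + \<theta>)) * ct s
           = (2 * b k * cos (real k * \<theta>)) * e s + (- 2 * b k * sin (real k * \<theta>)) * conj_kernel k s"
          unfolding e_def by (simp add: distrib_left cos_add left_diff_distrib right_diff_distrib)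
      qed
      also have "\<dots> = (2 * b k * cos (real k * \<theta>)) * integral {\<epsilon>..2 * pi - \<epsilon>} e
          + (- 2 * b k * sin (real k * \<theta>)) * integral {\<epsilon>..2 * pi - \<epsilon>} (conj_kernel k)"
        by (subst integral_add) (auto intro!: integrable_continuous_interval continuous_intros ec conj_kernel_cont)
      finally show ?thesis using e0 by simp
    qed
    ultimately have sJ: "(\<lambda>k. - 2 * b k * sin (real k * \<theta>) * integral {\<epsilon>..2 * pi - \<epsilon>} (conj_kernel k)) sums
        integral ({0..2 * pi} - ball \<theta> \<epsilon>) \<psi>" by (simp add: I1)
    have "(\<lambda>k. - 2 * b k * sin (real k * \<theta>) * (if k = 0 then 0 else 2 * pi)) sums V"
    proof -
      have "(\<lambda>k. - 2 * b k * sin (real k * \<theta>) * (if k = 0 then 0 else 2 * pi)) = (\<lambda>k. - 2 * b k * sin (real k * \<theta>) * (2 * pi))"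
        by auto
      then show ?thesis unfolding V_def using summable_sums[OF summable_mult2[OF sV, of "2 * pi"]] by (simp only:)
    qed
    from sums_diff[OF sJ this]
    have D: "(\<lambda>k. - 2 * b k * sin (real k * \<theta>) * (integral {\<epsilon>..2 * pi - \<epsilon>} (conj_kernel k) - (if k = 0 then 0 else 2 * pi))) sums
        (integral ({0..2 * pi} - ball \<theta> \<epsilon>) \<psi> - V)" by (simp only: right_diff_distrib)
    have "\<bar>- 2 * b k * sin (real k * \<theta>) * (integral {\<epsilon>..2 * pi - \<epsilon>} (conj_kernel k) - (if k = 0 then 0 else 2 * pi))\<bar> \<le> 8 * (real k * \<bar>b k\<bar>) * \<epsilon>" for k
    proof -
      have "\<bar>sin (real k * \<theta>)\<bar> * \<bar>integral {\<epsilon>..2 * pi - \<epsilon>} (conj_kernel k) - (if k = 0 then 0 else 2 * pi)\<bar> \<le> 1 * (4 * real k * \<epsilon>)"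
        using integral_conj_kernel_truncated[OF \<epsilon>(1,4), of k] unfolding integral_conj_kernel
        by (intro mult_mono) auto
      from mult_left_mono[OF this, of "2 * \<bar>b k\<bar>"] show ?thesis by (simp add: abs_mult mult_ac)
    qed
    moreover have "(\<lambda>k. 8 * (real k * \<bar>b k\<bar>) * \<epsilon>) sums (CC * \<epsilon>)"
      unfolding CC_def by (intro sums_mult2 summable_sums summable_mult b)
    ultimately show ?thesis
      using D norm_sums_le[OF D, of "\<lambda>k. 8 * (real k * \<bar>b k\<bar>) * \<epsilon>"] by simp
  qed
  have CC: "CC \<ge> 0" unfolding CC_def by (intro suminf_nonneg summable_mult b) auto
  have "((\<lambda>\<epsilon>. integral ({0..2 * pi} - ball \<theta> \<epsilon>) \<psi>) \<longlongrightarrow> V) (at_right 0)"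
  proof (rule LIM_zero_cancel, rule Lim_null_comparison)
    have "eventually (\<lambda>\<epsilon>. 0 < \<epsilon> \<and> \<epsilon> < min (min \<theta> (2 * pi - \<theta>)) pi) (at_right 0)"
      using \<theta> by (intro eventually_conj eventually_at_right_less eventually_at_rightI[of 0 "min (min \<theta> (2 * pi - \<theta>)) pi"]) auto
    then show "\<forall>\<^sub>F \<epsilon> in at_right 0. norm (integral ({0..2 * pi} - ball \<theta> \<epsilon>) \<psi> - V) \<le> CC * \<epsilon>"
      by eventually_elim (use main in auto)
    have "((\<lambda>\<epsilon>. CC * \<epsilon>) \<longlongrightarrow> CC * 0) (at_right 0)" by (intro tendsto_intros)
    then show "((\<lambda>\<epsilon>. CC * \<epsilon>) \<longlongrightarrow> 0) (at_right 0)" by simp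
  qed
  then have "pv_integral 0 (2 * pi) \<theta> \<psi> = V" unfolding pv_integral_def by (intro tendsto_Lim) auto
  also have "V = (\<Sum>k. - 2 * b k * sin (real k * \<theta>) * (2 * pi))" unfolding V_def by (intro arg_cong[where f=suminf]) auto
  also have "\<dots> = 2 * pi * (\<Sum>k. - 2 * b k * sin (real k * \<theta>))"
    using suminf_mult2[OF sV, of "2 * pi"] by (simp add: mult.commute)
  finally show ?thesis unfolding \<psi>_def .
qed

text \<open>Since tan has period \<pi>, the second integral has the same form with 2\<pi> - \<theta>
  in place of \<theta>. Its value is the negative of the first, so the two halves of
  \<open>rho\<close> add up: 1/(4\<pi>) times 2\<pi>, twice. The sum is the conjugate series of ln
  H, which is the reason why \<rho>/2 is the argument of 1/D.\<close>

lemma rho_eq_series: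
  assumes \<theta>: "0 < \<theta>" "\<theta> < pi"
    and u: "\<And>t. (\<lambda>k. 2 * b k * cos (real k * t)) sums ln (H_quot f t \<theta>)"
    and b: "summable (\<lambda>k. \<bar>b k\<bar>)" "summable (\<lambda>k. real k * \<bar>b k\<bar>)"
  shows "rho f \<theta> = (\<Sum>k. - 2 * b k * sin (real k * \<theta>))"
proof -
  have 1: "pv_integral 0 (2 * pi) \<theta> (\<lambda>t. ln (H_quot f t \<theta>) / tan ((t - \<theta>) / 2)) = 2 * pi * (\<Sum>k. - 2 * b k * sin (real k * \<theta>))"
    by (rule pv_integral_cot_eqI) (use \<theta> u b in auto)
  have e: "tan ((t + \<theta>) / 2) = tan ((t - (2 * pi - \<theta>)) / 2)" for t
  proof -
    have "(t + \<theta>) / 2 = (t - (2 * pi - \<theta>)) / 2 + pi" by (simp add: field_simps)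
    then show ?thesis by (simp only: tan_periodic_pi)
  qed
  have "pv_integral 0 (2 * pi) (2 * pi - \<theta>) (\<lambda>t. ln (H_quot f t \<theta>) / tan ((t + \<theta>) / 2)) = 2 * pi * (\<Sum>k. - 2 * b k * sin (real k * (2 * pi - \<theta>)))"
    unfolding e by (rule pv_integral_cot_eqI) (use \<theta> u b in auto)
  also have "(\<lambda>k. - 2 * b k * sin (real k * (2 * pi - \<theta>))) = (\<lambda>k. - (- 2 * b k * sin (real k * \<theta>)))"
  proof (rule ext)
    fix k
    have "sin (real k * (2 * pi - \<theta>)) = - sin (real k * \<theta>)"
      using cos_int_2pin[of "int k"] sin_int_2pin[of "int k"] by (simp add: right_diff_distrib sin_diff mult_ac)
    then show "- 2 * b k * sin (real k * (2 * pi - \<theta>)) = - (- 2 * b k * sin (real k * \<theta>))" by simp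
  qed
  also have "(\<Sum>k. - (- 2 * b k * sin (real k * \<theta>))) = - (\<Sum>k. - 2 * b k * sin (real k * \<theta>))"
  proof (rule suminf_minus)
    show "summable (\<lambda>k. - 2 * b k * sin (real k * \<theta>))"
      by (rule summable_comparison_test[OF _ summable_mult[OF b(1), of 2]])
         (auto simp: abs_mult intro!: mult_left_le)
  qed
  finally have 2: "pv_integral 0 (2 * pi) (2 * pi - \<theta>) (\<lambda>t. ln (H_quot f t \<theta>) / tan ((t + \<theta>) / 2))
      = 2 * pi * - (\<Sum>k. - 2 * b k * sin (real k * \<theta>))" .
  have "1 / (4 * pi) * (2 * pi * X) - 1 / (4 * pi) * (2 * pi * - X) = X" for X :: real by (simp add: field_simps)
  then show ?thesis unfolding rho_def 1 2 .
qed

section \<open>Smooth even functions depending on a parameter\<close>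

text \<open>Functions of class C^k in two variables. The recursion through both partial derivatives
  turns the closure properties into inductions, and asking for a total derivative at each stage
  gives continuity and the restriction to lines for free.\<close>

primrec C_diff :: "nat \<Rightarrow> (real \<times> real) set \<Rightarrow> (real \<times> real \<Rightarrow> real) \<Rightarrow> bool" where
  "C_diff 0 U F \<longleftrightarrow> continuous_on U F"
| "C_diff (Suc k) U F \<longleftrightarrow> (\<exists>Fx Fy. (\<forall>p\<in>U. (F has_derivative (\<lambda>h. Fx p * fst h + Fy p * snd h)) (at p)) \<and>
     C_diff k U Fx \<and> C_diff k U Fy)"

lemma C_diff_SucI:
  assumes "\<And>p. p \<in> U \<Longrightarrow> (F has_derivative (\<lambda>h. Fx p * fst h + Fy p * snd h)) (at p)"
    "C_diff k U Fx" "C_diff k U Fy"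
  shows "C_diff (Suc k) U F"
  unfolding C_diff.simps by (rule exI[of _ Fx], rule exI[of _ Fy]) (use assms in blast)

lemma C_diff_continuous:
  assumes "C_diff k U F"
  shows "continuous_on U F"
proof (cases k)
  case (Suc j)
  then obtain Fx Fy where "\<forall>p\<in>U. (F has_derivative (\<lambda>h. Fx p * fst h + Fy p * snd h)) (at p)"
    using assms by auto
  then show ?thesis by (meson continuous_at_imp_continuous_on has_derivative_continuous)
qed (use assms in simp)

lemma C_diff_Suc_imp: "C_diff (Suc k) U F \<Longrightarrow> C_diff k U F"
proof (induction k arbitrary: F)
  case 0
  then show ?case unfolding C_diff.simps(1) by (rule C_diff_continuous)
next
  case (Suc k)
  from Suc.prems obtain Fx Fy where F: "\<forall>p\<in>U. (F has_derivative (\<lambda>h. Fx p * fst h + Fy p * snd h)) (at p)"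
    "C_diff (Suc k) U Fx" "C_diff (Suc k) U Fy" unfolding C_diff.simps(2)[of "Suc k"] by blast
  show ?case
    by (rule C_diff_SucI[OF F(1)[rule_format] Suc.IH[OF F(2)] Suc.IH[OF F(3)]])
qed

lemma C_diff_cong:
  assumes "open U" "\<And>p. p \<in> U \<Longrightarrow> F p = G p" "C_diff k U F"
  shows "C_diff k U G"
proof (cases k)
  case 0
  then show ?thesis using assms continuous_on_cong[of U U F G] by simp
next
  case (Suc j)
  then obtain Fx Fy where F: "\<forall>p\<in>U. (F has_derivative (\<lambda>h. Fx p * fst h + Fy p * snd h)) (at p)" "C_diff j U Fx" "C_diff j U Fy"
    using assms by auto
  have "(G has_derivative (\<lambda>h. Fx p * fst h + Fy p * snd h)) (at p)" if "p \<in> U" for p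
    by (rule has_derivative_transform_within_open[OF F(1)[rule_format, OF that] assms(1) that assms(2)])
  then show ?thesis unfolding Suc using F by (intro C_diff_SucI[of U G Fx Fy]) auto
qed

lemma C_diff_const: "C_diff k U (\<lambda>p. c)"
  by (induction k arbitrary: c) (auto intro!: exI[of _ "\<lambda>_. 0"])

lemma C_diff_add: "C_diff k U F \<Longrightarrow> C_diff k U G \<Longrightarrow> C_diff k U (\<lambda>p. F p + G p)"
proof (induction k arbitrary: F G)
  case (Suc k)
  from Suc.prems(1) obtain Fx Fy where
    F: "\<forall>p\<in>U. (F has_derivative (\<lambda>h. Fx p * fst h + Fy p * snd h)) (at p)" "C_diff k U Fx" "C_diff k U Fy" by auto
  from Suc.prems(2) obtain Gx Gy where
    G: "\<forall>p\<in>U. (G has_derivative (\<lambda>h. Gx p * fst h + Gy p * snd h)) (at p)" "C_diff k U Gx" "C_diff k U Gy" by auto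
  have "((\<lambda>p. F p + G p) has_derivative (\<lambda>h. (Fx p + Gx p) * fst h + (Fy p + Gy p) * snd h)) (at p)" if "p \<in> U" for p
    using has_derivative_add[OF F(1)[rule_format, OF that] G(1)[rule_format, OF that]] by (simp add: algebra_simps)
  then show ?case using Suc.IH[OF F(2) G(2)] Suc.IH[OF F(3) G(3)] by (rule C_diff_SucI)
qed (auto intro: continuous_intros)

lemma C_diff_mult: "C_diff k U F \<Longrightarrow> C_diff k U G \<Longrightarrow> C_diff k U (\<lambda>p. F p * G p)"
proof (induction k arbitrary: F G)
  case (Suc k)
  from Suc.prems(1) obtain Fx Fy where
    F: "\<forall>p\<in>U. (F has_derivative (\<lambda>h. Fx p * fst h + Fy p * snd h)) (at p)" "C_diff k U Fx" "C_diff k U Fy" by auto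
  from Suc.prems(2) obtain Gx Gy where
    G: "\<forall>p\<in>U. (G has_derivative (\<lambda>h. Gx p * fst h + Gy p * snd h)) (at p)" "C_diff k U Gx" "C_diff k U Gy" by auto
  have "((\<lambda>p. F p * G p) has_derivative (\<lambda>h. (F p * Gx p + Fx p * G p) * fst h + (F p * Gy p + Fy p * G p) * snd h)) (at p)" if "p \<in> U" for p
    using has_derivative_mult[OF F(1)[rule_format, OF that] G(1)[rule_format, OF that]] by (simp add: algebra_simps)
  moreover have FG: "C_diff k U F" "C_diff k U G" using Suc.prems C_diff_Suc_imp by blast+
  have "C_diff k U (\<lambda>p. F p * Gx p + Fx p * G p)" "C_diff k U (\<lambda>p. F p * Gy p + Fy p * G p)"
    by (intro C_diff_add Suc.IH FG F G)+
  ultimately show ?case by (rule C_diff_SucI)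
qed (auto intro: continuous_intros)

lemma C_diff_inverse: "C_diff k U F \<Longrightarrow> (\<And>p. p \<in> U \<Longrightarrow> F p \<noteq> 0) \<Longrightarrow> C_diff k U (\<lambda>p. inverse (F p))"
proof (induction k arbitrary: F)
  case (Suc k)
  from Suc.prems(1) obtain Fx Fy where
    F: "\<forall>p\<in>U. (F has_derivative (\<lambda>h. Fx p * fst h + Fy p * snd h)) (at p)" "C_diff k U Fx" "C_diff k U Fy" by auto
  let ?D = "\<lambda>p. (- 1) * (inverse (F p) * inverse (F p))"
  have "((\<lambda>p. inverse (F p)) has_derivative (\<lambda>h. (?D p * Fx p) * fst h + (?D p * Fy p) * snd h)) (at p)" if "p \<in> U" for p
    using Deriv.has_derivative_inverse[OF Suc.prems(2)[OF that] F(1)[rule_format, OF that]] by (simp add: algebra_simps)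
  moreover have "C_diff k U (\<lambda>p. inverse (F p))" by (rule Suc.IH[OF C_diff_Suc_imp[OF Suc.prems(1)] Suc.prems(2)])
  then have D: "C_diff k U ?D" by (intro C_diff_mult C_diff_const)
  have "C_diff k U (\<lambda>p. ?D p * Fx p)" "C_diff k U (\<lambda>p. ?D p * Fy p)"
    by (rule C_diff_mult[OF D F(2)], rule C_diff_mult[OF D F(3)])
  ultimately show ?case by (rule C_diff_SucI)
qed (auto intro: continuous_intros)

text \<open>The partial derivatives of ln F contain only 1/F and those of F, so one differentiation
  reduces the claim to the closure properties above.\<close>

lemma C_diff_ln:
  assumes "C_diff k U F" "\<And>p. p \<in> U \<Longrightarrow> F p > 0"
  shows "C_diff k U (\<lambda>p. ln (F p))"
proof (cases k)
  case 0
  then show ?thesis using assms by (force intro!: continuous_intros)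
next
  case (Suc j)
  with assms(1) obtain Fx Fy where
    F: "\<forall>p\<in>U. (F has_derivative (\<lambda>h. Fx p * fst h + Fy p * snd h)) (at p)" "C_diff j U Fx" "C_diff j U Fy"
    by auto
  have "((\<lambda>p. ln (F p)) has_derivative (\<lambda>h. (inverse (F p) * Fx p) * fst h + (inverse (F p) * Fy p) * snd h)) (at p)" if "p \<in> U" for p
    using has_derivative_ln[OF assms(2)[OF that] F(1)[rule_format, OF that]] by (simp add: algebra_simps)
  moreover have I: "C_diff j U (\<lambda>p. inverse (F p))"
  proof (rule C_diff_inverse)
    show "C_diff j U F" by (rule C_diff_Suc_imp) (use assms(1) Suc in \<open>simp only:\<close>)
    show "F p \<noteq> 0" if "p \<in> U" for p using assms(2)[OF that] by simp
  qed
  have "C_diff j U (\<lambda>p. inverse (F p) * Fx p)" "C_diff j U (\<lambda>p. inverse (F p) * Fy p)"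
    by (rule C_diff_mult[OF I F(2)], rule C_diff_mult[OF I F(3)])
  ultimately show ?thesis unfolding Suc by (rule C_diff_SucI)
qed

section \<open>Integrals along segments\<close>

lemma continuous_on_segment_integrand:
  fixes c \<phi> :: "real \<Rightarrow> real"
  assumes c: "continuous_on {0..1} c" and \<phi>: "continuous_on UNIV \<phi>"
  shows "continuous_on (UNIV \<times> cbox 0 1) (\<lambda>(p :: real \<times> real, s). c s * \<phi> (snd p + s * (fst p - snd p)))"
    and "continuous_on (cbox 0 1) (\<lambda>s. c s * \<phi> (snd p + s * (fst p - snd p)))"
proof -
  have "continuous_on (UNIV \<times> cbox 0 1) (\<lambda>q :: (real \<times> real) \<times> real. c (snd q))"
    by (rule continuous_on_compose2[OF c]) (auto intro!: continuous_on_snd continuous_on_id)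
  moreover have "continuous_on (UNIV \<times> cbox 0 1) (\<lambda>q :: (real \<times> real) \<times> real. \<phi> (snd (fst q) + snd q * (fst (fst q) - snd (fst q))))"
    by (rule continuous_on_compose2[OF \<phi>])
       (auto intro!: continuous_on_add continuous_on_mult continuous_on_diff continuous_on_snd continuous_on_fst continuous_on_id)
  ultimately show "continuous_on (UNIV \<times> cbox 0 1) (\<lambda>(p :: real \<times> real, s). c s * \<phi> (snd p + s * (fst p - snd p)))"
    unfolding split_beta by (rule continuous_on_mult)
  have "continuous_on (cbox 0 1) (\<lambda>s. \<phi> (snd p + s * (fst p - snd p)))"
    by (rule continuous_on_compose2[OF \<phi>]) (auto intro!: continuous_on_add continuous_on_mult continuous_on_const continuous_on_id)
  then show "continuous_on (cbox 0 1) (\<lambda>s. c s * \<phi> (snd p + s * (fst p - snd p)))"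
    using c by (intro continuous_on_mult) auto
qed

text \<open>Differentiation under the integral sign reproduces the same form with the weights s c(s)
  and (1 - s) c(s). The weight \<open>c\<close> is carried along for the sake of this
  induction.\<close>

lemma C_diff_segment_integral:
  assumes "\<And>i x. i < k \<Longrightarrow> (\<phi> i has_real_derivative \<phi> (Suc i) x) (at x)" "continuous_on UNIV (\<phi> k)"
    and c: "continuous_on {0..1} c"
  shows "C_diff k UNIV (\<lambda>p. integral {0..1} (\<lambda>s. c s * \<phi> 0 (snd p + s * (fst p - snd p))))"
  using assms
proof (induction k arbitrary: \<phi> c)
  case 0
  have "continuous_on (UNIV \<times> cbox 0 1) (\<lambda>(p :: real \<times> real, s). c s * \<phi> 0 (snd p + s * (fst p - snd p)))"
    by (rule continuous_on_segment_integrand) (use 0 in auto)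
  then show ?case using integral_continuous_on_param[of UNIV 0 "1::real" "\<lambda>p s. c s * \<phi> 0 (snd p + s * (fst p - snd p))"]
    by simp
next
  case (Suc k)
  have d0: "(\<phi> 0 has_real_derivative \<phi> (Suc 0) x) (at x)" for x using Suc.prems(1) by simp
  have c1: "continuous_on UNIV (\<phi> (Suc 0))"
  proof (cases k)
    case (Suc j)
    then show ?thesis using Suc.prems(1)[of "Suc 0"]
      by (auto intro!: continuous_at_imp_continuous_on DERIV_isCont)
  qed (use Suc in simp)
  have c0: "continuous_on UNIV (\<phi> 0)" using d0 by (auto intro!: continuous_at_imp_continuous_on DERIV_isCont)
  define X where "X p s = (c s * s) * \<phi> (Suc 0) (snd p + s * (fst p - snd p))" for p :: "real \<times> real" and s
  define Y where "Y p s = (c s * (1 - s)) * \<phi> (Suc 0) (snd p + s * (fst p - snd p))" for p :: "real \<times> real" and s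
  have cs: "continuous_on {0..1} (\<lambda>s. c s * s)" "continuous_on {0..1} (\<lambda>s. c s * (1 - s))"
    by (intro continuous_on_mult continuous_on_diff continuous_on_const continuous_on_id Suc.prems(3))+
  have cX: "continuous_on (UNIV \<times> cbox 0 1) (\<lambda>(p, s). X p s)" "continuous_on (UNIV \<times> cbox 0 1) (\<lambda>(p, s). Y p s)"
    unfolding X_def Y_def by (rule continuous_on_segment_integrand(1)[OF cs(1) c1], rule continuous_on_segment_integrand(1)[OF cs(2) c1])
  have cXs: "continuous_on (cbox 0 1) (X p)" "continuous_on (cbox 0 1) (Y p)" for p
    unfolding X_def Y_def by (rule continuous_on_segment_integrand(2)[OF cs(1) c1], rule continuous_on_segment_integrand(2)[OF cs(2) c1])
  have "((\<lambda>p. integral {0..1} (\<lambda>s. c s * \<phi> 0 (snd p + s * (fst p - snd p)))) has_derivative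
      (\<lambda>h. integral {0..1} (X p) * fst h + integral {0..1} (Y p) * snd h)) (at p)" for p
  proof -
    have "((\<lambda>p. integral (cbox 0 1) (\<lambda>s. c s * \<phi> 0 (snd p + s * (fst p - snd p)))) has_derivative
       integral (cbox 0 1) (\<lambda>s. X p s *\<^sub>R fst_blinfun + Y p s *\<^sub>R snd_blinfun)) (at p within UNIV)"
    proof (rule leibniz_rule)
      fix p :: "real \<times> real" and s :: real assume s: "s \<in> cbox 0 1"
      have "((\<lambda>p::real \<times> real. snd p + s * (fst p - snd p)) has_derivative (\<lambda>h. snd h + s * (fst h - snd h))) (at p)"
        by (auto intro!: derivative_eq_intros)
      from has_derivative_compose[OF this d0[unfolded has_field_derivative_def]]
      have "((\<lambda>p. \<phi> 0 (snd p + s * (fst p - snd p))) has_derivative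
          (\<lambda>h. \<phi> (Suc 0) (snd p + s * (fst p - snd p)) * (snd h + s * (fst h - snd h)))) (at p)" .
      then have "((\<lambda>p. c s * \<phi> 0 (snd p + s * (fst p - snd p))) has_derivative
          (\<lambda>h. c s * (\<phi> (Suc 0) (snd p + s * (fst p - snd p)) * (snd h + s * (fst h - snd h))))) (at p)"
        by (rule has_derivative_mult_right)
      also have "(\<lambda>h. c s * (\<phi> (Suc 0) (snd p + s * (fst p - snd p)) * (snd h + s * (fst h - snd h))))
          = blinfun_apply (X p s *\<^sub>R fst_blinfun + Y p s *\<^sub>R snd_blinfun)"
        by (auto simp: X_def Y_def algebra_simps blinfun.bilinear_simps)
      finally show "((\<lambda>p. c s * \<phi> 0 (snd p + s * (fst p - snd p))) has_derivative
          blinfun_apply (X p s *\<^sub>R fst_blinfun + Y p s *\<^sub>R snd_blinfun)) (at p within UNIV)" by simp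
    next
      fix p :: "real \<times> real"
      show "(\<lambda>s. c s * \<phi> 0 (snd p + s * (fst p - snd p))) integrable_on cbox 0 1"
        by (rule integrable_continuous[OF continuous_on_segment_integrand(2)[OF Suc.prems(3) c0]])
      show "continuous_on (UNIV \<times> cbox 0 1) (\<lambda>(p, s). X p s *\<^sub>R fst_blinfun + Y p s *\<^sub>R (snd_blinfun :: (real \<times> real) \<Rightarrow>\<^sub>L real))"
        using cX unfolding split_beta by (intro continuous_on_add continuous_on_scaleR continuous_on_const)
    qed auto
    also have "integral (cbox 0 1) (\<lambda>s. X p s *\<^sub>R fst_blinfun + Y p s *\<^sub>R snd_blinfun)
        = integral (cbox 0 1) (X p) *\<^sub>R fst_blinfun + integral (cbox 0 1) (Y p) *\<^sub>R (snd_blinfun :: (real \<times> real) \<Rightarrow>\<^sub>L real)"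
    proof (rule integral_unique)
      have "((X p) has_integral integral (cbox 0 1) (X p)) (cbox 0 1)" "((Y p) has_integral integral (cbox 0 1) (Y p)) (cbox 0 1)"
        using integrable_continuous cXs integrable_integral by blast+
      then show "((\<lambda>s. X p s *\<^sub>R fst_blinfun + Y p s *\<^sub>R (snd_blinfun :: (real \<times> real) \<Rightarrow>\<^sub>L real)) has_integral
         integral (cbox 0 1) (X p) *\<^sub>R fst_blinfun + integral (cbox 0 1) (Y p) *\<^sub>R snd_blinfun) (cbox 0 1)"
        by (intro has_integral_add has_integral_scaleR_left)
    qed
    also have "blinfun_apply \<dots> = (\<lambda>h. integral {0..1} (X p) * fst h + integral {0..1} (Y p) * snd h)"
      by (auto simp: blinfun.bilinear_simps)
    finally show ?thesis by simp
  qed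
  moreover have "C_diff k UNIV (\<lambda>p. integral {0..1} (X p))" unfolding X_def
    by (rule Suc.IH[of "\<lambda>i. \<phi> (Suc i)" "\<lambda>s. c s * s"]) (use Suc.prems(1,2) cs in auto)
  moreover have "C_diff k UNIV (\<lambda>p. integral {0..1} (Y p))" unfolding Y_def
    by (rule Suc.IH[of "\<lambda>i. \<phi> (Suc i)" "\<lambda>s. c s * (1 - s)"]) (use Suc.prems(1,2) cs in auto)
  ultimately show ?case by (rule C_diff_SucI)
qed

lemma C_diff_subset: "C_diff k V F \<Longrightarrow> U \<subseteq> V \<Longrightarrow> C_diff k U F"
proof (induction k arbitrary: F)
  case (Suc k)
  from Suc.prems(1) obtain Fx Fy where
    F: "\<forall>p\<in>V. (F has_derivative (\<lambda>h. Fx p * fst h + Fy p * snd h)) (at p)" "C_diff k V Fx" "C_diff k V Fy" by auto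
  show ?case by (rule C_diff_SucI[OF _ Suc.IH[OF F(2)] Suc.IH[OF F(3)]]) (use F(1) Suc.prems(2) in auto)
qed (auto intro: continuous_on_subset)

text \<open>Hadamard's representation of a difference quotient, which has no singularity on the
  diagonal and loses only one derivative.\<close>

lemma segment_integral:
  assumes "\<And>x. (\<phi> has_real_derivative \<phi>' x) (at x)"
  shows "(t - \<theta>) * integral {0..1} (\<lambda>s. \<phi>' (\<theta> + s * (t - \<theta>))) = \<phi> t - \<phi> \<theta>"
proof -
  have "((\<lambda>s. (t - \<theta>) * \<phi>' (\<theta> + s * (t - \<theta>))) has_integral (\<phi> (\<theta> + 1 * (t - \<theta>)) - \<phi> (\<theta> + 0 * (t - \<theta>)))) {0..1}"
  proof (rule fundamental_theorem_of_calculus)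
    fix s :: real
    have "((\<lambda>s. \<phi> (\<theta> + s * (t - \<theta>))) has_real_derivative \<phi>' (\<theta> + s * (t - \<theta>)) * (t - \<theta>)) (at s)"
      by (rule DERIV_chain2[OF assms]) (auto intro!: derivative_eq_intros)
    then show "((\<lambda>s. \<phi> (\<theta> + s * (t - \<theta>))) has_vector_derivative (t - \<theta>) * \<phi>' (\<theta> + s * (t - \<theta>))) (at s within {0..1})"
      by (simp add: has_real_derivative_iff_has_vector_derivative has_vector_derivative_at_within mult.commute)
  qed simp
  then show ?thesis by (simp add: integral_unique flip: integral_mult_right)
qed

lemma C_diff_partials:
  assumes "C_diff (Suc k) U F"
  obtains Fx Fy where "C_diff k U Fx" "C_diff k U Fy"
    "\<And>t \<theta>. (t, \<theta>) \<in> U \<Longrightarrow> ((\<lambda>t. F (t, \<theta>)) has_real_derivative Fx (t, \<theta>)) (at t)"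
    "\<And>t \<theta>. (t, \<theta>) \<in> U \<Longrightarrow> ((\<lambda>\<theta>. F (t, \<theta>)) has_real_derivative Fy (t, \<theta>)) (at \<theta>)"
proof -
  from assms obtain Fx Fy where
    F: "\<forall>p\<in>U. (F has_derivative (\<lambda>h. Fx p * fst h + Fy p * snd h)) (at p)" "C_diff k U Fx" "C_diff k U Fy"
    by auto
  show thesis
  proof (rule that[OF F(2,3)])
    fix t \<theta> assume U: "(t, \<theta>) \<in> U"
    have "((\<lambda>t. (t, \<theta>)) has_derivative (\<lambda>h. (h, 0))) (at t)" by (auto intro!: derivative_eq_intros)
    from has_derivative_compose[OF this F(1)[rule_format, OF U]]
    show "((\<lambda>t. F (t, \<theta>)) has_real_derivative Fx (t, \<theta>)) (at t)"
      by (simp add: has_field_derivative_def)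
    have "((\<lambda>\<theta>. (t, \<theta>)) has_derivative (\<lambda>h. (0, h))) (at \<theta>)" by (auto intro!: derivative_eq_intros)
    from has_derivative_compose[OF this F(1)[rule_format, OF U]]
    show "((\<lambda>\<theta>. F (t, \<theta>)) has_real_derivative Fy (t, \<theta>)) (at \<theta>)"
      by (simp add: has_field_derivative_def)
  qed
qed

section \<open>Cosine coefficients of even kernels with a parameter\<close>

lemma symmetric_deriv_eq_0:
  assumes h: "(h has_real_derivative D) (at c)" and U: "open U" "c \<in> U" "\<And>x. x \<in> U \<Longrightarrow> h (2 * c - x) = h x"
  shows "D = 0"
proof -
  have "((\<lambda>x. h (2 * c - x)) has_real_derivative D * (- 1)) (at c)"
    by (rule DERIV_chain2[of h]) (use h in \<open>auto intro!: derivative_eq_intros\<close>)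
  then have "(h has_real_derivative D * (- 1)) (at c)"
    by (rule has_field_derivative_transform_within_open[OF _ U(1,2)]) (use U(3) in auto)
  with h have "D = D * (- 1)" by (rule DERIV_unique)
  then show ?thesis by simp
qed

text \<open>What H and ln H have in common. The symmetry about 0 and about \<pi> removes the
  boundary terms of repeated integration by parts on the half period.\<close>

locale even_kernel =
  fixes F :: "real \<times> real \<Rightarrow> real" and U :: "(real \<times> real) set" and \<theta>1 \<theta>2 :: real
  assumes U: "open U" "{0..pi} \<times> {\<theta>1..\<theta>2} \<subseteq> U"
    and smooth: "C_diff 3 U F"
    and even: "\<And>t \<theta>. F (- t, \<theta>) = F (t, \<theta>)" "\<And>t \<theta>. F (2 * pi - t, \<theta>) = F (t, \<theta>)"
begin

lemma partial_continuous:
  assumes "C_diff k U G" "\<theta> \<in> {\<theta>1..\<theta>2}"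
  shows "continuous_on {0..pi} (\<lambda>t. G (t, \<theta>))"
  by (rule continuous_on_compose2[OF C_diff_continuous[OF assms(1)]])
     (use U assms in \<open>auto intro!: continuous_intros\<close>)

lemma partial_bounded:
  assumes "C_diff k U G"
  obtains m where "m > 0" "\<And>t \<theta>. t \<in> {0..pi} \<Longrightarrow> \<theta> \<in> {\<theta>1..\<theta>2} \<Longrightarrow> \<bar>G (t, \<theta>)\<bar> \<le> m"
proof -
  have "compact ({0..pi} \<times> {\<theta>1..\<theta>2})" by (intro compact_Times compact_Icc)
  then have "bounded (G ` ({0..pi} \<times> {\<theta>1..\<theta>2}))"
    by (intro compact_imp_bounded compact_continuous_image continuous_on_subset[OF C_diff_continuous[OF assms] U(2)])
  then obtain m where "m > 0" "\<forall>x\<in>G ` ({0..pi} \<times> {\<theta>1..\<theta>2}). norm x \<le> m" unfolding bounded_pos by auto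
  then show ?thesis by (intro that[of m]) auto
qed

lemma slice_open: "open {t. (t, \<theta>) \<in> U}"
proof -
  have "open ((\<lambda>t. (t, \<theta>)) -` U)" by (rule open_vimage[OF U(1)]) (auto intro!: continuous_intros)
  then show ?thesis by (simp add: vimage_def)
qed

text \<open>The symmetry of \<open>G\<close> is asked only where both points lie in
  \<open>U\<close>, because for the \<theta>-derivatives of the kernel nothing more is known. The
  argument therefore works on the intersection of the slice with its reflection.\<close>

lemma deriv_at_ends_eq_0:
  assumes d: "\<And>t \<theta>. (t, \<theta>) \<in> U \<Longrightarrow> ((\<lambda>t. G (t, \<theta>)) has_real_derivative G' (t, \<theta>)) (at t)"
    and e: "\<And>t \<theta>. (t, \<theta>) \<in> U \<Longrightarrow> (- t, \<theta>) \<in> U \<Longrightarrow> G (- t, \<theta>) = G (t, \<theta>)"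
      "\<And>t \<theta>. (t, \<theta>) \<in> U \<Longrightarrow> (2 * pi - t, \<theta>) \<in> U \<Longrightarrow> G (2 * pi - t, \<theta>) = G (t, \<theta>)"
    and \<theta>: "\<theta> \<in> {\<theta>1..\<theta>2}"
  shows "G' (0, \<theta>) = 0" "G' (pi, \<theta>) = 0"
proof -
  have in_U: "(0, \<theta>) \<in> U" "(pi, \<theta>) \<in> U" using U \<theta> by auto
  have refl: "open ({t. (t, \<theta>) \<in> U} \<inter> {t. (2 * c - t, \<theta>) \<in> U})" for c
  proof -
    have "open ((\<lambda>t. 2 * c - t) -` {t. (t, \<theta>) \<in> U})"
      by (rule open_vimage[OF slice_open]) (auto intro!: continuous_intros)
    then show ?thesis using slice_open[of \<theta>] by (auto simp: vimage_def)
  qed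
  show "G' (0, \<theta>) = 0"
    by (rule symmetric_deriv_eq_0[OF d[OF in_U(1)] refl[of 0]]) (use in_U e(1) in auto)
  show "G' (pi, \<theta>) = 0"
    by (rule symmetric_deriv_eq_0[OF d[OF in_U(2)] refl[of pi]]) (use in_U e(2) in auto)
qed

lemma coeff_ibp2:
  assumes G: "C_diff 0 U Gxx"
    and d: "\<And>t \<theta>. (t, \<theta>) \<in> U \<Longrightarrow> ((\<lambda>t. G (t, \<theta>)) has_real_derivative Gx (t, \<theta>)) (at t)"
      "\<And>t \<theta>. (t, \<theta>) \<in> U \<Longrightarrow> ((\<lambda>t. Gx (t, \<theta>)) has_real_derivative Gxx (t, \<theta>)) (at t)"
    and e: "\<And>t \<theta>. (t, \<theta>) \<in> U \<Longrightarrow> (- t, \<theta>) \<in> U \<Longrightarrow> G (- t, \<theta>) = G (t, \<theta>)"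
      "\<And>t \<theta>. (t, \<theta>) \<in> U \<Longrightarrow> (2 * pi - t, \<theta>) \<in> U \<Longrightarrow> G (2 * pi - t, \<theta>) = G (t, \<theta>)"
    and \<theta>: "\<theta> \<in> {\<theta>1..\<theta>2}"
  shows "(real k)\<^sup>2 * integral {0..pi} (\<lambda>t. G (t, \<theta>) * cos (real k * t)) = - integral {0..pi} (\<lambda>t. Gxx (t, \<theta>) * cos (real k * t))"
proof -
  have in_U: "(t, \<theta>) \<in> U" if "t \<in> {0..pi}" for t using U \<theta> that by auto
  have Gxc: "continuous_on {0..pi} (\<lambda>t. Gx (t, \<theta>))"
    using d(2)[OF in_U] by (meson DERIV_isCont continuous_at_imp_continuous_on)
  have "real k * integral {0..pi} (\<lambda>t. G (t, \<theta>) * cos (real k * t)) = - integral {0..pi} (\<lambda>t. Gx (t, \<theta>) * sin (real k * t))"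
    by (rule ibp_cos[OF d(1)[OF in_U] Gxc])
  moreover have "real k * integral {0..pi} (\<lambda>t. Gx (t, \<theta>) * sin (real k * t)) = integral {0..pi} (\<lambda>t. Gxx (t, \<theta>) * cos (real k * t))"
    by (rule ibp_sin[OF d(2)[OF in_U] partial_continuous[OF G \<theta>]]) (use deriv_at_ends_eq_0[OF d(1) e \<theta>] in auto)
  ultimately show ?thesis by (simp add: power2_eq_square mult.assoc)
qed

text \<open>Three integrations by parts: the boundary terms of the first and third vanish because
  sin(k\<pi>) = 0, those of the second by symmetry. The factor 8 comes from (1 + k)^3 \<le>
  (2k)^3.\<close>

lemma cos_coeff_decay:
  obtains M where "\<And>\<theta> k. \<theta> \<in> {\<theta>1..\<theta>2} \<Longrightarrow> \<bar>cos_coeff (\<lambda>t. F (t, \<theta>)) k\<bar> \<le> M / (1 + real k) ^ 3"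
proof -
  from smooth have "C_diff (Suc (Suc (Suc 0))) U F" by (simp only: numeral_3_eq_3)
  from C_diff_partials[OF this] obtain Fx where F1: "C_diff (Suc (Suc 0)) U Fx"
    "\<And>t \<theta>. (t, \<theta>) \<in> U \<Longrightarrow> ((\<lambda>t. F (t, \<theta>)) has_real_derivative Fx (t, \<theta>)) (at t)" by metis
  from C_diff_partials[OF F1(1)] obtain Fxx where F2: "C_diff (Suc 0) U Fxx"
    "\<And>t \<theta>. (t, \<theta>) \<in> U \<Longrightarrow> ((\<lambda>t. Fx (t, \<theta>)) has_real_derivative Fxx (t, \<theta>)) (at t)" by metis
  from C_diff_partials[OF F2(1)] obtain Fxxx where F3: "C_diff 0 U Fxxx"
    "\<And>t \<theta>. (t, \<theta>) \<in> U \<Longrightarrow> ((\<lambda>t. Fxx (t, \<theta>)) has_real_derivative Fxxx (t, \<theta>)) (at t)" by metis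
  obtain m0 where m0: "m0 > 0" "\<And>t \<theta>. t \<in> {0..pi} \<Longrightarrow> \<theta> \<in> {\<theta>1..\<theta>2} \<Longrightarrow> \<bar>F (t, \<theta>)\<bar> \<le> m0" using partial_bounded[OF smooth] by metis
  obtain m3 where m3: "m3 > 0" "\<And>t \<theta>. t \<in> {0..pi} \<Longrightarrow> \<theta> \<in> {\<theta>1..\<theta>2} \<Longrightarrow> \<bar>Fxxx (t, \<theta>)\<bar> \<le> m3" using partial_bounded[OF F3(1)] by metis
  have F2c: "C_diff 0 U Fxx" using C_diff_Suc_imp[OF F2(1)] .
  show ?thesis
  proof (rule that[of "m0 + 8 * m3"])
    fix \<theta> k assume \<theta>: "\<theta> \<in> {\<theta>1..\<theta>2}"
    show "\<bar>cos_coeff (\<lambda>t. F (t, \<theta>)) k\<bar> \<le> (m0 + 8 * m3) / (1 + real k) ^ 3"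
    proof (cases "k = 0")
      case True
      have "\<bar>integral {0..pi} (\<lambda>t. F (t, \<theta>))\<bar> \<le> m0 * (pi - 0)"
        using integral_bound[OF _ partial_continuous[OF smooth \<theta>], of m0] m0(2)[OF _ \<theta>] by auto
      moreover have "pi * m0 > 0" "pi * m3 > 0" using m3(1) m0(1) by simp_all
      ultimately have "\<bar>integral {0..pi} (\<lambda>t. F (t, \<theta>))\<bar> \<le> (m0 + 8 * m3) * (2 * pi)"
        by (simp add: algebra_simps)
      then have "\<bar>integral {0..pi} (\<lambda>t. F (t, \<theta>))\<bar> / (2 * pi) \<le> m0 + 8 * m3" by (simp add: pos_divide_le_eq)
      then show ?thesis using True by (simp add: cos_coeff_def abs_mult)
    next
      case False
      have in_U: "(t, \<theta>) \<in> U" if "t \<in> {0..pi}" for t using U \<theta> that by auto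
      define I where "I = integral {0..pi} (\<lambda>t. F (t, \<theta>) * cos (real k * t))"
      have "(real k)\<^sup>2 * I = - integral {0..pi} (\<lambda>t. Fxx (t, \<theta>) * cos (real k * t))"
        unfolding I_def by (rule coeff_ibp2[OF F2c F1(2) F2(2)]) (use even \<theta> in auto)
      moreover have "real k * integral {0..pi} (\<lambda>t. Fxx (t, \<theta>) * cos (real k * t)) = - integral {0..pi} (\<lambda>t. Fxxx (t, \<theta>) * sin (real k * t))"
        by (rule ibp_cos[OF F3(2)[OF in_U] partial_continuous[OF F3(1) \<theta>]])
      ultimately have "real k ^ 3 * I = integral {0..pi} (\<lambda>t. Fxxx (t, \<theta>) * sin (real k * t))"
        by (simp add: power3_eq_cube power2_eq_square mult.assoc)
      also have "\<bar>\<dots>\<bar> \<le> m3 * (pi - 0)"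
      proof -
        have "\<bar>Fxxx (t, \<theta>) * sin (real k * t)\<bar> \<le> m3" if "t \<in> {0..pi}" for t
          using mult_mono[OF m3(2)[OF that \<theta>] abs_sin_le_one[of "real k * t"]] m3(1) by (simp add: abs_mult)
        moreover have "continuous_on {0..pi} (\<lambda>t. Fxxx (t, \<theta>) * sin (real k * t))"
          by (intro continuous_on_mult partial_continuous[OF F3(1) \<theta>] continuous_intros)
        ultimately show ?thesis
          using integral_bound[of 0 pi "\<lambda>t. Fxxx (t, \<theta>) * sin (real k * t)" m3] by simp
      qed
      finally have "real k ^ 3 * \<bar>I\<bar> \<le> m3 * pi" by (simp add: abs_mult)
      then have "real k ^ 3 * \<bar>cos_coeff (\<lambda>t. F (t, \<theta>)) k\<bar> \<le> m3"
      proof -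
        assume "real k ^ 3 * \<bar>I\<bar> \<le> m3 * pi"
        then have "real k ^ 3 * \<bar>I\<bar> / pi \<le> m3" by (simp add: pos_divide_le_eq)
        moreover have "cos_coeff (\<lambda>t. F (t, \<theta>)) k = I / pi" using False by (simp add: cos_coeff_def I_def)
        ultimately show ?thesis by simp
      qed
      then have "8 * (real k ^ 3 * \<bar>cos_coeff (\<lambda>t. F (t, \<theta>)) k\<bar>) \<le> m0 + 8 * m3" using m0(1) by linarith
      moreover have "(1 + real k) ^ 3 \<le> (2 * real k) ^ 3" using False by (intro power_mono) auto
      then have "(1 + real k) ^ 3 * \<bar>cos_coeff (\<lambda>t. F (t, \<theta>)) k\<bar> \<le> 8 * real k ^ 3 * \<bar>cos_coeff (\<lambda>t. F (t, \<theta>)) k\<bar>"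
        by (intro mult_right_mono) (auto simp: power_mult_distrib)
      ultimately have "(1 + real k) ^ 3 * \<bar>cos_coeff (\<lambda>t. F (t, \<theta>)) k\<bar> \<le> m0 + 8 * m3" by simp
      then show ?thesis by (simp add: pos_le_divide_eq mult.commute)
    qed
  qed
qed

lemma cos_coeff_deriv:
  assumes G: "C_diff (Suc j) U G" "C_diff j U Gy"
    "\<And>t \<theta>. (t, \<theta>) \<in> U \<Longrightarrow> ((\<lambda>\<theta>. G (t, \<theta>)) has_real_derivative Gy (t, \<theta>)) (at \<theta>)"
    and \<theta>: "\<theta> \<in> {\<theta>1..\<theta>2}"
  shows "((\<lambda>\<theta>. cos_coeff (\<lambda>t. G (t, \<theta>)) k) has_real_derivative cos_coeff (\<lambda>t. Gy (t, \<theta>)) k) (at \<theta> within {\<theta>1..\<theta>2})"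
proof -
  have "((\<lambda>\<theta>. integral (cbox 0 pi) (\<lambda>t. G (t, \<theta>) * cos (real k * t))) has_field_derivative
      integral (cbox 0 pi) (\<lambda>t. Gy (t, \<theta>) * cos (real k * t))) (at \<theta> within {\<theta>1..\<theta>2})"
  proof (rule leibniz_rule_field_derivative)
    fix \<theta> t assume "\<theta> \<in> {\<theta>1..\<theta>2}" "t \<in> cbox 0 pi"
    then have "(t, \<theta>) \<in> U" using U by auto
    from DERIV_cmult_right[OF G(3)[OF this], of "cos (real k * t)"]
    show "((\<lambda>\<theta>. G (t, \<theta>) * cos (real k * t)) has_field_derivative Gy (t, \<theta>) * cos (real k * t)) (at \<theta> within {\<theta>1..\<theta>2})"
      by (rule has_field_derivative_at_within)
  next
    fix \<theta> assume "\<theta> \<in> {\<theta>1..\<theta>2}"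
    from partial_continuous[OF G(1) this]
    show "(\<lambda>t. G (t, \<theta>) * cos (real k * t)) integrable_on cbox 0 pi"
      by (auto intro!: integrable_continuous_interval continuous_intros)
  next
    have "continuous_on ({\<theta>1..\<theta>2} \<times> cbox 0 pi) (\<lambda>p. Gy (snd p, fst p))"
      by (rule continuous_on_compose2[OF C_diff_continuous[OF G(2)]])
         (use U in \<open>auto intro!: continuous_on_Pair continuous_on_snd continuous_on_fst continuous_on_id\<close>)
    moreover have "continuous_on ({\<theta>1..\<theta>2} \<times> cbox 0 pi) (\<lambda>p::real \<times> real. cos (real k * snd p))"
      by (intro continuous_on_cos continuous_on_mult continuous_on_const continuous_on_snd continuous_on_id)
    ultimately show "continuous_on ({\<theta>1..\<theta>2} \<times> cbox 0 pi) (\<lambda>(\<theta>, t). Gy (t, \<theta>) * cos (real k * t))"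
      unfolding split_beta by (rule continuous_on_mult)
  qed (use \<theta> in auto)
  from DERIV_cmult[OF this, of "(if k = 0 then 1 / 2 else 1) / pi"]
  show ?thesis unfolding cos_coeff_def by simp
qed

text \<open>Cubic decay only bounds k^2 |A k| by a multiple of 1/k, which is not summable. But k^3 A
  k is up to a constant a sine coefficient of the third derivative, hence square summable by
  Bessel's inequality, and 1/k is square summable too. The other two terms are treated alike: the
  three available derivatives are spent as ttt, \<theta>tt and \<theta>\<theta>t.\<close>

lemma coeff_sums_bounded:
  obtains A A1 A2 R where
    "\<And>\<theta> k. \<theta> \<in> {\<theta>1..\<theta>2} \<Longrightarrow> A k \<theta> = cos_coeff (\<lambda>t. F (t, \<theta>)) k"
    "\<And>\<theta> k. \<theta> \<in> {\<theta>1..\<theta>2} \<Longrightarrow> (A k has_real_derivative A1 k \<theta>) (at \<theta> within {\<theta>1..\<theta>2})"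
    "\<And>\<theta> k. \<theta> \<in> {\<theta>1..\<theta>2} \<Longrightarrow> (A1 k has_real_derivative A2 k \<theta>) (at \<theta> within {\<theta>1..\<theta>2})"
    "\<And>\<theta> K. \<theta> \<in> {\<theta>1..\<theta>2} \<Longrightarrow> (\<Sum>k=1..K. (real k)\<^sup>2 * \<bar>A k \<theta>\<bar> + real k * \<bar>A1 k \<theta>\<bar> + \<bar>A2 k \<theta>\<bar>) \<le> R"
proof -
  from smooth have "C_diff (Suc (Suc (Suc 0))) U F" by (simp only: numeral_3_eq_3)
  from C_diff_partials[OF this] obtain Fx Fy where Fx: "C_diff (Suc (Suc 0)) U Fx"
      "\<And>t \<theta>. (t, \<theta>) \<in> U \<Longrightarrow> ((\<lambda>t. F (t, \<theta>)) has_real_derivative Fx (t, \<theta>)) (at t)"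
    and Fy: "C_diff (Suc (Suc 0)) U Fy"
      "\<And>t \<theta>. (t, \<theta>) \<in> U \<Longrightarrow> ((\<lambda>\<theta>. F (t, \<theta>)) has_real_derivative Fy (t, \<theta>)) (at \<theta>)" by metis
  from C_diff_partials[OF Fx(1)] obtain Fxx where Fxx: "C_diff (Suc 0) U Fxx"
    "\<And>t \<theta>. (t, \<theta>) \<in> U \<Longrightarrow> ((\<lambda>t. Fx (t, \<theta>)) has_real_derivative Fxx (t, \<theta>)) (at t)" by metis
  from C_diff_partials[OF Fxx(1)] obtain Fxxx where Fxxx: "C_diff 0 U Fxxx"
    "\<And>t \<theta>. (t, \<theta>) \<in> U \<Longrightarrow> ((\<lambda>t. Fxx (t, \<theta>)) has_real_derivative Fxxx (t, \<theta>)) (at t)" by metis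
  from C_diff_partials[OF Fy(1)] obtain Fyx Fyy where Fyx: "C_diff (Suc 0) U Fyx"
      "\<And>t \<theta>. (t, \<theta>) \<in> U \<Longrightarrow> ((\<lambda>t. Fy (t, \<theta>)) has_real_derivative Fyx (t, \<theta>)) (at t)"
    and Fyy: "C_diff (Suc 0) U Fyy"
      "\<And>t \<theta>. (t, \<theta>) \<in> U \<Longrightarrow> ((\<lambda>\<theta>. Fy (t, \<theta>)) has_real_derivative Fyy (t, \<theta>)) (at \<theta>)" by metis
  from C_diff_partials[OF Fyx(1)] obtain Fyxx where Fyxx: "C_diff 0 U Fyxx"
    "\<And>t \<theta>. (t, \<theta>) \<in> U \<Longrightarrow> ((\<lambda>t. Fyx (t, \<theta>)) has_real_derivative Fyxx (t, \<theta>)) (at t)" by metis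
  from C_diff_partials[OF Fyy(1)] obtain Fyyx where Fyyx: "C_diff 0 U Fyyx"
    "\<And>t \<theta>. (t, \<theta>) \<in> U \<Longrightarrow> ((\<lambda>t. Fyy (t, \<theta>)) has_real_derivative Fyyx (t, \<theta>)) (at t)" by metis
  obtain m1 where m1: "m1 > 0" "\<And>t \<theta>. t \<in> {0..pi} \<Longrightarrow> \<theta> \<in> {\<theta>1..\<theta>2} \<Longrightarrow> \<bar>Fxxx (t, \<theta>)\<bar> \<le> m1" using partial_bounded[OF Fxxx(1)] by metis
  obtain m2 where m2: "m2 > 0" "\<And>t \<theta>. t \<in> {0..pi} \<Longrightarrow> \<theta> \<in> {\<theta>1..\<theta>2} \<Longrightarrow> \<bar>Fyxx (t, \<theta>)\<bar> \<le> m2" using partial_bounded[OF Fyxx(1)] by metis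
  obtain m3 where m3: "m3 > 0" "\<And>t \<theta>. t \<in> {0..pi} \<Longrightarrow> \<theta> \<in> {\<theta>1..\<theta>2} \<Longrightarrow> \<bar>Fyyx (t, \<theta>)\<bar> \<le> m3" using partial_bounded[OF Fyyx(1)] by metis
  have Fxx0: "C_diff 0 U Fxx" using C_diff_Suc_imp[OF Fxx(1)] .
  define A where "A k \<theta> = cos_coeff (\<lambda>t. F (t, \<theta>)) k" for k \<theta>
  define A1 where "A1 k \<theta> = cos_coeff (\<lambda>t. Fy (t, \<theta>)) k" for k \<theta>
  define A2 where "A2 k \<theta> = cos_coeff (\<lambda>t. Fyy (t, \<theta>)) k" for k \<theta>
  define S where "S k \<theta> = integral {0..pi} (\<lambda>t. Fxxx (t, \<theta>) * sin (real k * t))" for k \<theta>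
  define S1 where "S1 k \<theta> = integral {0..pi} (\<lambda>t. Fyxx (t, \<theta>) * cos (real k * t))" for k \<theta>
  define S2 where "S2 k \<theta> = integral {0..pi} (\<lambda>t. Fyyx (t, \<theta>) * sin (real k * t))" for k \<theta>
  \<comment> \<open>Three times the bound 2 for the sum of 1/k^2, plus the three Bessel
    bounds.\<close>
  define R where "R = 6 + pi / 2 * (m1\<^sup>2 * pi) + pi / 2 * (m2\<^sup>2 * pi) + pi / 2 * (m3\<^sup>2 * pi)"
  \<comment> \<open>The inequality 2uv \<le> u^2 + v^2 for u = 1/k and v = |s| separates the two
    square summable factors.\<close>
  have am: "x \<le> 1 / (real k)\<^sup>2 + s\<^sup>2" if "k \<ge> 1" "real k * x \<le> \<bar>s\<bar> / pi" for x s k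
  proof -
    have "\<bar>s\<bar> / pi \<le> \<bar>s\<bar> / 1" using pi_gt3 by (intro divide_left_mono) auto
    then have "real k * x \<le> \<bar>s\<bar>" using that(2) by simp
    then have "x \<le> (1 / real k) * \<bar>s\<bar>" using that(1) by (simp add: pos_le_divide_eq mult.commute)
    also have "0 \<le> (1 / real k - \<bar>s\<bar>)\<^sup>2" by simp
    then have "2 * ((1 / real k) * \<bar>s\<bar>) \<le> (1 / real k)\<^sup>2 + s\<^sup>2" by (simp add: power2_diff)
    then have "(1 / real k) * \<bar>s\<bar> \<le> (1 / real k)\<^sup>2 + s\<^sup>2"
      using sum_power2_ge_zero[of "1 / real k" s] by linarith
    finally show ?thesis by (simp add: power_divide)
  qed
  have sq: "(\<Sum>k=1..K. 1 / (real k)\<^sup>2) \<le> 2" for K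
  proof -
    have "(\<Sum>k=1..Suc n. 1 / (real k)\<^sup>2) \<le> 2 - 1 / real (Suc n)" for n
    proof (induction n)
      case (Suc n)
      have "1 / (real (Suc (Suc n)))\<^sup>2 \<le> 1 / (real (Suc n) * real (Suc (Suc n)))"
        unfolding power2_eq_square by (intro divide_left_mono mult_right_mono) auto
      also have "\<dots> = 1 / real (Suc n) - 1 / real (Suc (Suc n))" by (simp add: field_simps)
      finally show ?case using Suc by simp
    qed simp
    moreover have "1 / real (Suc n) \<ge> 0" for n by simp
    ultimately have "(\<Sum>k=1..Suc n. 1 / (real k)\<^sup>2) \<le> 2" for n by (meson diff_le_eq le_add_same_cancel1 order_trans)
    then show ?thesis by (cases K) auto
  qed
  have int_le: "integral {0..pi} (\<lambda>t. (G (t, \<theta>))\<^sup>2) \<le> m\<^sup>2 * pi"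
    if "C_diff 0 U G" "\<And>t. t \<in> {0..pi} \<Longrightarrow> \<bar>G (t, \<theta>)\<bar> \<le> m" "\<theta> \<in> {\<theta>1..\<theta>2}" for G m \<theta>
  proof -
    have "integral {0..pi} (\<lambda>t. (G (t, \<theta>))\<^sup>2) \<le> integral {0..pi} (\<lambda>t. m\<^sup>2)"
    proof (rule integral_le)
      show "(\<lambda>t. (G (t, \<theta>))\<^sup>2) integrable_on {0..pi}"
        by (intro integrable_continuous_interval continuous_on_power partial_continuous[OF that(1,3)])
      show "(G (t, \<theta>))\<^sup>2 \<le> m\<^sup>2" if "t \<in> {0..pi}" for t
        using \<open>\<And>t. t \<in> {0..pi} \<Longrightarrow> \<bar>G (t, \<theta>)\<bar> \<le> m\<close>[OF that] by (metis abs_ge_zero power2_abs power_mono)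
    qed auto
    then show ?thesis by (simp add: mult.commute)
  qed
  show thesis
  proof (rule that[of A A1 A2 R])
    fix \<theta> k assume \<theta>: "\<theta> \<in> {\<theta>1..\<theta>2}"
    show "A k \<theta> = cos_coeff (\<lambda>t. F (t, \<theta>)) k" by (simp add: A_def)
    show "(A k has_real_derivative A1 k \<theta>) (at \<theta> within {\<theta>1..\<theta>2})"
      unfolding A_def A1_def by (rule cos_coeff_deriv[OF _ Fy \<theta>]) (use smooth in \<open>simp only: numeral_3_eq_3\<close>)
    show "(A1 k has_real_derivative A2 k \<theta>) (at \<theta> within {\<theta>1..\<theta>2})"
      unfolding A1_def A2_def by (rule cos_coeff_deriv[OF Fy(1) Fyy \<theta>])
  next
    fix \<theta> K assume \<theta>: "\<theta> \<in> {\<theta>1..\<theta>2}"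
    have in_U: "(t, \<theta>) \<in> U" if "t \<in> {0..pi}" for t using U \<theta> that by auto
    \<comment> \<open>The \<theta>-derivative inherits the symmetry by uniqueness of derivatives,
      but only where both points belong to \<open>U\<close>.\<close>
    have Fy_even: "Fy (- t, \<theta>) = Fy (t, \<theta>)" if "(t, \<theta>) \<in> U" "(- t, \<theta>) \<in> U" for t \<theta>
      using Fy(2)[OF that(1)] Fy(2)[OF that(2)] unfolding even by (rule DERIV_unique[rotated])
    have Fy_even2: "Fy (2 * pi - t, \<theta>) = Fy (t, \<theta>)" if "(t, \<theta>) \<in> U" "(2 * pi - t, \<theta>) \<in> U" for t \<theta>
      using Fy(2)[OF that(1)] Fy(2)[OF that(2)] unfolding even by (rule DERIV_unique[rotated])
    have "(\<Sum>k=1..K. (real k)\<^sup>2 * \<bar>A k \<theta>\<bar> + real k * \<bar>A1 k \<theta>\<bar> + \<bar>A2 k \<theta>\<bar>)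
      \<le> (\<Sum>k=1..K. (1 / (real k)\<^sup>2 + (S k \<theta>)\<^sup>2) + (1 / (real k)\<^sup>2 + (S1 k \<theta>)\<^sup>2) + (1 / (real k)\<^sup>2 + (S2 k \<theta>)\<^sup>2))"
    proof (intro sum_mono add_mono)
      fix k assume k: "k \<in> {1..K}"
      have "(real k)\<^sup>2 * integral {0..pi} (\<lambda>t. F (t, \<theta>) * cos (real k * t)) = - integral {0..pi} (\<lambda>t. Fxx (t, \<theta>) * cos (real k * t))"
        by (rule coeff_ibp2[OF Fxx0 Fx(2) Fxx(2)]) (use even \<theta> in auto)
      moreover have "real k * integral {0..pi} (\<lambda>t. Fxx (t, \<theta>) * cos (real k * t)) = - S k \<theta>"
        unfolding S_def by (rule ibp_cos[OF Fxxx(2)[OF in_U] partial_continuous[OF Fxxx(1) \<theta>]])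
      ultimately have "real k * ((real k)\<^sup>2 * A k \<theta>) = S k \<theta> / pi"
        using k by (simp add: A_def cos_coeff_def)
      from arg_cong[OF this, of abs] have "real k * ((real k)\<^sup>2 * \<bar>A k \<theta>\<bar>) = \<bar>S k \<theta>\<bar> / pi"
        by (simp add: abs_mult)
      then show "(real k)\<^sup>2 * \<bar>A k \<theta>\<bar> \<le> 1 / (real k)\<^sup>2 + (S k \<theta>)\<^sup>2" using k by (intro am) auto
      have "(real k)\<^sup>2 * integral {0..pi} (\<lambda>t. Fy (t, \<theta>) * cos (real k * t)) = - S1 k \<theta>"
        unfolding S1_def by (rule coeff_ibp2[OF Fyxx(1) Fyx(2) Fyxx(2)]) (use Fy_even Fy_even2 \<theta> in auto)
      then have "real k * (real k * A1 k \<theta>) = - S1 k \<theta> / pi"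
        using k by (simp add: A1_def cos_coeff_def power2_eq_square mult.assoc)
      from arg_cong[OF this, of abs] have "real k * (real k * \<bar>A1 k \<theta>\<bar>) = \<bar>S1 k \<theta>\<bar> / pi"
        by (simp add: abs_mult)
      then show "real k * \<bar>A1 k \<theta>\<bar> \<le> 1 / (real k)\<^sup>2 + (S1 k \<theta>)\<^sup>2" using k by (intro am) auto
      have "real k * integral {0..pi} (\<lambda>t. Fyy (t, \<theta>) * cos (real k * t)) = - S2 k \<theta>"
        unfolding S2_def by (rule ibp_cos[OF Fyyx(2)[OF in_U] partial_continuous[OF Fyyx(1) \<theta>]])
      then have "real k * A2 k \<theta> = - S2 k \<theta> / pi"
        using k by (simp add: A2_def cos_coeff_def)
      from arg_cong[OF this, of abs] have "real k * \<bar>A2 k \<theta>\<bar> = \<bar>S2 k \<theta>\<bar> / pi"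
        by (simp add: abs_mult)
      then show "\<bar>A2 k \<theta>\<bar> \<le> 1 / (real k)\<^sup>2 + (S2 k \<theta>)\<^sup>2" using k by (intro am) auto
    qed
    also have "\<dots> = 3 * (\<Sum>k=1..K. 1 / (real k)\<^sup>2) + (\<Sum>k=1..K. (S k \<theta>)\<^sup>2) + (\<Sum>k=1..K. (S1 k \<theta>)\<^sup>2) + (\<Sum>k=1..K. (S2 k \<theta>)\<^sup>2)"
      unfolding sum.distrib by simp
    also have "\<dots> \<le> R"
    proof -
      have "(\<Sum>k=1..K. (S k \<theta>)\<^sup>2) \<le> pi / 2 * (m1\<^sup>2 * pi)" unfolding S_def
        by (rule order_trans[OF bessel_sin[OF partial_continuous[OF Fxxx(1) \<theta>]]], intro mult_left_mono int_le Fxxx(1) m1(2) \<theta>) auto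
      moreover have "(\<Sum>k=1..K. (S1 k \<theta>)\<^sup>2) \<le> pi / 2 * (m2\<^sup>2 * pi)" unfolding S1_def
        by (rule order_trans[OF bessel_cos[OF partial_continuous[OF Fyxx(1) \<theta>]]], intro mult_left_mono int_le Fyxx(1) m2(2) \<theta>) auto
      moreover have "(\<Sum>k=1..K. (S2 k \<theta>)\<^sup>2) \<le> pi / 2 * (m3\<^sup>2 * pi)" unfolding S2_def
        by (rule order_trans[OF bessel_sin[OF partial_continuous[OF Fyyx(1) \<theta>]]], intro mult_left_mono int_le Fyyx(1) m3(2) \<theta>) auto
      ultimately show ?thesis using sq[of K] unfolding R_def by linarith
    qed
    finally show "(\<Sum>k=1..K. (real k)\<^sup>2 * \<bar>A k \<theta>\<bar> + real k * \<bar>A1 k \<theta>\<bar> + \<bar>A2 k \<theta>\<bar>) \<le> R" .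
  qed
qed

end

text \<open>No convergence of the series of second derivatives is claimed. A uniform bound for its
  partial sums makes the partial sums of the first derivatives Lipschitz, which gives the quadratic
  remainder for every partial sum; this inequality survives the passage to the limit.\<close>

lemma c11_of_bounded_partial_sums:
  fixes t0 t1 t2 :: "nat \<Rightarrow> real \<Rightarrow> real"
  assumes d: "\<And>k \<theta>. \<theta> \<in> {a..b} \<Longrightarrow> (t0 k has_real_derivative t1 k \<theta>) (at \<theta> within {a..b})"
      "\<And>k \<theta>. \<theta> \<in> {a..b} \<Longrightarrow> (t1 k has_real_derivative t2 k \<theta>) (at \<theta> within {a..b})"
    and B: "\<And>\<theta> K. \<theta> \<in> {a..b} \<Longrightarrow> (\<Sum>k<K. \<bar>t0 k \<theta>\<bar>) \<le> R"
      "\<And>\<theta> K. \<theta> \<in> {a..b} \<Longrightarrow> (\<Sum>k<K. \<bar>t1 k \<theta>\<bar>) \<le> R"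
      "\<And>\<theta> K. \<theta> \<in> {a..b} \<Longrightarrow> (\<Sum>k<K. \<bar>t2 k \<theta>\<bar>) \<le> R"
    and xy: "x \<in> {a..b}" "y \<in> {a..b}"
  shows "\<bar>(\<Sum>k. t0 k y) - (\<Sum>k. t0 k x) - (\<Sum>k. t1 k x) * (y - x)\<bar> \<le> R * (y - x)\<^sup>2"
    and "\<bar>\<Sum>k. t0 k x\<bar> \<le> R" and "\<bar>\<Sum>k. t1 k x\<bar> \<le> R"
proof -
  have sab: "summable (\<lambda>k. \<bar>u k\<bar>)" if "\<And>K. (\<Sum>k<K. \<bar>u k\<bar>) \<le> R" for u :: "nat \<Rightarrow> real"
    by (rule summableI_nonneg_bounded[OF _ that]) auto
  have lim: "(\<lambda>K. \<Sum>k<K. u k) \<longlonglongrightarrow> (\<Sum>k. u k)" if "\<And>K. (\<Sum>k<K. \<bar>u k\<bar>) \<le> R" for u :: "nat \<Rightarrow> real"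
    by (rule summable_LIMSEQ[OF summable_rabs_cancel[OF sab[OF that]]])
  have le: "\<bar>\<Sum>k. u k\<bar> \<le> R" if "\<And>K. (\<Sum>k<K. \<bar>u k\<bar>) \<le> R" for u :: "nat \<Rightarrow> real"
    by (rule order_trans[OF summable_rabs[OF sab[OF that]] suminf_le_const[OF sab[OF that] that]])
  show "\<bar>\<Sum>k. t0 k x\<bar> \<le> R" "\<bar>\<Sum>k. t1 k x\<bar> \<le> R" by (rule le[OF B(1)[OF xy(1)]], rule le[OF B(2)[OF xy(1)]])
  have part: "\<bar>(\<Sum>k<K. t0 k y) - (\<Sum>k<K. t0 k x) - (\<Sum>k<K. t1 k x) * (y - x)\<bar> \<le> R * (y - x)\<^sup>2" for K
  proof -
    define C where "C = closed_segment x y"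
    have C: "convex C" "x \<in> C" "y \<in> C" "C \<subseteq> {a..b}"
      unfolding C_def using xy by (auto simp: closed_segment_eq_real_ivl)
    have Cd: "\<bar>z - x\<bar> \<le> \<bar>y - x\<bar>" if "z \<in> C" for z
      using that unfolding C_def by (auto simp: closed_segment_eq_real_ivl split: if_splits)
    define g where "g z = (\<Sum>k<K. t0 k z) - (\<Sum>k<K. t1 k x) * z" for z
    have t1_lip: "\<bar>(\<Sum>k<K. t1 k z) - (\<Sum>k<K. t1 k x)\<bar> \<le> R * \<bar>z - x\<bar>" if "z \<in> C" for z
    proof -
      have "norm ((\<Sum>k<K. t1 k z) - (\<Sum>k<K. t1 k x)) \<le> R * norm (z - x)"
      proof (rule field_differentiable_bound[OF C(1)])
        fix w assume w: "w \<in> C"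
        then have w': "w \<in> {a..b}" using C by auto
        show "((\<lambda>z. \<Sum>k<K. t1 k z) has_field_derivative (\<Sum>k<K. t2 k w)) (at w within C)"
          by (intro DERIV_sum has_field_derivative_subset[OF d(2)[OF w'] C(4)])
        show "norm (\<Sum>k<K. t2 k w) \<le> R"
          unfolding real_norm_def by (rule order_trans[OF sum_abs B(3)[OF w']])
      qed (use that C in auto)
      then show ?thesis by simp
    qed
    have R0: "R \<ge> 0" using B(1)[OF xy(1), of 0] by simp
    have "norm (g y - g x) \<le> (R * \<bar>y - x\<bar>) * norm (y - x)"
    proof (rule field_differentiable_bound[OF C(1)])
      fix w assume w: "w \<in> C"
      then have w': "w \<in> {a..b}" using C by auto
      show "(g has_field_derivative (\<Sum>k<K. t1 k w) - (\<Sum>k<K. t1 k x)) (at w within C)"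
        unfolding g_def
        by (intro DERIV_diff DERIV_sum has_field_derivative_subset[OF d(1)[OF w'] C(4)])
           (auto intro!: derivative_eq_intros)
      show "norm ((\<Sum>k<K. t1 k w) - (\<Sum>k<K. t1 k x)) \<le> R * \<bar>y - x\<bar>"
        unfolding real_norm_def by (rule order_trans[OF t1_lip[OF w] mult_left_mono[OF Cd[OF w] R0]])
    qed (use C in auto)
    then show ?thesis unfolding g_def real_norm_def by (simp add: power2_eq_square algebra_simps flip: abs_mult)
  qed
  have "(\<lambda>K. \<bar>(\<Sum>k<K. t0 k y) - (\<Sum>k<K. t0 k x) - (\<Sum>k<K. t1 k x) * (y - x)\<bar>)
     \<longlonglongrightarrow> \<bar>(\<Sum>k. t0 k y) - (\<Sum>k. t0 k x) - (\<Sum>k. t1 k x) * (y - x)\<bar>"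
    by (intro tendsto_rabs tendsto_diff tendsto_mult tendsto_const lim B(1)[OF xy(1)] B(1)[OF xy(2)] B(2)[OF xy(1)])
  then show "\<bar>(\<Sum>k. t0 k y) - (\<Sum>k. t0 k x) - (\<Sum>k. t1 k x) * (y - x)\<bar> \<le> R * (y - x)\<^sup>2"
    by (rule LIMSEQ_le_const2) (use part in auto)
qed

text \<open>The parameter enters both the coefficients and sin(k\<theta>), so Leibniz's rule
  distributes up to two derivatives over them. For k \<ge> 1 the three resulting terms are at most
  four times the summand of \<open>coeff_sums_bounded\<close>. The function \<sigma> is the series
  differentiated term by term.\<close>

lemma (in even_kernel) conjugate_series_c11:
  obtains \<sigma> R where "R > 0"
    "\<And>x y. x \<in> {\<theta>1..\<theta>2} \<Longrightarrow> y \<in> {\<theta>1..\<theta>2} \<Longrightarrow>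
      \<bar>(\<Sum>k. - 2 * cos_coeff (\<lambda>t. F (t, y)) k * sin (real k * y)) - (\<Sum>k. - 2 * cos_coeff (\<lambda>t. F (t, x)) k * sin (real k * x))
        - \<sigma> x * (y - x)\<bar> \<le> R * (y - x)\<^sup>2"
    "\<And>x. x \<in> {\<theta>1..\<theta>2} \<Longrightarrow> \<bar>\<Sum>k. - 2 * cos_coeff (\<lambda>t. F (t, x)) k * sin (real k * x)\<bar> \<le> R"
    "\<And>x. x \<in> {\<theta>1..\<theta>2} \<Longrightarrow> \<bar>\<sigma> x\<bar> \<le> R"
    "\<And>x. x \<in> {\<theta>1..\<theta>2} \<Longrightarrow> summable (\<lambda>k. \<bar>cos_coeff (\<lambda>t. F (t, x)) k\<bar>)"
    "\<And>x. x \<in> {\<theta>1..\<theta>2} \<Longrightarrow> summable (\<lambda>k. real k * \<bar>cos_coeff (\<lambda>t. F (t, x)) k\<bar>)"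
proof -
  obtain A A1 A2 R0 where A: "\<And>\<theta> k. \<theta> \<in> {\<theta>1..\<theta>2} \<Longrightarrow> A k \<theta> = cos_coeff (\<lambda>t. F (t, \<theta>)) k"
    and d: "\<And>\<theta> k. \<theta> \<in> {\<theta>1..\<theta>2} \<Longrightarrow> (A k has_real_derivative A1 k \<theta>) (at \<theta> within {\<theta>1..\<theta>2})"
      "\<And>\<theta> k. \<theta> \<in> {\<theta>1..\<theta>2} \<Longrightarrow> (A1 k has_real_derivative A2 k \<theta>) (at \<theta> within {\<theta>1..\<theta>2})"
    and R0: "\<And>\<theta> K. \<theta> \<in> {\<theta>1..\<theta>2} \<Longrightarrow> (\<Sum>k=1..K. (real k)\<^sup>2 * \<bar>A k \<theta>\<bar> + real k * \<bar>A1 k \<theta>\<bar> + \<bar>A2 k \<theta>\<bar>) \<le> R0"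
    by (rule coeff_sums_bounded) blast
  define e where "e k \<theta> = (real k)\<^sup>2 * \<bar>A k \<theta>\<bar> + real k * \<bar>A1 k \<theta>\<bar> + \<bar>A2 k \<theta>\<bar>" for k \<theta>
  define t0 where "t0 k \<theta> = - 2 * A k \<theta> * sin (real k * \<theta>)" for k \<theta>
  define t1 where "t1 k \<theta> = - 2 * (A1 k \<theta> * sin (real k * \<theta>) + A k \<theta> * (real k * cos (real k * \<theta>)))" for k \<theta>
  define t2 where "t2 k \<theta> = - 2 * (A2 k \<theta> * sin (real k * \<theta>) + 2 * (A1 k \<theta> * (real k * cos (real k * \<theta>)))
     - A k \<theta> * ((real k)\<^sup>2 * sin (real k * \<theta>)))" for k \<theta>
  \<comment> \<open>The summand 1 ensures that the constant is positive.\<close>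
  define R where "R = 4 * R0 + 1"
  have e0: "e k \<theta> \<ge> 0" for k \<theta> by (simp add: e_def)
  have bound: "(\<Sum>k<K. \<bar>u k\<bar>) \<le> R" if u: "u 0 = 0" "\<And>k. k \<ge> 1 \<Longrightarrow> \<bar>u k\<bar> \<le> 4 * e k \<theta>" and \<theta>: "\<theta> \<in> {\<theta>1..\<theta>2}" for u :: "nat \<Rightarrow> real" and \<theta> K
  proof -
    have "(\<Sum>k<K. \<bar>u k\<bar>) \<le> (\<Sum>k\<in>insert 0 {1..K}. \<bar>u k\<bar>)" by (intro sum_mono2) auto
    also have "\<dots> = (\<Sum>k=1..K. \<bar>u k\<bar>)" using u(1) by simp
    also have "\<dots> \<le> (\<Sum>k=1..K. 4 * e k \<theta>)" by (intro sum_mono u(2)) auto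
    also have "\<dots> \<le> R" using R0[OF \<theta>, of K] unfolding e_def R_def sum_distrib_left[symmetric] by linarith
    finally show ?thesis .
  qed
  have R0nn: "R0 \<ge> 0" if "\<theta> \<in> {\<theta>1..\<theta>2}" for \<theta> using R0[OF that, of 0] by simp
  have sc: "\<bar>x * sin y\<bar> \<le> \<bar>x\<bar>" "\<bar>x * cos y\<bar> \<le> \<bar>x\<bar>" for x y :: real
    by (simp_all add: abs_mult mult_left_le)
  have k1: "\<bar>A k \<theta>\<bar> \<le> (real k)\<^sup>2 * \<bar>A k \<theta>\<bar>" "real k * \<bar>A k \<theta>\<bar> \<le> (real k)\<^sup>2 * \<bar>A k \<theta>\<bar>" "\<bar>A1 k \<theta>\<bar> \<le> real k * \<bar>A1 k \<theta>\<bar>" if "k \<ge> 1" for k \<theta>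
  proof -
    have r: "real k \<ge> 1" using that by simp
    then have "(real k)\<^sup>2 \<ge> 1" by (rule one_le_power)
    then show "\<bar>A k \<theta>\<bar> \<le> (real k)\<^sup>2 * \<bar>A k \<theta>\<bar>" using mult_right_mono[of 1 "(real k)\<^sup>2" "\<bar>A k \<theta>\<bar>"] by simp
    show "\<bar>A1 k \<theta>\<bar> \<le> real k * \<bar>A1 k \<theta>\<bar>" using r mult_right_mono[of 1 "real k" "\<bar>A1 k \<theta>\<bar>"] by simp
    have "real k \<le> (real k)\<^sup>2" using r by (simp add: power2_eq_square)
    then show "real k * \<bar>A k \<theta>\<bar> \<le> (real k)\<^sup>2 * \<bar>A k \<theta>\<bar>" by (rule mult_right_mono) simp
  qed
  have nn: "0 \<le> (real k)\<^sup>2 * \<bar>A k \<theta>\<bar>" "0 \<le> real k * \<bar>A1 k \<theta>\<bar>" "0 \<le> \<bar>A2 k \<theta>\<bar>" for k \<theta> by simp_all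
  have lin1: "2 * x \<le> 4 * (p + q + r)" if "x \<le> p" "0 \<le> p" "0 \<le> q" "0 \<le> r" for x p q r :: real
    using that by simp
  have lin2: "2 * (x + y) \<le> 4 * (p + q + r)" if "x \<le> q" "y \<le> p" "0 \<le> r" "0 \<le> p + q" for x y p q r :: real
    using that by simp
  have lin3: "2 * (r + 2 * q + p) \<le> 4 * (p + q + r)" if "0 \<le> p" "0 \<le> r" for p q r :: real
    using that by simp
  have ab1: "\<bar>t\<bar> \<le> 2 * (\<bar>x\<bar> + \<bar>y\<bar>)" if "t = - 2 * (x + y)" for t x y :: real
    unfolding that abs_mult using abs_triangle_ineq[of x y] by simp
  have ab2: "\<bar>t\<bar> = 2 * \<bar>x\<bar>" if "t = - 2 * x" for t x :: real using that by simp
  have ab3: "2 * \<bar>x + 2 * y - z\<bar> \<le> 2 * (\<bar>x\<bar> + 2 * \<bar>y\<bar> + \<bar>z\<bar>)" for x y z :: real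
    using abs_triangle_ineq4[of "x + 2 * y" z] abs_triangle_ineq[of x "2 * y"] by (simp add: abs_mult)
  have b0: "\<bar>t0 k \<theta>\<bar> \<le> 4 * e k \<theta>" if "k \<ge> 1" for k \<theta>
  proof -
    have "\<bar>t0 k \<theta>\<bar> = 2 * \<bar>A k \<theta> * sin (real k * \<theta>)\<bar>" by (simp add: t0_def abs_mult)
    also have "\<dots> \<le> 2 * \<bar>A k \<theta>\<bar>" by (intro mult_left_mono sc) auto
    also have "\<dots> \<le> 4 * e k \<theta>"
      unfolding e_def by (rule lin1[OF k1(1)[OF that] nn])
    finally show ?thesis .
  qed
  have b1: "\<bar>t1 k \<theta>\<bar> \<le> 4 * e k \<theta>" if "k \<ge> 1" for k \<theta>
  proof -
    have "\<bar>t1 k \<theta>\<bar> \<le> 2 * (\<bar>A1 k \<theta> * sin (real k * \<theta>)\<bar> + \<bar>(real k * A k \<theta>) * cos (real k * \<theta>)\<bar>)"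
    proof -
      have "t1 k \<theta> = - 2 * (A1 k \<theta> * sin (real k * \<theta>) + (real k * A k \<theta>) * cos (real k * \<theta>))"
        unfolding t1_def by (simp only: mult.left_commute mult.commute)
      then show ?thesis by (rule ab1)
    qed
    also have "\<dots> \<le> 2 * (\<bar>A1 k \<theta>\<bar> + \<bar>real k * A k \<theta>\<bar>)" by (intro mult_left_mono add_mono sc) auto
    also have "\<bar>real k * A k \<theta>\<bar> = real k * \<bar>A k \<theta>\<bar>" by (simp add: abs_mult)
    also have "2 * (\<bar>A1 k \<theta>\<bar> + real k * \<bar>A k \<theta>\<bar>) \<le> 4 * e k \<theta>"
      unfolding e_def by (rule lin2[OF k1(3,2)[OF that] nn(3) add_nonneg_nonneg[OF nn(1,2)]])
    finally show ?thesis .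
  qed
  have b2: "\<bar>t2 k \<theta>\<bar> \<le> 4 * e k \<theta>" if "k \<ge> 1" for k \<theta>
  proof -
    have "\<bar>t2 k \<theta>\<bar> = 2 * \<bar>A2 k \<theta> * sin (real k * \<theta>) + 2 * ((real k * A1 k \<theta>) * cos (real k * \<theta>)) - ((real k)\<^sup>2 * A k \<theta>) * sin (real k * \<theta>)\<bar>"
    proof -
      have "t2 k \<theta> = - 2 * (A2 k \<theta> * sin (real k * \<theta>) + 2 * ((real k * A1 k \<theta>) * cos (real k * \<theta>)) - ((real k)\<^sup>2 * A k \<theta>) * sin (real k * \<theta>))"
        unfolding t2_def by (simp only: mult.left_commute mult.commute)
      then show ?thesis by (rule ab2)
    qed
    also have "\<dots> \<le> 2 * (\<bar>A2 k \<theta> * sin (real k * \<theta>)\<bar> + 2 * \<bar>(real k * A1 k \<theta>) * cos (real k * \<theta>)\<bar> + \<bar>((real k)\<^sup>2 * A k \<theta>) * sin (real k * \<theta>)\<bar>)"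
      by (rule ab3)
    also have "\<dots> \<le> 2 * (\<bar>A2 k \<theta>\<bar> + 2 * \<bar>real k * A1 k \<theta>\<bar> + \<bar>(real k)\<^sup>2 * A k \<theta>\<bar>)" by (intro mult_left_mono add_mono sc) auto
    also have "\<dots> = 2 * (\<bar>A2 k \<theta>\<bar> + 2 * (real k * \<bar>A1 k \<theta>\<bar>) + (real k)\<^sup>2 * \<bar>A k \<theta>\<bar>)" by (simp add: abs_mult)
    also have "\<dots> \<le> 4 * e k \<theta>" unfolding e_def by (rule lin3[OF nn(1,3)])
    finally show ?thesis .
  qed
  have z: "t0 0 \<theta> = 0" "t1 0 \<theta> = 0" "t2 0 \<theta> = 0" for \<theta> by (simp_all add: t0_def t1_def t2_def)
  have D0: "(t0 k has_real_derivative t1 k \<theta>) (at \<theta> within {\<theta>1..\<theta>2})" if "\<theta> \<in> {\<theta>1..\<theta>2}" for k \<theta>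
    unfolding t0_def t1_def
    by (rule derivative_eq_intros d(1)[OF that] refl)+ (simp add: algebra_simps)
  have D1: "(t1 k has_real_derivative t2 k \<theta>) (at \<theta> within {\<theta>1..\<theta>2})" if "\<theta> \<in> {\<theta>1..\<theta>2}" for k \<theta>
    unfolding t1_def t2_def
    by (rule derivative_eq_intros d(1)[OF that] d(2)[OF that] refl)+ (simp add: algebra_simps power2_eq_square)
  have B0: "(\<Sum>k<K. \<bar>t0 k \<theta>\<bar>) \<le> R" if "\<theta> \<in> {\<theta>1..\<theta>2}" for \<theta> K by (rule bound[OF z(1) b0 that])
  have B1: "(\<Sum>k<K. \<bar>t1 k \<theta>\<bar>) \<le> R" if "\<theta> \<in> {\<theta>1..\<theta>2}" for \<theta> K by (rule bound[OF z(2) b1 that])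
  have B2: "(\<Sum>k<K. \<bar>t2 k \<theta>\<bar>) \<le> R" if "\<theta> \<in> {\<theta>1..\<theta>2}" for \<theta> K by (rule bound[OF z(3) b2 that])
  have c11: "\<bar>(\<Sum>k. t0 k y) - (\<Sum>k. t0 k x) - (\<Sum>k. t1 k x) * (y - x)\<bar> \<le> R * (y - x)\<^sup>2"
    "\<bar>\<Sum>k. t0 k x\<bar> \<le> R" "\<bar>\<Sum>k. t1 k x\<bar> \<le> R" if "x \<in> {\<theta>1..\<theta>2}" "y \<in> {\<theta>1..\<theta>2}" for x y
    using c11_of_bounded_partial_sums[of \<theta>1 \<theta>2 t0 t1 t2 R x y] D0 D1 B0 B1 B2 that by blast+
  have t0s: "(\<Sum>k. t0 k x) = (\<Sum>k. - 2 * cos_coeff (\<lambda>t. F (t, x)) k * sin (real k * x))" if "x \<in> {\<theta>1..\<theta>2}" for x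
    unfolding t0_def by (simp only: A[OF that])
  \<comment> \<open>For an empty interval \<open>R0\<close> is not known to be nonnegative, but then
    any constant will do.\<close>
  show thesis
  proof (cases "{\<theta>1..\<theta>2} = {}")
    case True
    show thesis by (rule that[of 1 "\<lambda>_. 0"]) (use True in auto)
  next
    case False
    then have Rp: "R > 0" using R0nn unfolding R_def by fastforce
    show thesis
    proof (rule that[of R "\<lambda>x. \<Sum>k. t1 k x"])
      fix x assume x: "x \<in> {\<theta>1..\<theta>2}"
      show "\<bar>\<Sum>k. t1 k x\<bar> \<le> R" by (rule c11(3)[OF x x])
      show "\<bar>\<Sum>k. - 2 * cos_coeff (\<lambda>t. F (t, x)) k * sin (real k * x)\<bar> \<le> R"
        unfolding t0s[OF x, symmetric] by (rule c11(2)[OF x x])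
      have se: "summable (\<lambda>k. e k x)"
      proof -
        define u where "u k = (if k = 0 then 0 else 4 * e k x)" for k
        have "(\<Sum>k<K. \<bar>u k\<bar>) \<le> R" for K
          by (rule bound[OF _ _ x]) (auto simp: u_def e0)
        then have "summable (\<lambda>k. \<bar>u k\<bar>)" by (intro summableI_nonneg_bounded[of _ R]) auto
        then have "summable (\<lambda>k. 4 * e k x)"
          by (rule summable_comparison_test[rotated]) (auto intro!: exI[of _ 1] simp: e0 u_def)
        from summable_mult[OF this, of "1 / 4"] show ?thesis by simp
      qed
      show "summable (\<lambda>k. \<bar>cos_coeff (\<lambda>t. F (t, x)) k\<bar>)"
        unfolding A[OF x, symmetric]
        by (rule summable_comparison_test[OF _ se], rule exI[of _ 1]) (use k1(1)[of _ x] in \<open>auto simp: e_def intro!: add_increasing2 order_trans[OF k1(1)]\<close>)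
      show "summable (\<lambda>k. real k * \<bar>cos_coeff (\<lambda>t. F (t, x)) k\<bar>)"
        unfolding A[OF x, symmetric]
        by (rule summable_comparison_test[OF _ se], rule exI[of _ 1]) (auto simp: e_def intro!: add_increasing2 order_trans[OF k1(2)])
    next
      fix x y assume x: "x \<in> {\<theta>1..\<theta>2}" and y: "y \<in> {\<theta>1..\<theta>2}"
      show "\<bar>(\<Sum>k. - 2 * cos_coeff (\<lambda>t. F (t, y)) k * sin (real k * y)) - (\<Sum>k. - 2 * cos_coeff (\<lambda>t. F (t, x)) k * sin (real k * x))
        - (\<Sum>k. t1 k x) * (y - x)\<bar> \<le> R * (y - x)\<^sup>2"
        unfolding t0s[OF x, symmetric] t0s[OF y, symmetric] by (rule c11(1)[OF x y])
    qed (rule Rp)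
  qed
qed

section \<open>Fourier coefficients of even functions, and elementary estimates\<close>

definition cos_fourier :: "(real \<Rightarrow> real) \<Rightarrow> int \<Rightarrow> real" where
  "cos_fourier h j = 1 / pi * integral {0..pi} (\<lambda>t. h t * cos (of_int j * t))"

lemma cos_fourier_minus: "cos_fourier h (- j) = cos_fourier h j"
  by (simp add: cos_fourier_def)

lemma cos_fourier_nat: "cos_fourier h (int k) = (if k = 0 then 2 else 1) * cos_coeff h k"
  by (simp add: cos_fourier_def cos_coeff_def)

lemma cos_fourier_delta: "1 / pi * integral {0..pi} (\<lambda>t. cos (of_int m * t)) = (if m = 0 then 1 else 0)"
  using has_integral_cos_multiple(1)[of m] by (auto simp: integral_unique)

lemma periodic_int:
  fixes f :: "real \<Rightarrow> 'a"
  assumes f_periodic: "\<And>x. f (x + 2 * pi) = f x"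
  shows "f (x + 2 * of_int n * pi) = f x"
proof -
  have nat: "f (x + 2 * real m * pi) = f x" for m x
  proof (induction m)
    case (Suc m)
    have "x + 2 * real (Suc m) * pi = (x + 2 * real m * pi) + 2 * pi" by (simp add: algebra_simps)
    then show ?case using Suc by (simp only: f_periodic)
  qed simp
  show ?thesis
  proof (cases "n \<ge> 0")
    case True
    then show ?thesis using nat[of x "nat n"] by simp
  next
    case False
    then show ?thesis using nat[of "x + 2 * of_int n * pi" "nat (- n)"] by (simp add: algebra_simps)
  qed
qed

text \<open>The reflection t to 2\<pi> - t cancels the sine part and folds the cosine part onto the
  half period; in particular T_N(f) is real and symmetric.\<close>

lemma fourier_coeff_even:
  assumes c: "continuous_on UNIV f" and e: "\<And>t. f (2 * pi - t) = f t"
  shows "fourier_coeff (\<lambda>t. complex_of_real (f t)) u = complex_of_real (cos_fourier f u)"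
proof -
  have fc: "continuous_on S f" for S by (rule continuous_on_subset[OF c]) simp
  define F where "F t = f t * cos (of_int u * t)" for t
  define S where "S t = f t * sin (of_int u * t)" for t
  have Fc: "continuous_on A F" and Sc: "continuous_on A S" for A
    unfolding F_def S_def by (intro continuous_intros fc)+
  have per: "cos (of_int u * (2 * pi - t)) = cos (of_int u * t)" "sin (of_int u * (2 * pi - t)) = - sin (of_int u * t)" for t :: real
  proof -
    have "of_int u * (2 * pi - t) = - (of_int u * t) + 2 * of_int u * pi" by (simp add: algebra_simps)
    then show "cos (of_int u * (2 * pi - t)) = cos (of_int u * t)" "sin (of_int u * (2 * pi - t)) = - sin (of_int u * t)"
      using periodic_int[of cos "- (of_int u * t)" u] periodic_int[of sin "- (of_int u * t)" u] by simp_all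
  qed
  have F2: "F (2 * pi - t) = F t" and S2: "S (2 * pi - t) = - S t" for t
    by (simp_all add: F_def S_def e per)
  have "integral {0..2 * pi} (\<lambda>t. S (0 + 2 * pi - t)) = integral {0..2 * pi} S" by (rule integral_reflect_real[OF Sc])
  then have S0: "integral {0..2 * pi} S = 0" by (simp add: S2)
  have "integral {0..2 * pi} F = integral {0..pi} F + integral {pi..2 * pi} F"
    by (rule Henstock_Kurzweil_Integration.integral_combine[symmetric]) (auto intro!: integrable_continuous_interval Fc)
  also have "integral {pi..2 * pi} F = integral {0..pi} (\<lambda>t. F (t + pi))"
    using integral_shift_real[OF Fc, of 0 pi pi] by simp
  also have "\<dots> = integral {0..pi} (\<lambda>t. F (0 + pi - t + pi))"
    by (rule integral_reflect_real[symmetric, of 0 pi "\<lambda>t. F (t + pi)"])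
       (rule continuous_on_compose2[OF Fc[of UNIV]], auto intro!: continuous_intros)
  also have "(\<lambda>t. F (0 + pi - t + pi)) = F"
  proof
    fix t
    have "0 + pi - t + pi = 2 * pi - t" by simp
    then show "F (0 + pi - t + pi) = F t" using F2 by simp
  qed
  finally have F0: "integral {0..2 * pi} F = 2 * integral {0..pi} F" by simp
  have hF: "(F has_integral 2 * integral {0..pi} F) {0..2 * pi}"
    using integrable_integral[OF integrable_continuous_interval[OF Fc], of 0 "2 * pi"] unfolding F0 .
  have hS: "(S has_integral 0) {0..2 * pi}"
    using integrable_integral[OF integrable_continuous_interval[OF Sc], of 0 "2 * pi"] unfolding S0 .
  have "((\<lambda>t. complex_of_real (F t) - \<i> * complex_of_real (S t)) has_integral
      (complex_of_real (2 * integral {0..pi} F) - \<i> * complex_of_real 0)) {0..2 * pi}"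
    using has_integral_linear[OF hF bounded_linear_of_real] has_integral_linear[OF hS bounded_linear_of_real]
    by (intro has_integral_diff has_integral_mult_right) (auto simp: o_def)
  moreover have "complex_of_real (F t) - \<i> * complex_of_real (S t) = complex_of_real (f t) * exp (- \<i> * of_int u * of_real t)" for t
  proof -
    have "- \<i> * of_int u * of_real t = \<i> * complex_of_real (- (of_int u * t))" by simp
    then have "exp (- \<i> * of_int u * of_real t) = cis (- (of_int u * t))" by (simp only: cis_conv_exp)
    then show ?thesis unfolding F_def S_def by (simp add: complex_eq_iff)
  qed
  ultimately have "integral {0..2 * pi} (\<lambda>t. complex_of_real (f t) * exp (- \<i> * of_int u * of_real t)) = complex_of_real (2 * integral {0..pi} F)"
    by (simp add: integral_unique)
  then show ?thesis unfolding fourier_coeff_def cos_fourier_def F_def by simp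
qed

lemma eventually_small: "eventually (\<lambda>N. K / (real N + 2) < e) sequentially" if "e > 0"
proof -
  have "((\<lambda>N. K / real (N + 2)) \<longlongrightarrow> 0) sequentially"
    by (rule LIMSEQ_ignore_initial_segment[OF lim_const_over_n])
  from order_tendstoD(2)[OF this that] show ?thesis by (simp add: add.commute)
qed

lemma eventually_small_sqrt: "eventually (\<lambda>N. K / sqrt (real N + 2) < e) sequentially" if "e > 0"
proof -
  have "eventually (\<lambda>N. K\<^sup>2 / (real N + 2) < e\<^sup>2) sequentially" using that by (intro eventually_small) simp
  then show ?thesis
  proof eventually_elim
    case (elim N)
    have "(K / sqrt (real N + 2))\<^sup>2 < e\<^sup>2" using elim by (simp add: power_divide)
    then show ?case using that by (rule power2_less_imp_less[OF _ less_imp_le])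
  qed
qed

text \<open>Up to \<pi>/3 the difference 2 sin y - y has derivative 2 cos y - 1 \<ge> 0; beyond, 2
  sin y is at least sqrt 3, which exceeds \<pi>/2.\<close>

lemma abs_le_2_abs_sin:
  assumes "\<bar>y\<bar> \<le> pi / 2"
  shows "\<bar>y\<bar> \<le> 2 * \<bar>sin y\<bar>"
proof -
  have pos: "y \<le> 2 * sin y" if "0 \<le> y" "y \<le> pi / 2" for y :: real
  proof (cases "y \<le> pi / 3")
    case True
    have "(\<lambda>y. 2 * sin y - y) 0 \<le> (\<lambda>y. 2 * sin y - y) y"
    proof (rule DERIV_nonneg_imp_nondecreasing[OF that(1)])
      fix x assume x: "0 \<le> x" "x \<le> y"
      have "cos (pi / 3) \<le> cos x" using x True pi_gt_zero by (intro cos_monotone_0_pi_le) auto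
      then have "0 \<le> 2 * cos x - 1" by (simp add: cos_60)
      then show "\<exists>z. ((\<lambda>y. 2 * sin y - y) has_real_derivative z) (at x) \<and> 0 \<le> z"
        by (intro exI[of _ "2 * cos x - 1"]) (auto intro!: derivative_eq_intros)
    qed
    then show ?thesis by simp
  next
    case False
    have "sin (pi / 3) \<le> sin y" using False that pi_gt_zero by (intro sin_monotone_2pi_le) auto
    then have "sqrt 3 / 2 \<le> sin y" by (simp add: sin_60)
    moreover have "sqrt 3 \<ge> 1.7" by (rule real_le_rsqrt) (simp add: power2_eq_square)
    moreover have "pi < 3.2" using pi_approx by simp
    ultimately show ?thesis using that by simp
  qed
  show ?thesis
  proof (cases "y \<ge> 0")
    case True
    then have "y \<le> 2 * sin y" using pos assms by simp
    then show ?thesis using True by simp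
  next
    case False
    then have "- y \<le> 2 * sin (- y)" using pos[of "- y"] assms by simp
    then show ?thesis using False by simp
  qed
qed

lemma sin_small_imp_near_multiple:
  obtains k :: int where "\<bar>x - of_int k * pi\<bar> \<le> 2 * \<bar>sin x\<bar>"
proof -
  define k where "k = round (x / pi)"
  define y where "y = x - of_int k * pi"
  have "\<bar>of_int k - x / pi\<bar> \<le> 1 / 2" unfolding k_def by (rule of_int_round_abs_le)
  then have "\<bar>of_int k - x / pi\<bar> * pi \<le> 1 / 2 * pi" by (intro mult_right_mono) auto
  then have "\<bar>(of_int k - x / pi) * pi\<bar> \<le> pi / 2" by (simp add: abs_mult)
  then have y: "\<bar>y\<bar> \<le> pi / 2" unfolding y_def by (simp add: left_diff_distrib abs_minus_commute)
  have "sin y = sin x * cos (of_int k * pi)"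
    unfolding y_def sin_diff using sin_zero_iff_int2[of "of_int k * pi"] by auto
  moreover have "\<bar>cos (of_int k * pi)\<bar> \<le> 1" by simp
  ultimately have "\<bar>sin y\<bar> \<le> \<bar>sin x\<bar>" by (simp add: abs_mult mult_left_le)
  with abs_le_2_abs_sin[OF y] show ?thesis by (intro that[of k]) (simp add: y_def)
qed

text \<open>\<open>Min\<close> and \<open>Max\<close> have their intended meaning only for a finite
  nonempty set, which is assured as soon as the grid spacing is smaller than the interval.
  Monotonicity of the grid leaves no gaps in between.\<close>

lemma k_range_iff:
  assumes "\<alpha> < \<beta>"
  shows "eventually (\<lambda>N. \<forall>k. k \<in> {k_min \<alpha> \<beta> N..k_max \<alpha> \<beta> N} \<longleftrightarrow> grid N k \<in> {\<alpha>..\<beta>}) sequentially"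
proof -
  have "eventually (\<lambda>N. pi / (real N + 2) < \<beta> - \<alpha>) sequentially" using assms by (intro eventually_small) simp
  then show ?thesis
  proof eventually_elim
    case (elim N)
    define n where "n = real N + 2"
    have n: "n > 0" by (simp add: n_def)
    define p where "p = pi / n"
    have gr: "grid N k = of_int k * p" for k by (simp add: grid_def n_def p_def)
    have pn: "p > 0" using n by (simp add: p_def)
    define A where "A = {k. grid N k \<in> {\<alpha>..\<beta>}}"
    have mono: "grid N j \<le> grid N k" if "j \<le> k" for j k unfolding gr using that pn by (intro mult_right_mono) auto
    have "A \<subseteq> {\<lfloor>\<alpha> / p\<rfloor>..\<lceil>\<beta> / p\<rceil>}"
    proof
      fix k assume "k \<in> A"
      then have "\<alpha> / p \<le> of_int k" "of_int k \<le> \<beta> / p"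
        unfolding A_def gr using pn by (auto simp: pos_divide_le_eq pos_le_divide_eq)
      then show "k \<in> {\<lfloor>\<alpha> / p\<rfloor>..\<lceil>\<beta> / p\<rceil>}" by (auto simp: floor_le_iff le_ceiling_iff)
    qed
    then have fin: "finite A" by (rule finite_subset) simp
    have ne: "A \<noteq> {}"
    proof -
      define k where "k = \<lceil>\<alpha> / p\<rceil>"
      have "\<alpha> / p \<le> of_int k" "of_int k < \<alpha> / p + 1" unfolding k_def by linarith+
      then have "\<alpha> \<le> of_int k * p" "(of_int k - 1) * p < \<alpha>"
        using pn pos_less_divide_eq[of p "of_int k - 1" \<alpha>] by (simp_all add: pos_divide_le_eq)
      moreover have "p < \<beta> - \<alpha>" using elim by (simp add: n_def p_def)
      ultimately have "k \<in> A" unfolding A_def gr by (simp add: left_diff_distrib)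
      then show ?thesis by auto
    qed
    have kk: "k_min \<alpha> \<beta> N = Min A" "k_max \<alpha> \<beta> N = Max A" by (simp_all add: k_min_def k_max_def A_def)
    have "k \<in> {Min A..Max A} \<longleftrightarrow> grid N k \<in> {\<alpha>..\<beta>}" for k
    proof
      assume k: "k \<in> {Min A..Max A}"
      have "Min A \<in> A" "Max A \<in> A" using fin ne by auto
      then show "grid N k \<in> {\<alpha>..\<beta>}" using mono[of "Min A" k] mono[of k "Max A"] k unfolding A_def by auto
    next
      assume "grid N k \<in> {\<alpha>..\<beta>}"
      then have "k \<in> A" by (simp add: A_def)
      then show "k \<in> {Min A..Max A}" using fin by simp
    qed
    then show ?case unfolding kk by blast
  qed
qed

section \<open>The quotient H and its logarithm\<close>

locale smooth_symbol =
  fixes f :: "real \<Rightarrow> real" and \<theta>1 \<theta>2 :: real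
  assumes \<theta>1: "0 < \<theta>1" and \<theta>12: "\<theta>1 < \<theta>2" and \<theta>2: "\<theta>2 < pi"
    and f_even: "\<And>x. f (- x) = f x" and f_periodic: "\<And>x. f (x + 2 * pi) = f x"
    and f_C4: "C_class 4 f" and f_A: "f \<in> A_plus \<theta>1 \<theta>2"
begin

lemma DERIV_iterate: "j < 4 \<Longrightarrow> (((deriv ^^ j) f) has_real_derivative (deriv ^^ Suc j) f x) (at x)"
  using f_C4 unfolding C_class_def by (simp add: DERIV_deriv_iff_real_differentiable)

lemma DERIV_f: "(f has_real_derivative deriv f x) (at x)"
  using DERIV_iterate[of 0] by simp

lemma f_cont: "continuous_on S f"
  by (meson DERIV_f DERIV_isCont continuous_at_imp_continuous_on)

lemma deriv_f_pos: "\<theta> \<in> {\<theta>1..\<theta>2} \<Longrightarrow> deriv f \<theta> > 0"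
  using f_A by (simp add: A_plus_def)

lemma f_range: "\<theta> \<in> {0..pi} \<Longrightarrow> f \<theta> \<in> {f \<theta>1..f \<theta>2} \<longleftrightarrow> \<theta> \<in> {\<theta>1..\<theta>2}"
  using f_A by (simp add: A_plus_def)

lemma f_strict_mono:
  assumes "x \<in> {\<theta>1..\<theta>2}" "y \<in> {\<theta>1..\<theta>2}" "x < y"
  shows "f x < f y"
  by (rule DERIV_pos_imp_increasing[OF assms(3)]) (use assms DERIV_f deriv_f_pos in \<open>meson atLeastAtMost_iff order_trans\<close>)

text \<open>Immediately to the right of \<theta>2 the function exceeds f \<theta>2. Were it smaller
  at t, it would take the value f \<theta>2 once more in between, at a point outside
  [\<theta>1, \<theta>2], against the defining equivalence of \<open>A_plus\<close>.\<close>

lemma f_above: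
  assumes "\<theta>2 < t" "t \<le> pi"
  shows "f \<theta>2 < f t"
proof (rule ccontr)
  assume "\<not> f \<theta>2 < f t"
  moreover have "f t \<notin> {f \<theta>1..f \<theta>2}" using f_range[of t] assms \<theta>1 \<theta>12 by auto
  ultimately have ft: "f t < f \<theta>2" using f_strict_mono[of \<theta>1 \<theta>2] \<theta>12 by auto
  obtain d where d: "d > 0" "\<And>h. 0 < h \<Longrightarrow> h < d \<Longrightarrow> f \<theta>2 < f (\<theta>2 + h)"
    using DERIV_pos_inc_right[OF DERIV_f deriv_f_pos[of \<theta>2]] \<theta>12 by auto
  define \<delta> where "\<delta> = min (d / 2) ((t - \<theta>2) / 2)"
  have \<delta>: "0 < \<delta>" "\<delta> < d" "\<delta> < t - \<theta>2" using d(1) assms unfolding \<delta>_def by (auto simp: min_def field_simps)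
  define s where "s = \<theta>2 + \<delta>"
  have s: "\<theta>2 < s" "s < t" "f \<theta>2 < f s"
    using \<delta> d(2)[OF \<delta>(1,2)] unfolding s_def by auto
  obtain x where x: "s \<le> x" "x \<le> t" "f x = f \<theta>2"
    using IVT2'[of f t "f \<theta>2" s] ft s f_cont by auto
  have "f x \<in> {f \<theta>1..f \<theta>2}" using x f_strict_mono[of \<theta>1 \<theta>2] \<theta>12 by auto
  then show False using f_range[of x] x s assms \<theta>1 \<theta>12 by auto
qed

lemma f_below:
  assumes "0 \<le> t" "t < \<theta>1"
  shows "f t < f \<theta>1"
proof (rule ccontr)
  assume "\<not> f t < f \<theta>1"
  moreover have "f t \<notin> {f \<theta>1..f \<theta>2}" using f_range[of t] assms \<theta>2 \<theta>12 by auto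
  ultimately have ft: "f \<theta>1 < f t" using f_strict_mono[of \<theta>1 \<theta>2] \<theta>12 by auto
  obtain d where d: "d > 0" "\<And>h. 0 < h \<Longrightarrow> h < d \<Longrightarrow> f (\<theta>1 - h) < f \<theta>1"
    using DERIV_pos_inc_left[OF DERIV_f deriv_f_pos[of \<theta>1]] \<theta>12 by auto
  define \<delta> where "\<delta> = min (d / 2) ((\<theta>1 - t) / 2)"
  have \<delta>: "0 < \<delta>" "\<delta> < d" "\<delta> < \<theta>1 - t" using d(1) assms unfolding \<delta>_def by (auto simp: min_def field_simps)
  define s where "s = \<theta>1 - \<delta>"
  have s: "s < \<theta>1" "t < s" "f s < f \<theta>1"
    using \<delta> d(2)[OF \<delta>(1,2)] unfolding s_def by auto
  obtain x where x: "t \<le> x" "x \<le> s" "f x = f \<theta>1"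
    using IVT2'[of f s "f \<theta>1" t] ft s f_cont by auto
  have "f x \<in> {f \<theta>1..f \<theta>2}" using x f_strict_mono[of \<theta>1 \<theta>2] \<theta>12 by auto
  then show False using f_range[of x] x s assms \<theta>2 \<theta>12 by auto
qed

lemma f_separates:
  assumes "t \<in> {0..pi}" "\<theta> \<in> {\<theta>1..\<theta>2}"
  shows "t < \<theta> \<Longrightarrow> f t < f \<theta>" "\<theta> < t \<Longrightarrow> f \<theta> < f t"
proof -
  have mono: "f x \<le> f y" if "x \<in> {\<theta>1..\<theta>2}" "y \<in> {\<theta>1..\<theta>2}" "x \<le> y" for x y
    using f_strict_mono[OF that(1,2)] that(3) by (cases "x = y") auto
  show "f t < f \<theta>" if "t < \<theta>"
  proof (cases "t < \<theta>1")
    case True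
    then show ?thesis using f_below[of t] mono[of \<theta>1 \<theta>] assms \<theta>12 by auto
  qed (use f_strict_mono[of t \<theta>] assms that in auto)
  show "f \<theta> < f t" if "\<theta> < t"
  proof (cases "\<theta>2 < t")
    case True
    then show ?thesis using f_above[of t] mono[of \<theta> \<theta>2] assms \<theta>12 by auto
  qed (use f_strict_mono[of \<theta> t] assms that in auto)
qed

text \<open>The divided differences of f and of -cos, extended smoothly to the diagonal. The set U below is the
  neighbourhood of the box where their quotient is a smooth version of H.\<close>

definition num :: "real \<times> real \<Rightarrow> real" where
  "num p = integral {0..1} (\<lambda>s. 1 * deriv f (snd p + s * (fst p - snd p)))"

definition den :: "real \<times> real \<Rightarrow> real" where
  "den p = integral {0..1} (\<lambda>s. 1 * sin (snd p + s * (fst p - snd p)))"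

lemma num_eq: "(t - \<theta>) * num (t, \<theta>) = f t - f \<theta>"
  unfolding num_def using segment_integral[OF DERIV_f, of t \<theta>] by simp

lemma den_eq: "(t - \<theta>) * den (t, \<theta>) = cos \<theta> - cos t"
proof -
  have "((\<lambda>x. - cos x) has_real_derivative sin x) (at x)" for x :: real
    by (auto intro!: derivative_eq_intros)
  from segment_integral[OF this, of t \<theta>] show ?thesis by (simp add: den_def)
qed

lemma num_diag: "num (\<theta>, \<theta>) = deriv f \<theta>" by (simp add: num_def)

lemma den_diag: "den (\<theta>, \<theta>) = sin \<theta>" by (simp add: den_def)

lemma C_diff_num: "C_diff 3 UNIV num"
proof -
  have "C_diff 3 UNIV (\<lambda>p. integral {0..1} (\<lambda>s. 1 * (deriv ^^ Suc 0) f (snd p + s * (fst p - snd p))))"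
  proof (rule C_diff_segment_integral[of 3 "\<lambda>i. (deriv ^^ Suc i) f" "\<lambda>_. 1"])
    show "((deriv ^^ Suc i) f has_real_derivative (deriv ^^ Suc (Suc i)) f x) (at x)" if "i < 3" for i x
      using DERIV_iterate[of "Suc i"] that by simp
    have "Suc 3 = (4::nat)" by simp
    then show "continuous_on UNIV ((deriv ^^ Suc 3) f)" using f_C4 unfolding C_class_def by (simp only:)
  qed simp
  then show ?thesis by (simp add: num_def[abs_def])
qed

lemma C_diff_den: "C_diff 3 UNIV den"
proof -
  have "C_diff 3 UNIV (\<lambda>p. integral {0..1} (\<lambda>s. 1 * (\<lambda>x. sin (x + real 0 * (pi / 2))) (snd p + s * (fst p - snd p))))"
  \<comment> \<open>Shifts by quarter periods give all derivatives of the sine in one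
    formula.\<close>
  proof (rule C_diff_segment_integral[of 3 "\<lambda>i x. sin (x + real i * (pi / 2))" "\<lambda>_. 1"])
    fix i :: nat and x :: real
    have "x + real (Suc i) * (pi / 2) = (x + real i * (pi / 2)) + pi / 2" by (simp add: algebra_simps)
    then have "sin (x + real (Suc i) * (pi / 2)) = cos (x + real i * (pi / 2))" by (simp only: sin_add) simp
    then show "((\<lambda>x. sin (x + real i * (pi / 2))) has_real_derivative sin (x + real (Suc i) * (pi / 2))) (at x)"
      by (auto intro!: derivative_eq_intros)
  qed (auto intro!: continuous_intros)
  then show ?thesis by (simp add: den_def[abs_def])
qed

definition U :: "(real \<times> real) set" where "U = {p. num p > 0 \<and> den p > 0}"

lemma open_U: "open U"
proof -
  have "open {p. 0 < num p}" "open {p. 0 < den p}"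
    by (intro open_Collect_less continuous_on_const C_diff_continuous[OF C_diff_num] C_diff_continuous[OF C_diff_den])+
  then show ?thesis unfolding U_def by (intro open_Collect_conj)
qed

lemma box_subset_U: "{0..pi} \<times> {\<theta>1..\<theta>2} \<subseteq> U"
proof clarify
  fix t \<theta> assume t: "t \<in> {0..pi}" and \<theta>: "\<theta> \<in> {\<theta>1..\<theta>2}"
  have sgn: "x > 0" if "(t - \<theta>) * x = y" "t < \<theta> \<Longrightarrow> y < 0" "\<theta> < t \<Longrightarrow> 0 < y" "t \<noteq> \<theta>" for x y
    using that by (cases "t < \<theta>") (auto simp: mult_less_0_iff zero_less_mult_iff)
  have "num (t, \<theta>) > 0"
  proof (cases "t = \<theta>")
    case False
    show ?thesis by (rule sgn[OF num_eq]) (use f_separates[OF t \<theta>] False in auto)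
  qed (use num_diag deriv_f_pos \<theta> in simp)
  moreover have "den (t, \<theta>) > 0"
  proof (cases "t = \<theta>")
    case False
    show ?thesis
      by (rule sgn[OF den_eq]) (use t \<theta> \<theta>1 \<theta>2 False cos_monotone_0_pi[of t \<theta>] cos_monotone_0_pi[of \<theta> t] in auto)
  qed (use den_diag sin_gt_zero[of \<theta>] \<theta> \<theta>1 \<theta>2 in simp)
  ultimately show "(t, \<theta>) \<in> U" by (simp add: U_def)
qed

lemma H_quot_eq:
  assumes "(t, \<theta>) \<in> U"
  shows "H_quot f t \<theta> = num (t, \<theta>) * inverse (den (t, \<theta>))"
proof (cases "t = \<theta>")
  case True
  then show ?thesis by (simp add: H_quot_def num_diag den_diag divide_inverse)
next
  case False
  have "den (t, \<theta>) > 0" using assms by (simp add: U_def)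
  \<comment> \<open>On \<open>U\<close> the exceptional case of \<open>H_quot\<close> occurs only on
    the diagonal, since a positive \<open>den\<close> rules out any other solution of cos t = cos
    \<theta>.\<close>
  then have "cos \<theta> - cos t \<noteq> 0" using den_eq[of t \<theta>] False by auto
  then have "H_quot f t \<theta> = ((t - \<theta>) * num (t, \<theta>)) / ((t - \<theta>) * den (t, \<theta>))"
    unfolding num_eq den_eq by (simp add: H_quot_def)
  then show ?thesis using False by (simp add: divide_inverse)
qed

lemma H_quot_pos: "(t, \<theta>) \<in> U \<Longrightarrow> H_quot f t \<theta> > 0"
  by (simp add: H_quot_eq) (simp add: U_def)

lemma C_diff_H: "C_diff 3 U (\<lambda>p. H_quot f (fst p) (snd p))"
proof (rule C_diff_cong[OF open_U])
  show "C_diff 3 U (\<lambda>p. num p * inverse (den p))"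
    by (intro C_diff_mult C_diff_inverse C_diff_subset[OF C_diff_num] C_diff_subset[OF C_diff_den]) (auto simp: U_def)
qed (auto simp: H_quot_eq)

lemma C_diff_ln_H: "C_diff 3 U (\<lambda>p. ln (H_quot f (fst p) (snd p)))"
  by (rule C_diff_ln[OF C_diff_H]) (auto simp: H_quot_pos)

lemma f_reflect: "f (2 * pi - t) = f t"
  using f_periodic[of "- t"] f_even[of t] by (simp add: add.commute)

lemma H_quot_even: "H_quot f (- t) \<theta> = H_quot f t \<theta>" "H_quot f (2 * pi - t) \<theta> = H_quot f t \<theta>"
  by (simp_all add: H_quot_def f_even f_reflect cos_diff)

sublocale H: even_kernel "\<lambda>p. H_quot f (fst p) (snd p)" U \<theta>1 \<theta>2
  by unfold_locales (use open_U box_subset_U C_diff_H H_quot_even in auto)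

sublocale lnH: even_kernel "\<lambda>p. ln (H_quot f (fst p) (snd p))" U \<theta>1 \<theta>2
  by unfold_locales (use open_U box_subset_U C_diff_ln_H H_quot_even in auto)

text \<open>The assumptions on f give information on [0, \<pi>] only. The point arccos (cos t)
  represents t there without changing f or any cosine term, which carries positivity, bounds and
  series expansions of H to the whole line.\<close>

lemma fold_to_half_period:
  obtains s where "s \<in> {0..pi}" "f s = f t" "\<And>k. cos (real k * s) = cos (real k * t)"
proof -
  define s where "s = arccos (cos t)"
  have s: "s \<in> {0..pi}" "cos t = cos s" unfolding s_def by (auto simp: arccos_lbound arccos_ubound)
  then obtain n :: real where "n \<in> \<int>" and n: "t = s + 2 * n * pi \<or> t = - s + 2 * n * pi"
    unfolding cos_eq by auto
  from this(1) obtain m :: int where m: "n = of_int m" by (rule Ints_cases)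
  have "f s = f t"
    using n f_even[of s] periodic_int[of f s m] periodic_int[of f "- s" m] f_periodic unfolding m by auto
  moreover have "cos (real k * s) = cos (real k * t)" for k
  proof -
    have "real k * (x + 2 * n * pi) = real k * x + 2 * of_int (int k * m) * pi" for x
      by (simp add: m algebra_simps)
    then have "cos (real k * (x + 2 * n * pi)) = cos (real k * x)" for x
      using periodic_int[of cos "real k * x" "int k * m"] by (simp only: cos_periodic)
    from this[of s] this[of "- s"] show ?thesis using n by auto
  qed
  ultimately show ?thesis using s(1) by (intro that[of s]) auto
qed

lemma H_quot_fold:
  obtains s where "s \<in> {0..pi}" "\<And>\<theta>. H_quot f s \<theta> = H_quot f t \<theta>" "\<And>k. cos (real k * s) = cos (real k * t)"
proof -
  obtain s where s: "s \<in> {0..pi}" "f s = f t" "\<And>k. cos (real k * s) = cos (real k * t)"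
    using fold_to_half_period by blast
  have "cos s = cos t" using s(3)[of 1] by simp
  then have "H_quot f s \<theta> = H_quot f t \<theta>" for \<theta> using s(2) by (simp add: H_quot_def)
  then show ?thesis using s by (intro that[of s]) auto
qed

section \<open>The coefficients of ln H and the function \<rho>\<close>

definition b :: "real \<Rightarrow> nat \<Rightarrow> real" where
  "b \<theta> k = cos_coeff (\<lambda>t. ln (H_quot f t \<theta>)) k"

lemma b_decay:
  obtains M where "\<And>\<theta> k. \<theta> \<in> {\<theta>1..\<theta>2} \<Longrightarrow> \<bar>b \<theta> k\<bar> \<le> M / (1 + real k) ^ 3"
  by (rule lnH.cos_coeff_decay[unfolded fst_conv snd_conv, folded b_def]) blast

lemma ln_H_series:
  assumes "\<theta> \<in> {\<theta>1..\<theta>2}"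
  shows "(\<lambda>k. 2 * b \<theta> k * cos (real k * t)) sums ln (H_quot f t \<theta>)"
proof -
  obtain s where s: "s \<in> {0..pi}" "\<And>\<theta>. H_quot f s \<theta> = H_quot f t \<theta>" "\<And>k. cos (real k * s) = cos (real k * t)"
    using H_quot_fold by blast
  have "continuous_on {0..pi} (\<lambda>t. ln (H_quot f t \<theta>))"
    using lnH.partial_continuous[OF C_diff_ln_H assms] by simp
  moreover have "summable (\<lambda>k. \<bar>b \<theta> k\<bar>)"
  proof -
    obtain M where M: "\<And>\<theta> k. \<theta> \<in> {\<theta>1..\<theta>2} \<Longrightarrow> \<bar>b \<theta> k\<bar> \<le> M / (1 + real k) ^ 3" by (rule b_decay) blast
    show ?thesis
      by (rule summable_comparison_test[OF _ summable_mult[OF summable_inverse_cubes, of M]]) (use M[OF assms] in auto)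
  qed
  ultimately have "(\<lambda>k. 2 * b \<theta> k * cos (real k * s)) sums ln (H_quot f s \<theta>)"
    unfolding b_def by (rule cos_series_expansion[OF _ _ s(1)])
  then show ?thesis unfolding s(2,3) .
qed

lemma rho_c11:
  obtains \<sigma> R where "R > 0"
    "\<And>x y. x \<in> {\<theta>1..\<theta>2} \<Longrightarrow> y \<in> {\<theta>1..\<theta>2} \<Longrightarrow> \<bar>rho f y - rho f x - \<sigma> x * (y - x)\<bar> \<le> R * (y - x)\<^sup>2"
    "\<And>x. x \<in> {\<theta>1..\<theta>2} \<Longrightarrow> \<bar>rho f x\<bar> \<le> R"
    "\<And>x. x \<in> {\<theta>1..\<theta>2} \<Longrightarrow> \<bar>\<sigma> x\<bar> \<le> R"
    "\<And>\<theta>. \<theta> \<in> {\<theta>1..\<theta>2} \<Longrightarrow> rho f \<theta> = (\<Sum>k. - 2 * b \<theta> k * sin (real k * \<theta>))"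
proof -
  obtain \<sigma> R where R: "R > 0"
    "\<And>x y. x \<in> {\<theta>1..\<theta>2} \<Longrightarrow> y \<in> {\<theta>1..\<theta>2} \<Longrightarrow>
      \<bar>(\<Sum>k. - 2 * b y k * sin (real k * y)) - (\<Sum>k. - 2 * b x k * sin (real k * x)) - \<sigma> x * (y - x)\<bar> \<le> R * (y - x)\<^sup>2"
    "\<And>x. x \<in> {\<theta>1..\<theta>2} \<Longrightarrow> \<bar>\<Sum>k. - 2 * b x k * sin (real k * x)\<bar> \<le> R"
    "\<And>x. x \<in> {\<theta>1..\<theta>2} \<Longrightarrow> \<bar>\<sigma> x\<bar> \<le> R"
    and s: "\<And>x. x \<in> {\<theta>1..\<theta>2} \<Longrightarrow> summable (\<lambda>k. \<bar>b x k\<bar>)" "\<And>x. x \<in> {\<theta>1..\<theta>2} \<Longrightarrow> summable (\<lambda>k. real k * \<bar>b x k\<bar>)"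
    by (rule lnH.conjugate_series_c11[unfolded fst_conv snd_conv, folded b_def]) blast
  have rho: "rho f \<theta> = (\<Sum>k. - 2 * b \<theta> k * sin (real k * \<theta>))" if "\<theta> \<in> {\<theta>1..\<theta>2}" for \<theta>
    using that \<theta>1 \<theta>2 by (intro rho_eq_series ln_H_series s) auto
  show thesis
  proof (rule that[of R \<sigma>])
    fix x y assume "x \<in> {\<theta>1..\<theta>2}" "y \<in> {\<theta>1..\<theta>2}"
    then show "\<bar>rho f y - rho f x - \<sigma> x * (y - x)\<bar> \<le> R * (y - x)\<^sup>2" using R(2)[of x y] by (simp only: rho)
  next
    fix x assume "x \<in> {\<theta>1..\<theta>2}"
    then show "\<bar>rho f x\<bar> \<le> R" using R(3)[of x] by (simp only: rho)
  qed (use R(1,4) rho in blast)+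
qed

text \<open>The second conclusion is positivity of H for all real t, in the form in which it is
  used.\<close>

lemma ln_H_bounded:
  obtains m where "m > 0" "\<And>t \<theta>. \<theta> \<in> {\<theta>1..\<theta>2} \<Longrightarrow> \<bar>ln (H_quot f t \<theta>)\<bar> \<le> m"
    "\<And>t \<theta>. \<theta> \<in> {\<theta>1..\<theta>2} \<Longrightarrow> exp (ln (H_quot f t \<theta>)) = H_quot f t \<theta>"
proof -
  obtain m where m: "m > 0" "\<And>t \<theta>. t \<in> {0..pi} \<Longrightarrow> \<theta> \<in> {\<theta>1..\<theta>2} \<Longrightarrow> \<bar>ln (H_quot f t \<theta>)\<bar> \<le> m"
    using lnH.partial_bounded[OF C_diff_ln_H] unfolding fst_conv snd_conv by metis
  show thesis
  proof (rule that[OF m(1)])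
    fix t \<theta> assume \<theta>: "\<theta> \<in> {\<theta>1..\<theta>2}"
    obtain s where s: "s \<in> {0..pi}" "\<And>\<theta>. H_quot f s \<theta> = H_quot f t \<theta>" using H_quot_fold by blast
    show "\<bar>ln (H_quot f t \<theta>)\<bar> \<le> m" using m(2)[OF s(1) \<theta>] s(2) by simp
    have "(s, \<theta>) \<in> U" using box_subset_U s(1) \<theta> by auto
    from H_quot_pos[OF this] show "exp (ln (H_quot f t \<theta>)) = H_quot f t \<theta>" by (simp add: s(2))
  qed
qed

lemma H_cont: "\<theta> \<in> {\<theta>1..\<theta>2} \<Longrightarrow> continuous_on {0..pi} (\<lambda>t. H_quot f t \<theta>)"
  using H.partial_continuous[OF C_diff_H] by simp

section \<open>The Toeplitz matrices of H and the factor D\<close>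

definition g :: "real \<Rightarrow> int \<Rightarrow> real" where
  "g \<theta> = cos_fourier (\<lambda>t. H_quot f t \<theta>)"

lemma g_abs_summable:
  obtains G where "\<And>\<theta>. \<theta> \<in> {\<theta>1..\<theta>2} \<Longrightarrow> summable (\<lambda>i. \<bar>g \<theta> (int i)\<bar>)"
    "\<And>\<theta>. \<theta> \<in> {\<theta>1..\<theta>2} \<Longrightarrow> (\<Sum>i. \<bar>g \<theta> (int i)\<bar>) \<le> G"
proof -
  obtain M where M: "\<And>\<theta> k. \<theta> \<in> {\<theta>1..\<theta>2} \<Longrightarrow> \<bar>cos_coeff (\<lambda>t. H_quot f t \<theta>) k\<bar> \<le> M / (1 + real k) ^ 3"
    by (rule H.cos_coeff_decay[unfolded fst_conv snd_conv]) blast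
  have le: "\<bar>g \<theta> (int i)\<bar> \<le> 2 * M * (1 / (1 + real i) ^ 3)" if "\<theta> \<in> {\<theta>1..\<theta>2}" for \<theta> i
  proof -
    have "\<bar>(if i = 0 then 2 else 1) * x\<bar> \<le> 2 * \<bar>x\<bar>" for x :: real by (auto simp: abs_mult)
    then have "\<bar>g \<theta> (int i)\<bar> \<le> 2 * \<bar>cos_coeff (\<lambda>t. H_quot f t \<theta>) i\<bar>"
      unfolding g_def cos_fourier_nat .
    with M[OF that, of i] show ?thesis by simp
  qed
  have s: "summable (\<lambda>i. \<bar>g \<theta> (int i)\<bar>)" if "\<theta> \<in> {\<theta>1..\<theta>2}" for \<theta>
    by (rule summable_comparison_test[OF _ summable_mult[OF summable_inverse_cubes, of "2 * M"]]) (use le[OF that] in auto)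
  show thesis
    by (rule that[of "\<Sum>i. 2 * M * (1 / (1 + real i) ^ 3)"])
       (use s in \<open>auto intro!: suminf_le le summable_mult summable_inverse_cubes simp del: times_divide_eq_right\<close>)
qed

text \<open>The quadratic form is the integral of H against S(t) = |\<Sum>i. x i exp(iit)|^2 \<ge>
  0, where the first i in the exponent is the imaginary unit. Replacing H by the constant c, whose
  Toeplitz matrix is c times the identity, gives the lower bound.\<close>

lemma g_pos_def:
  assumes \<theta>: "\<theta> \<in> {\<theta>1..\<theta>2}" and c: "\<And>t. t \<in> {0..pi} \<Longrightarrow> c \<le> H_quot f t \<theta>"
  shows "c * (\<Sum>i<n. (x i)\<^sup>2) \<le> (\<Sum>i<n. \<Sum>j<n. g \<theta> (int i - int j) * x i * x j)"
proof -
  define S where "S t = (\<Sum>i<n. \<Sum>j<n. x i * x j * cos (of_int (int i - int j) * t))" for t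
  have S: "S t = (\<Sum>i<n. x i * cos (real i * t))\<^sup>2 + (\<Sum>i<n. x i * sin (real i * t))\<^sup>2" for t
    unfolding S_def power2_eq_square sum_product sum.distrib[symmetric]
    by (intro sum.cong refl) (simp add: left_diff_distrib cos_diff algebra_simps)
  have Sc: "continuous_on {0..pi} S" unfolding S_def by (intro continuous_intros)
  have int: "1 / pi * integral {0..pi} (\<lambda>t. h t * S t) = (\<Sum>i<n. \<Sum>j<n. cos_fourier h (int i - int j) * x i * x j)"
    if h: "continuous_on {0..pi} h" for h
  proof -
    have "((\<lambda>t. h t * S t) has_integral (\<Sum>i<n. \<Sum>j<n. x i * x j * integral {0..pi} (\<lambda>t. h t * cos (of_int (int i - int j) * t)))) {0..pi}"
    proof -
      have "((\<lambda>t. \<Sum>i<n. \<Sum>j<n. x i * x j * (h t * cos (of_int (int i - int j) * t))) has_integral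
         (\<Sum>i<n. \<Sum>j<n. x i * x j * integral {0..pi} (\<lambda>t. h t * cos (of_int (int i - int j) * t)))) {0..pi}"
        by (intro has_integral_sum has_integral_mult_right integrable_integral integrable_continuous_interval continuous_intros h) auto
      moreover have "(\<lambda>t. \<Sum>i<n. \<Sum>j<n. x i * x j * (h t * cos (of_int (int i - int j) * t))) = (\<lambda>t. h t * S t)"
        unfolding S_def sum_distrib_left by (intro ext sum.cong refl) (simp only: mult_ac)
      ultimately show ?thesis by (simp only:)
    qed
    then have "integral {0..pi} (\<lambda>t. h t * S t) = (\<Sum>i<n. \<Sum>j<n. x i * x j * integral {0..pi} (\<lambda>t. h t * cos (of_int (int i - int j) * t)))"
      by (rule integral_unique)
    then show ?thesis unfolding cos_fourier_def
      by (simp only: sum_distrib_left mult_ac)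
  qed
  have "c * (\<Sum>i<n. (x i)\<^sup>2) = (\<Sum>i<n. \<Sum>j<n. cos_fourier (\<lambda>_. c) (int i - int j) * x i * x j)"
  proof -
    have "cos_fourier (\<lambda>_. c) m = (if m = 0 then c else 0)" for m
      using cos_fourier_delta[of m] unfolding cos_fourier_def by (simp split: if_splits)
    moreover have "(\<Sum>j<n. (if int i - int j = 0 then c else 0) * x i * x j) = c * (x i)\<^sup>2" if "i < n" for i
    proof -
      have "(\<Sum>j<n. (if int i - int j = 0 then c else 0) * x i * x j) = (\<Sum>j<n. if j = i then c * (x i)\<^sup>2 else 0)"
        by (intro sum.cong refl) (auto simp: power2_eq_square)
      then show ?thesis using that by simp
    qed
    ultimately show ?thesis by (simp add: sum_distrib_left)
  qed
  also have "\<dots> = 1 / pi * integral {0..pi} (\<lambda>t. c * S t)" by (rule int[symmetric]) auto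
  also have "\<dots> \<le> 1 / pi * integral {0..pi} (\<lambda>t. H_quot f t \<theta> * S t)"
  proof (intro mult_left_mono integral_le)
    show "(\<lambda>t. c * S t) integrable_on {0..pi}" "(\<lambda>t. H_quot f t \<theta> * S t) integrable_on {0..pi}"
      by (intro integrable_continuous_interval continuous_on_mult continuous_on_const Sc H_cont[OF \<theta>])+
    show "c * S t \<le> H_quot f t \<theta> * S t" if "t \<in> {0..pi}" for t
      by (intro mult_right_mono c that) (simp add: S)
  qed simp
  also have "\<dots> = (\<Sum>i<n. \<Sum>j<n. g \<theta> (int i - int j) * x i * x j)"
    unfolding g_def by (rule int[OF H_cont[OF \<theta>]])
  finally show ?thesis .
qed

lemma exists_toeplitz_data:
  obtains G B c c0 where "c > 0" "c0 > 0"
    "\<And>\<theta>. \<theta> \<in> {\<theta>1..\<theta>2} \<Longrightarrow> \<exists>d w W. toeplitz_data (g \<theta>) d \<theta> (rho f \<theta>) w G B c c0 W"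
proof -
  obtain M where M: "\<And>\<theta> k. \<theta> \<in> {\<theta>1..\<theta>2} \<Longrightarrow> \<bar>b \<theta> k\<bar> \<le> M / (1 + real k) ^ 3" by (rule b_decay) blast
  obtain m where m: "m > 0" "\<And>t \<theta>. \<theta> \<in> {\<theta>1..\<theta>2} \<Longrightarrow> \<bar>ln (H_quot f t \<theta>)\<bar> \<le> m"
    "\<And>t \<theta>. \<theta> \<in> {\<theta>1..\<theta>2} \<Longrightarrow> exp (ln (H_quot f t \<theta>)) = H_quot f t \<theta>" by (rule ln_H_bounded) blast
  obtain G where G: "\<And>\<theta>. \<theta> \<in> {\<theta>1..\<theta>2} \<Longrightarrow> summable (\<lambda>i. \<bar>g \<theta> (int i)\<bar>)"
    "\<And>\<theta>. \<theta> \<in> {\<theta>1..\<theta>2} \<Longrightarrow> (\<Sum>i. \<bar>g \<theta> (int i)\<bar>) \<le> G" by (rule g_abs_summable) blast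
  obtain \<sigma> R where rho: "\<And>\<theta>. \<theta> \<in> {\<theta>1..\<theta>2} \<Longrightarrow> rho f \<theta> = (\<Sum>k. - 2 * b \<theta> k * sin (real k * \<theta>))" by (rule rho_c11) blast
  have M0: "M \<ge> 0" using M[of \<theta>1 0] \<theta>12 by simp
  show thesis
  \<comment> \<open>With |ln H| \<le> m and |b k| \<le> M the values are c = exp(-m) \<le> H and B =
    exp(32 M). The one constant c0 = exp(-M - m) has to lie below both d 0 = exp(-b 0) \<ge> exp(-M)
    and w = H(\<theta>,\<theta>)^(-1/2) \<ge> exp(-m/2).\<close>
  proof (rule that[of "exp (- m)" "exp (- M - m)" G "exp (32 * M)"])
    fix \<theta> assume \<theta>: "\<theta> \<in> {\<theta>1..\<theta>2}"
    obtain d :: "nat \<Rightarrow> real" where d: "\<And>k. \<bar>d k\<bar> \<le> exp (32 * M) / (1 + real k) ^ 3"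
      "\<And>z::complex. norm z \<le> 1 \<Longrightarrow> (\<lambda>k. of_real (d k) * z ^ k) sums exp (\<Sum>k. of_real (- b \<theta> k) * z ^ k)"
    proof (rule exp_power_series[of "\<lambda>k. - b \<theta> k" M])
      show "\<bar>- b \<theta> k\<bar> \<le> M / (1 + real k) ^ 3" for k using M[OF \<theta>, of k] by simp
    qed blast
    \<comment> \<open>While d belongs to 1/D, the coefficients e belong to D itself; they enter only
      in the proof of orthogonality.\<close>
    obtain e :: "nat \<Rightarrow> real" where e: "\<And>k. \<bar>e k\<bar> \<le> exp (32 * M) / (1 + real k) ^ 3"
      "\<And>z::complex. norm z \<le> 1 \<Longrightarrow> (\<lambda>k. of_real (e k) * z ^ k) sums exp (\<Sum>k. of_real (b \<theta> k) * z ^ k)"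
      by (rule exp_power_series[OF M[OF \<theta>]]) blast
    define P where "P t = (\<Sum>k. complex_of_real (b \<theta> k) * cis t ^ k)" for t
    have bs: "summable (\<lambda>k. \<bar>b \<theta> k\<bar>)"
      by (rule summable_comparison_test[OF _ summable_mult[OF summable_inverse_cubes, of M]]) (use M[OF \<theta>] in auto)
    have Ps: "(\<lambda>k. complex_of_real (b \<theta> k) * cis t ^ k) sums P t" for t
    proof -
      have "summable (\<lambda>k. norm (complex_of_real (b \<theta> k) * cis t ^ k))" using bs by (simp add: norm_mult norm_power)
      then show ?thesis unfolding P_def by (rule summable_sums[OF summable_norm_cancel])
    qed
    have cis_Re: "Re (complex_of_real x * cis t ^ k) = x * cos (real k * t)" and cis_Im: "Im (complex_of_real x * cis t ^ k) = x * sin (real k * t)" for x t k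
      unfolding Complex.DeMoivre by simp_all
    have ReP: "Re (P t) = ln (H_quot f t \<theta>) / 2" for t
    proof -
      have "(\<lambda>k. 2 * (b \<theta> k * cos (real k * t))) sums (2 * Re (P t))"
        using sums_mult[OF sums_Re[OF Ps[of t]], of 2] unfolding cis_Re .
      moreover have "(\<lambda>k. 2 * (b \<theta> k * cos (real k * t))) sums ln (H_quot f t \<theta>)"
        using ln_H_series[OF \<theta>, of t] by (simp only: mult.assoc)
      ultimately have "2 * Re (P t) = ln (H_quot f t \<theta>)" by (rule sums_unique2)
      then show ?thesis by simp
    qed
    have ImP: "Im (P \<theta>) = - rho f \<theta> / 2"
    proof -
      have "(\<lambda>k. - 2 * (b \<theta> k * sin (real k * \<theta>))) sums (- 2 * Im (P \<theta>))"
        using sums_mult[OF sums_Im[OF Ps[of \<theta>]], of "- 2"] unfolding cis_Im .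
      then have "(\<Sum>k. - 2 * b \<theta> k * sin (real k * \<theta>)) = - 2 * Im (P \<theta>)" unfolding mult.assoc by (rule sums_unique[symmetric])
      then have "rho f \<theta> = - 2 * Im (P \<theta>)" unfolding rho[OF \<theta>] .
      then show ?thesis by simp
    qed
    have dP: "(\<lambda>k. complex_of_real (d k) * cis t ^ k) sums exp (- P t)" for t
    proof -
      have "(\<lambda>k. complex_of_real (- b \<theta> k) * cis t ^ k) sums (- P t)" using sums_minus[OF Ps[of t]] by simp
      then have "(\<Sum>k. complex_of_real (- b \<theta> k) * cis t ^ k) = - P t" by (rule sums_unique[symmetric])
      then show ?thesis using d(2)[of "cis t"] by simp
    qed
    have eP: "(\<lambda>k. complex_of_real (e k) * cis t ^ k) sums exp (P t)" for t
      using e(2)[of "cis t"] by (simp add: P_def)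
    have HP: "complex_of_real (H_quot f t \<theta>) = exp (P t) * exp (cnj (P t))" for t
    proof -
      have "complex_of_real (H_quot f t \<theta>) = exp (of_real (ln (H_quot f t \<theta>)))"
        using m(3)[OF \<theta>, of t] by (metis exp_of_real)
      also have "of_real (ln (H_quot f t \<theta>)) = P t + cnj (P t)" by (simp add: complex_eq_iff ReP)
      finally show ?thesis by (simp add: exp_add)
    qed
    have orth: "(\<lambda>l. g \<theta> (int k - int l) * d l) sums 0" if k: "k \<ge> 1" for k
    proof -
      \<comment> \<open>From H = D cnj D follows H z^k cnj(1/D) = z^k D. The real part of the left
        side, expanded in d, integrates to \<pi> times the series in question. The real part of the
        right side consists of the terms e j cos((k + j)t) with k + j \<ge> 1, which all integrate
        to zero.\<close>
      define v where "v t = Re (cis (real k * t) * exp (P t))" for t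
      have term_d: "Re (complex_of_real (H_quot f t \<theta>) * cis (real k * t) * cnj (complex_of_real (d l) * cis t ^ l))
          = d l * (H_quot f t \<theta> * cos (of_int (int k - int l) * t))" for t l
      proof -
        have "cnj (cis t ^ l) = cis (- (real l * t))" unfolding Complex.DeMoivre cis_cnj ..
        then have "complex_of_real (H_quot f t \<theta>) * cis (real k * t) * cnj (complex_of_real (d l) * cis t ^ l)
          = complex_of_real (d l * H_quot f t \<theta>) * (cis (real k * t) * cis (- (real l * t)))" by simp
        also have "cis (real k * t) * cis (- (real l * t)) = cis (of_int (int k - int l) * t)"
          by (simp add: cis_mult left_diff_distrib)
        finally have "complex_of_real (H_quot f t \<theta>) * cis (real k * t) * cnj (complex_of_real (d l) * cis t ^ l)
          = complex_of_real (d l * H_quot f t \<theta>) * cis (of_int (int k - int l) * t)" .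
        from arg_cong[OF this, of Re] show ?thesis by (simp only: Re_complex_of_real times_complex.sel complex_Re_of_int cis.sel Im_complex_of_real mult_zero_left diff_0_right mult.assoc)
      qed
      have term_e: "Re (cis (real k * t) * (complex_of_real (e j) * cis t ^ j)) = e j * cos (of_int (int k + int j) * t)" for t j
      proof -
        have "cis (real k * t) * (complex_of_real (e j) * cis t ^ j) = complex_of_real (e j) * (cis (real k * t) * cis (real j * t))"
          unfolding Complex.DeMoivre by simp
        also have "cis (real k * t) * cis (real j * t) = cis (of_int (int k + int j) * t)"
          by (simp add: cis_mult distrib_right)
        finally have "cis (real k * t) * (complex_of_real (e j) * cis t ^ j) = complex_of_real (e j) * cis (of_int (int k + int j) * t)" .
        from arg_cong[OF this, of Re] show ?thesis by (simp only: Re_complex_of_real times_complex.sel cis.sel Im_complex_of_real mult_zero_left diff_0_right)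
      qed
      have sv1: "(\<lambda>l. d l * (H_quot f t \<theta> * cos (of_int (int k - int l) * t))) sums v t" for t
      proof -
        have "(\<lambda>l. cnj (complex_of_real (d l) * cis t ^ l)) sums cnj (exp (- P t))" using dP[of t] unfolding sums_cnj .
        from sums_Re[OF sums_mult[OF this, of "complex_of_real (H_quot f t \<theta>) * cis (real k * t)"]]
        have "(\<lambda>l. d l * (H_quot f t \<theta> * cos (of_int (int k - int l) * t))) sums
            Re (complex_of_real (H_quot f t \<theta>) * cis (real k * t) * cnj (exp (- P t)))" unfolding term_d .
        moreover have E: "exp (cnj (P t)) * cnj (exp (- P t)) = 1"
          using arg_cong[OF exp_minus_inverse[of "P t"], of cnj] by (simp add: exp_cnj)
        have "exp (P t) * exp (cnj (P t)) * cis (real k * t) * cnj (exp (- P t))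
            = cis (real k * t) * exp (P t) * (exp (cnj (P t)) * cnj (exp (- P t)))" by (simp only: mult_ac)
        then have "complex_of_real (H_quot f t \<theta>) * cis (real k * t) * cnj (exp (- P t)) = cis (real k * t) * exp (P t)"
          unfolding HP E by (simp only: mult_1_right)
        ultimately show ?thesis unfolding v_def by (simp only:)
      qed
      have sv2: "(\<lambda>j. e j * cos (of_int (int k + int j) * t)) sums v t" for t
        using sums_Re[OF sums_mult[OF eP[of t], of "cis (real k * t)"]] unfolding term_e v_def .
      have cube: "summable (\<lambda>l. exp (32 * M) / (1 + real l) ^ 3 * K)" for K
        using summable_mult2[OF summable_mult[OF summable_inverse_cubes, of "exp (32 * M)"], of K] by simp
      have "(\<lambda>j. integral {0..pi} (\<lambda>t. e j * cos (of_int (int k + int j) * t))) sums integral {0..pi} (\<lambda>t. \<Sum>j. e j * cos (of_int (int k + int j) * t))"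
      proof (rule sums_integral_bounded(1)[OF _ _ cube[of 1]])
        show "\<bar>e j * cos (of_int (int k + int j) * t)\<bar> \<le> exp (32 * M) / (1 + real j) ^ 3 * 1" for j t
          unfolding abs_mult by (intro mult_mono e) auto
      qed (intro continuous_intros)
      moreover have "integral {0..pi} (\<lambda>t. e j * cos (of_int (int k + int j) * t)) = 0" for j
        using cos_fourier_delta[of "int k + int j"] k by simp
      ultimately have v0: "integral {0..pi} v = 0"
      proof -
        assume *: "(\<lambda>j. integral {0..pi} (\<lambda>t. e j * cos (of_int (int k + int j) * t))) sums integral {0..pi} (\<lambda>t. \<Sum>j. e j * cos (of_int (int k + int j) * t))"
          and **: "\<And>j. integral {0..pi} (\<lambda>t. e j * cos (of_int (int k + int j) * t)) = 0"
        have "(\<lambda>t. \<Sum>j. e j * cos (of_int (int k + int j) * t)) = v"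
          by (rule ext) (rule sums_unique[OF sv2, symmetric])
        with * show ?thesis unfolding ** by (simp add: sums_iff)
      qed
      have "(\<lambda>l. integral {0..pi} (\<lambda>t. d l * (H_quot f t \<theta> * cos (of_int (int k - int l) * t)))) sums
          integral {0..pi} (\<lambda>t. \<Sum>l. d l * (H_quot f t \<theta> * cos (of_int (int k - int l) * t)))"
      proof (rule sums_integral_bounded(1)[OF _ _ cube[of "exp m"]])
        show "continuous_on {0..pi} (\<lambda>t. d l * (H_quot f t \<theta> * cos (of_int (int k - int l) * t)))" for l
          by (intro continuous_intros H_cont[OF \<theta>])
        show "\<bar>d l * (H_quot f t \<theta> * cos (of_int (int k - int l) * t))\<bar> \<le> exp (32 * M) / (1 + real l) ^ 3 * exp m" for l t
        proof -
          have "\<bar>H_quot f t \<theta>\<bar> = exp (ln (H_quot f t \<theta>))" using m(3)[OF \<theta>, of t] by (metis abs_exp_cancel)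
          then have "\<bar>H_quot f t \<theta>\<bar> \<le> exp m" using m(2)[OF \<theta>, of t] by simp
          then have "\<bar>H_quot f t \<theta>\<bar> * \<bar>cos (of_int (int k - int l) * t)\<bar> \<le> exp m * 1" by (intro mult_mono) auto
          then show ?thesis unfolding abs_mult by (intro mult_mono d) auto
        qed
      qed
      also have "(\<lambda>t. \<Sum>l. d l * (H_quot f t \<theta> * cos (of_int (int k - int l) * t))) = v"
        by (rule ext) (rule sums_unique[OF sv1, symmetric])
      finally have "(\<lambda>l. integral {0..pi} (\<lambda>t. d l * (H_quot f t \<theta> * cos (of_int (int k - int l) * t)))) sums 0" using v0 by simp
      from sums_mult[OF this, of "1 / pi"]
      show ?thesis unfolding g_def cos_fourier_def by (simp add: mult_ac)
    qed
    have "toeplitz_data (g \<theta>) d \<theta> (rho f \<theta>) (exp (- ln (H_quot f \<theta> \<theta>) / 2)) G (exp (32 * M)) (exp (- m)) (exp (- M - m)) (exp (- P \<theta>))"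
    proof
      show "g \<theta> (- j) = g \<theta> j" for j unfolding g_def by (rule cos_fourier_minus)
      show "exp (- m) * (\<Sum>i<n. (x i)\<^sup>2) \<le> (\<Sum>i<n. \<Sum>j<n. g \<theta> (int i - int j) * x i * x j)" for n x
      proof (rule g_pos_def[OF \<theta>])
        fix t
        have "exp (- m) \<le> exp (ln (H_quot f t \<theta>))" using m(2)[OF \<theta>, of t] by simp
        then show "exp (- m) \<le> H_quot f t \<theta>" using m(3)[OF \<theta>, of t] by simp
      qed
      show "exp (- M - m) \<le> d 0"
      proof -
        have "complex_of_real (d 0) = exp (complex_of_real (- b \<theta> 0))"
          using d(2)[of 0] powser_sums_zero[of "\<lambda>k. complex_of_real (d k)"] powser_sums_zero[of "\<lambda>k. complex_of_real (- b \<theta> k)"]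
          by (simp add: sums_iff)
        then have "d 0 = exp (- b \<theta> 0)" by (metis exp_of_real of_real_eq_iff)
        moreover have "b \<theta> 0 \<le> M" using M[OF \<theta>, of 0] by simp
        ultimately show ?thesis using m(1) by simp
      qed
      show "exp (- M - m) \<le> exp (- ln (H_quot f \<theta> \<theta>) / 2)" using m(2)[OF \<theta>, of \<theta>] M0 m(1) by simp
      show "exp (- P \<theta>) = of_real (exp (- ln (H_quot f \<theta> \<theta>) / 2)) * cis (rho f \<theta> / 2)"
        unfolding exp_eq_polar[of "- P \<theta>"] by (simp add: ReP ImP)
    qed (use G[OF \<theta>] d(1) orth dP in auto)
    then show "\<exists>d w W. toeplitz_data (g \<theta>) d \<theta> (rho f \<theta>) w G (exp (32 * M)) (exp (- m)) (exp (- M - m)) W" by blast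
  qed auto
qed

section \<open>Eigenvalues and the phase condition\<close>

text \<open>A real eigenvector is enough because T_N(f) is a real matrix for even f;
  \<open>eigenvalue_toeplitz_iff\<close> makes the link with the complex matrix.\<close>

definition toeplitz_eig :: "nat \<Rightarrow> real \<Rightarrow> bool" where
  "toeplitz_eig N \<mu> \<longleftrightarrow> (\<exists>x. (\<exists>i\<le>N. x i \<noteq> 0) \<and>
     (\<forall>k\<le>N. (\<Sum>l\<le>N. cos_fourier f (int k - int l) * x l) = \<mu> * x k))"

lemma f_diff_eq:
  assumes "t \<in> {0..pi}" "\<theta> \<in> {\<theta>1..\<theta>2}"
  shows "f t - f \<theta> = (cos \<theta> - cos t) * H_quot f t \<theta>"
proof -
  have U: "(t, \<theta>) \<in> U" using box_subset_U assms by auto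
  then have "den (t, \<theta>) \<noteq> 0" by (auto simp: U_def)
  then show ?thesis unfolding H_quot_eq[OF U] num_eq[symmetric] den_eq[symmetric] by simp
qed

text \<open>This is f - f(\<theta>) = (cos \<theta> - cos t) H read off on Fourier coefficients,
  where multiplication by cos t averages the two neighbours.\<close>

lemma cos_fourier_shift:
  assumes \<theta>: "\<theta> \<in> {\<theta>1..\<theta>2}"
  shows "cos_fourier f j - f \<theta> * (if j = 0 then 1 else 0) = cos \<theta> * g \<theta> j - (g \<theta> (j - 1) + g \<theta> (j + 1)) / 2"
proof -
  let ?I = "\<lambda>h. integral {0..pi} h"
  have io: "h integrable_on {0..pi}" if "continuous_on {0..pi} h" for h :: "real \<Rightarrow> real"
    by (rule integrable_continuous_interval[OF that])
  have c: "continuous_on {0..pi} (\<lambda>t. cos (of_int m * t))" for m by (intro continuous_intros)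
  note cH = continuous_on_mult[OF H_cont[OF \<theta>] c]
  have "?I (\<lambda>t. f t * cos (of_int j * t)) - ?I (\<lambda>t. f \<theta> * cos (of_int j * t)) = ?I (\<lambda>t. f t * cos (of_int j * t) - f \<theta> * cos (of_int j * t))"
    by (rule integral_diff[symmetric]) (intro io continuous_on_mult f_cont c continuous_on_const)+
  also have "\<dots> = ?I (\<lambda>t. cos \<theta> * (H_quot f t \<theta> * cos (of_int j * t)) -
      (1 / 2) * (H_quot f t \<theta> * cos (of_int (j - 1) * t) + H_quot f t \<theta> * cos (of_int (j + 1) * t)))"
  proof (rule integral_cong)
    fix t assume t: "t \<in> {0..pi}"
    have "cos (of_int (j - 1) * t) + cos (of_int (j + 1) * t) = 2 * (cos t * cos (of_int j * t))"
      by (simp add: left_diff_distrib distrib_right cos_add cos_diff)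
    then have "(1 / 2) * (H_quot f t \<theta> * cos (of_int (j - 1) * t) + H_quot f t \<theta> * cos (of_int (j + 1) * t))
       = H_quot f t \<theta> * (cos t * cos (of_int j * t))"
      unfolding distrib_left[symmetric] by simp
    then show "f t * cos (of_int j * t) - f \<theta> * cos (of_int j * t) = cos \<theta> * (H_quot f t \<theta> * cos (of_int j * t)) -
      (1 / 2) * (H_quot f t \<theta> * cos (of_int (j - 1) * t) + H_quot f t \<theta> * cos (of_int (j + 1) * t))"
      unfolding left_diff_distrib[symmetric] f_diff_eq[OF t \<theta>] by (simp add: algebra_simps)
  qed
  also have "\<dots> = cos \<theta> * ?I (\<lambda>t. H_quot f t \<theta> * cos (of_int j * t)) -
      (1 / 2) * (?I (\<lambda>t. H_quot f t \<theta> * cos (of_int (j - 1) * t)) + ?I (\<lambda>t. H_quot f t \<theta> * cos (of_int (j + 1) * t)))"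
  proof (rule integral_unique)
    have hi: "((\<lambda>t. H_quot f t \<theta> * cos (of_int m * t)) has_integral ?I (\<lambda>t. H_quot f t \<theta> * cos (of_int m * t))) {0..pi}" for m
      by (rule integrable_integral[OF io[OF cH]])
    show "((\<lambda>t. cos \<theta> * (H_quot f t \<theta> * cos (of_int j * t)) -
      (1 / 2) * (H_quot f t \<theta> * cos (of_int (j - 1) * t) + H_quot f t \<theta> * cos (of_int (j + 1) * t))) has_integral
      cos \<theta> * ?I (\<lambda>t. H_quot f t \<theta> * cos (of_int j * t)) -
      (1 / 2) * (?I (\<lambda>t. H_quot f t \<theta> * cos (of_int (j - 1) * t)) + ?I (\<lambda>t. H_quot f t \<theta> * cos (of_int (j + 1) * t)))) {0..pi}"
      by (intro has_integral_diff has_integral_mult_right has_integral_add hi)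
  qed
  finally have eq: "?I (\<lambda>t. f t * cos (of_int j * t)) - ?I (\<lambda>t. f \<theta> * cos (of_int j * t)) = cos \<theta> * ?I (\<lambda>t. H_quot f t \<theta> * cos (of_int j * t)) -
      (1 / 2) * (?I (\<lambda>t. H_quot f t \<theta> * cos (of_int (j - 1) * t)) + ?I (\<lambda>t. H_quot f t \<theta> * cos (of_int (j + 1) * t)))" .
  have "?I (\<lambda>t. f \<theta> * cos (of_int j * t)) = f \<theta> * ?I (\<lambda>t. cos (of_int j * t))" by simp
  then have d: "1 / pi * ?I (\<lambda>t. f \<theta> * cos (of_int j * t)) = f \<theta> * (if j = 0 then 1 else 0)"
    unfolding cos_fourier_delta[symmetric] by simp
  show ?thesis
    using arg_cong[OF eq, of "\<lambda>z. 1 / pi * z"] unfolding right_diff_distrib d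
    unfolding g_def cos_fourier_def by (simp add: algebra_simps add_divide_distrib)
qed

lemma toeplitz_residual:
  assumes \<theta>: "\<theta> \<in> {\<theta>1..\<theta>2}" and k: "k \<le> N"
  shows "(\<Sum>l\<le>N. cos_fourier f (int k - int l) * x l) - f \<theta> * x k
     = (\<Sum>l\<le>N. (cos \<theta> * g \<theta> (int k - int l) - (g \<theta> (int k - int l - 1) + g \<theta> (int k - int l + 1)) / 2) * x l)"
proof -
  have "f \<theta> * x k = (\<Sum>l\<le>N. f \<theta> * (if int k - int l = 0 then 1 else 0) * x l)"
  proof -
    have "(\<Sum>l\<le>N. f \<theta> * (if int k - int l = 0 then 1 else 0) * x l) = (\<Sum>l\<le>N. if l = k then f \<theta> * x k else 0)"
      by (intro sum.cong refl) auto
    then show ?thesis using k by simp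
  qed
  then show ?thesis
    unfolding cos_fourier_shift[OF \<theta>, symmetric] left_diff_distrib sum_subtractf by simp
qed

lemma phase_bound:
  obtains C where "C > 0"
    "eventually (\<lambda>N. \<forall>\<theta>\<in>{\<theta>1..\<theta>2}. toeplitz_eig N (f \<theta>) \<longrightarrow> \<bar>sin ((real N + 2) * \<theta> - rho f \<theta>)\<bar> \<le> C / (real N + 2)\<^sup>2) sequentially"
proof -
  obtain G B c c0 where cc: "c > 0" "c0 > 0"
    and td: "\<And>\<theta>. \<theta> \<in> {\<theta>1..\<theta>2} \<Longrightarrow> \<exists>d w W. toeplitz_data (g \<theta>) d \<theta> (rho f \<theta>) w G B c c0 W"
    by (rule exists_toeplitz_data) blast
  have "\<theta>1 \<in> {\<theta>1..\<theta>2}" using \<theta>12 by simp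
  from td[OF this] obtain d w W where "toeplitz_data (g \<theta>1) d \<theta>1 (rho f \<theta>1) w G B c c0 W" by blast
  then have BG: "B \<ge> 0" "G \<ge> 0" by (rule toeplitz_data.B_nonneg, rule toeplitz_data.G_nonneg)
  define K where "K = (2 * B + 2 * B * G / c) / c0"
  have K0: "K \<ge> 0" unfolding K_def using BG cc by simp
  have "eventually (\<lambda>N. B / (real N + 2) < c0 / 2) sequentially" "eventually (\<lambda>N. K / (real N + 2) < 1 / 2) sequentially"
    using cc by (intro eventually_small; simp)+
  then have ev: "eventually (\<lambda>N. \<forall>\<theta>\<in>{\<theta>1..\<theta>2}. toeplitz_eig N (f \<theta>) \<longrightarrow> \<bar>sin ((real N + 2) * \<theta> - rho f \<theta>)\<bar> \<le> 2 * K / (real N + 2)\<^sup>2) sequentially"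
  proof eventually_elim
    case (elim N)
    define n where "n = N + 2"
    have n: "real n = real N + 2" "n \<ge> 1" by (simp_all add: n_def)
    have n3: "B / real n ^ 3 \<le> c0 / 2"
    proof -
      have "B / real n ^ 3 \<le> B / real n ^ 1" using BG n(2) by (intro divide_left_mono power_increasing) auto
      also have "\<dots> = B / (real N + 2)" by (simp add: n)
      also have "\<dots> \<le> c0 / 2" by (rule less_imp_le[OF elim(1)])
      finally show ?thesis .
    qed
    have n2: "K / (real n)\<^sup>2 \<le> 1 / 2"
    proof -
      have "K / (real n)\<^sup>2 \<le> K / real n ^ 1" using K0 n(2) by (intro divide_left_mono power_increasing) auto
      also have "\<dots> = K / (real N + 2)" by (simp add: n)
      also have "\<dots> \<le> 1 / 2" by (rule less_imp_le[OF elim(2)])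
      finally show ?thesis .
    qed
    show ?case
    proof (intro ballI impI)
      fix \<theta> assume \<theta>: "\<theta> \<in> {\<theta>1..\<theta>2}" and "toeplitz_eig N (f \<theta>)"
      then obtain x where x: "\<exists>i\<le>N. x i \<noteq> 0"
        and eq: "\<And>k. k \<le> N \<Longrightarrow> (\<Sum>l\<le>N. cos_fourier f (int k - int l) * x l) = f \<theta> * x k"
        unfolding toeplitz_eig_def by blast
      from td[OF \<theta>] obtain d w W where "toeplitz_data (g \<theta>) d \<theta> (rho f \<theta>) w G B c c0 W" by blast
      then interpret toeplitz_data "g \<theta>" d \<theta> "rho f \<theta>" w G B c c0 W .
      \<comment> \<open>Extension by zero, so that multiplication by the quadratic may produce the
        degrees N + 1 and N + 2.\<close>
      define p where "p l = (if l \<le> N then x l else 0)" for l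
      have p0: "p l = 0" if "l > N" for l using that by (simp add: p_def)
      have "\<bar>sin (real n * \<theta> - rho f \<theta>)\<bar> \<le> 2 * K / (real n)\<^sup>2"
      proof (rule phase_estimate[OF n(2) _ _ _ K_def n3 n2])
        show "\<exists>l\<le>n. quad_mult (cos \<theta>) p l \<noteq> 0"
        proof (rule ccontr)
          assume "\<not> (\<exists>l\<le>n. quad_mult (cos \<theta>) p l \<noteq> 0)"
          then have z: "quad_mult (cos \<theta>) p l = 0" if "l \<le> N + 2" for l using that by (simp add: n_def)
          from x obtain i where i: "i \<le> N" "x i \<noteq> 0" by blast
          from quad_mult_eq_0_imp[OF z i(1)] i show False by (simp add: p_def)
        qed
        show "(\<Sum>l\<le>n. of_real (quad_mult (cos \<theta>) p l) * cis \<theta> ^ l) = 0"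
          unfolding n_def by (rule quad_mult_cis[OF p0])
        fix k assume k: "1 \<le> k" "k < n"
        then obtain k' where k': "k = k' + 1" "k' \<le> N" by (cases k) (auto simp: n_def)
        have "(\<Sum>l\<le>N. (cos \<theta> * g \<theta> (int k' - int l) - (g \<theta> (int k' - int l - 1) + g \<theta> (int k' - int l + 1)) / 2) * p l)
            = (\<Sum>l\<le>N. (cos \<theta> * g \<theta> (int k' - int l) - (g \<theta> (int k' - int l - 1) + g \<theta> (int k' - int l + 1)) / 2) * x l)"
          by (intro sum.cong refl) (simp add: p_def)
        also have "\<dots> = 0" using toeplitz_residual[OF \<theta> k'(2), of x] eq[OF k'(2)] by simp
        finally show "(\<Sum>l\<le>n. g \<theta> (int k - int l) * quad_mult (cos \<theta>) p l) = 0"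
          using toeplitz_quad_mult[where p = p and N = N and x = "cos \<theta>" and g = "g \<theta>" and k = k', OF p0] unfolding n_def k'(1) by simp
      qed
      then show "\<bar>sin ((real N + 2) * \<theta> - rho f \<theta>)\<bar> \<le> 2 * K / (real N + 2)\<^sup>2" unfolding n .
    qed
  qed
  show thesis
  \<comment> \<open>Since \<open>K\<close> may be zero, 1 is added to obtain a positive
    constant.\<close>
  proof (rule that[of "2 * K + 1"])
    show "2 * K + 1 > 0" using K0 by simp
    from ev show "eventually (\<lambda>N. \<forall>\<theta>\<in>{\<theta>1..\<theta>2}. toeplitz_eig N (f \<theta>) \<longrightarrow> \<bar>sin ((real N + 2) * \<theta> - rho f \<theta>)\<bar> \<le> (2 * K + 1) / (real N + 2)\<^sup>2) sequentially"
    proof eventually_elim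
      case (elim N)
      have "2 * K / (real N + 2)\<^sup>2 \<le> (2 * K + 1) / (real N + 2)\<^sup>2" by (intro divide_right_mono) auto
      with elim show ?case by (meson order_trans)
    qed
  qed
qed

text \<open>Each entry of the residual is O(n^(-2)) and there are N + 1 of them, so its norm is
  O(n^(-3/2)), while the first coefficient keeps the norm of the quasi-mode above c0/2. The exponent
  matters only in being larger than 1.\<close>

lemma quasi_mode_eig:
  obtains C where "C > 0"
    "eventually (\<lambda>N. \<forall>\<theta>\<in>{\<theta>1..\<theta>2}. sin ((real N + 2) * \<theta> - rho f \<theta>) = 0 \<longrightarrow>
       (\<exists>\<mu>. toeplitz_eig N \<mu> \<and> \<bar>\<mu> - f \<theta>\<bar> \<le> C / ((real N + 2) * sqrt (real N + 2)))) sequentially"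
proof -
  obtain G B c c0 where cc: "c > 0" "c0 > 0"
    and td: "\<And>\<theta>. \<theta> \<in> {\<theta>1..\<theta>2} \<Longrightarrow> \<exists>d w W. toeplitz_data (g \<theta>) d \<theta> (rho f \<theta>) w G B c c0 W"
    by (rule exists_toeplitz_data) blast
  have "\<theta>1 \<in> {\<theta>1..\<theta>2}" using \<theta>12 by simp
  from td[OF this] obtain d w W where "toeplitz_data (g \<theta>1) d \<theta>1 (rho f \<theta>1) w G B c c0 W" by blast
  then have BG: "B \<ge> 0" "G \<ge> 0" by (rule toeplitz_data.B_nonneg, rule toeplitz_data.G_nonneg)
  \<comment> \<open>On an interval inside [0, \<pi>] the sine is smallest at an end point.\<close>
  define s0 where "s0 = min (sin \<theta>1) (sin \<theta>2)"
  have s0: "s0 > 0" unfolding s0_def using \<theta>1 \<theta>12 \<theta>2 by (auto intro!: sin_gt_zero)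
  have sin_ge: "s0 \<le> sin \<theta>" if \<theta>: "\<theta> \<in> {\<theta>1..\<theta>2}" for \<theta>
  proof (cases "\<theta> \<le> pi / 2")
    case True
    then have "sin \<theta>1 \<le> sin \<theta>" using \<theta> \<theta>1 by (intro sin_monotone_2pi_le) auto
    then show ?thesis by (simp add: s0_def)
  next
    case False
    have "sin (pi - \<theta>2) \<le> sin (pi - \<theta>)" using \<theta> \<theta>2 False by (intro sin_monotone_2pi_le) auto
    then show ?thesis by (simp add: s0_def)
  qed
  define K where "K = B * G + 4 * B * G / s0"
  have K0: "K \<ge> 0" unfolding K_def using BG s0 by simp
  define C where "C = 2 * K / c0"
  have "eventually (\<lambda>N. B / (real N + 2) < c0 / 2) sequentially" "eventually (\<lambda>N::nat. N \<ge> 1) sequentially"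
    using cc by (auto intro!: eventually_small eventually_ge_at_top)
  then have ev: "eventually (\<lambda>N. \<forall>\<theta>\<in>{\<theta>1..\<theta>2}. sin ((real N + 2) * \<theta> - rho f \<theta>) = 0 \<longrightarrow>
       (\<exists>\<mu>. toeplitz_eig N \<mu> \<and> \<bar>\<mu> - f \<theta>\<bar> \<le> C / ((real N + 2) * sqrt (real N + 2)))) sequentially"
  proof eventually_elim
    case (elim N)
    define n where "n = N + 2"
    have n: "real n = real N + 2" "n \<ge> 1" by (simp_all add: n_def)
    have n3: "B / real n ^ 3 \<le> c0 / 2"
    proof -
      have "B / real n ^ 3 \<le> B / real n ^ 1" using BG n(2) by (intro divide_left_mono power_increasing) auto
      also have "\<dots> = B / (real N + 2)" by (simp add: n)
      also have "\<dots> \<le> c0 / 2" by (rule less_imp_le[OF elim(1)])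
      finally show ?thesis .
    qed
    show ?case
    proof (intro ballI impI)
      fix \<theta> assume \<theta>: "\<theta> \<in> {\<theta>1..\<theta>2}" and ph: "sin ((real N + 2) * \<theta> - rho f \<theta>) = 0"
      from td[OF \<theta>] obtain d w W where "toeplitz_data (g \<theta>) d \<theta> (rho f \<theta>) w G B c c0 W" by blast
      then interpret toeplitz_data "g \<theta>" d \<theta> "rho f \<theta>" w G B c c0 W .
      obtain p where p: "c0 / 2 \<le> p 0"
        and res: "\<And>k. k \<le> N \<Longrightarrow> \<bar>\<Sum>l\<le>N. (cos \<theta> * g \<theta> (int k - int l) - (g \<theta> (int k - int l - 1) + g \<theta> (int k - int l + 1)) / 2) * p l\<bar>
         \<le> K / (real n)\<^sup>2"
        using quasi_mode[OF elim(2) n_def _ s0 sin_ge[OF \<theta>] n3] ph unfolding n K_def by blast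
      define r where "r = C / (real n * sqrt (real n))"
      have r0: "r \<ge> 0" unfolding r_def C_def using K0 cc by simp
      have "\<exists>\<mu> y. \<bar>\<mu> - f \<theta>\<bar> \<le> r \<and> (\<exists>i<N + 1. y i \<noteq> 0) \<and> (\<forall>i<N + 1. (\<Sum>j<N + 1. cos_fourier f (int i - int j) * y j) = \<mu> * y i)"
      proof (rule symmetric_approx_eigenvalue[OF _ _ r0, where x = p])
        show "cos_fourier f (int i - int j) = cos_fourier f (int j - int i)" for i j
          using cos_fourier_minus[of f "int i - int j"] by simp
        show "\<exists>i<N + 1. p i \<noteq> 0" using p cc by (intro exI[of _ 0]) auto
        \<comment> \<open>At most n terms of size (K/n^2)^2 give K^2/n^3, which equals r^2 (c0/2)^2;
          this is where C = 2K/c0 comes from.\<close>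
        have "(\<Sum>i<N + 1. ((\<Sum>j<N + 1. cos_fourier f (int i - int j) * p j) - f \<theta> * p i)\<^sup>2) \<le> (\<Sum>i<N + 1. (K / (real n)\<^sup>2)\<^sup>2)"
        proof (rule sum_mono)
          fix i assume "i \<in> {..<N + 1}"
          then have i: "i \<le> N" by simp
          have "{..<N + 1} = {..N}" by auto
          then have "\<bar>(\<Sum>j<N + 1. cos_fourier f (int i - int j) * p j) - f \<theta> * p i\<bar> \<le> K / (real n)\<^sup>2"
            using res[OF i] toeplitz_residual[OF \<theta> i, of p] by simp
          from power_mono[OF this abs_ge_zero, of 2]
          show "((\<Sum>j<N + 1. cos_fourier f (int i - int j) * p j) - f \<theta> * p i)\<^sup>2 \<le> (K / (real n)\<^sup>2)\<^sup>2"
            by (simp only: power2_abs)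
        qed
        also have "\<dots> \<le> real n * (K / (real n)\<^sup>2)\<^sup>2"
          by (simp add: n_def mult_right_mono)
        also have "\<dots> = r\<^sup>2 * (c0 / 2)\<^sup>2"
        proof -
          have "x * (K / x\<^sup>2)\<^sup>2 = (K / (x * sqrt x))\<^sup>2" if "x > 0" for x :: real
          proof -
            have "x * (K / x\<^sup>2)\<^sup>2 = x * (K\<^sup>2 / (x * (x\<^sup>2 * x)))" by (simp add: power_divide power2_eq_square)
            also have "\<dots> = K\<^sup>2 / (x\<^sup>2 * x)" using that by simp
            also have "\<dots> = (K / (x * sqrt x))\<^sup>2" using that by (simp add: power_divide power_mult_distrib)
            finally show ?thesis .
          qed
          moreover have "r * (c0 / 2) = K / (real n * sqrt (real n))" unfolding r_def C_def using cc by simp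
          ultimately show ?thesis unfolding power_mult_distrib[symmetric] using n(2) by simp
        qed
        also have "\<dots> \<le> r\<^sup>2 * (\<Sum>i<N + 1. (p i)\<^sup>2)"
        proof (rule mult_left_mono)
          have "(c0 / 2)\<^sup>2 \<le> (p 0)\<^sup>2" using p cc by (intro power_mono) auto
          also have "\<dots> \<le> (\<Sum>i<N + 1. (p i)\<^sup>2)" by (rule member_le_sum) auto
          finally show "(c0 / 2)\<^sup>2 \<le> (\<Sum>i<N + 1. (p i)\<^sup>2)" .
        qed simp
        finally show "(\<Sum>i<N + 1. ((\<Sum>j<N + 1. cos_fourier f (int i - int j) * p j) - f \<theta> * p i)\<^sup>2) \<le> r\<^sup>2 * (\<Sum>i<N + 1. (p i)\<^sup>2)" .
      qed
      then obtain \<mu> y where \<mu>: "\<bar>\<mu> - f \<theta>\<bar> \<le> r" and y: "\<exists>i<N + 1. y i \<noteq> 0"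
        "\<forall>i<N + 1. (\<Sum>j<N + 1. cos_fourier f (int i - int j) * y j) = \<mu> * y i" by blast
      have "toeplitz_eig N \<mu>"
        using y unfolding toeplitz_eig_def Suc_eq_plus1[symmetric] less_Suc_eq_le lessThan_Suc_atMost by blast
      then show "\<exists>\<mu>. toeplitz_eig N \<mu> \<and> \<bar>\<mu> - f \<theta>\<bar> \<le> C / ((real N + 2) * sqrt (real N + 2))"
        using \<mu> unfolding r_def n(1) by blast
    qed
  qed
  show thesis
  proof (rule that[of "C + 1"])
    show "C + 1 > 0" unfolding C_def using K0 cc by (simp add: add_nonneg_pos)
    from ev show "eventually (\<lambda>N. \<forall>\<theta>\<in>{\<theta>1..\<theta>2}. sin ((real N + 2) * \<theta> - rho f \<theta>) = 0 \<longrightarrow>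
       (\<exists>\<mu>. toeplitz_eig N \<mu> \<and> \<bar>\<mu> - f \<theta>\<bar> \<le> (C + 1) / ((real N + 2) * sqrt (real N + 2)))) sequentially"
    proof eventually_elim
      case (elim N)
      have "C / ((real N + 2) * sqrt (real N + 2)) \<le> (C + 1) / ((real N + 2) * sqrt (real N + 2))" by (intro divide_right_mono) auto
      with elim show ?case by (meson order_trans)
    qed
  qed
qed

text \<open>The combination of the two eigenvectors with vanishing last entry is an approximate eigenvector of the
  smaller matrix.\<close>

lemma interlacing:
  assumes "toeplitz_eig (Suc N) \<mu>" "toeplitz_eig (Suc N) \<mu>'" "\<mu> \<noteq> \<mu>'"
  shows "\<exists>\<nu>. toeplitz_eig N \<nu> \<and> \<bar>\<nu> - \<mu>\<bar> \<le> \<bar>\<mu>' - \<mu>\<bar>"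
proof -
  define a where "a i j = cos_fourier f (int i - int j)" for i j :: nat
  have a_sym: "a i j = a j i" for i j unfolding a_def using cos_fourier_minus[of f "int i - int j"] by simp
  obtain v where v: "\<exists>i\<le>Suc N. v i \<noteq> 0" "\<And>k. k \<le> Suc N \<Longrightarrow> (\<Sum>l\<le>Suc N. a k l * v l) = \<mu> * v k"
    using assms(1) unfolding toeplitz_eig_def a_def by blast
  obtain v' where v': "\<exists>i\<le>Suc N. v' i \<noteq> 0" "\<And>k. k \<le> Suc N \<Longrightarrow> (\<Sum>l\<le>Suc N. a k l * v' l) = \<mu>' * v' k"
    using assms(2) unfolding toeplitz_eig_def a_def by blast
  have pos: "(\<Sum>i\<le>Suc N. (u i)\<^sup>2) > 0" if "\<exists>i\<le>Suc N. u i \<noteq> 0" for u :: "nat \<Rightarrow> real"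
  proof -
    from that obtain i where "i \<le> Suc N" "u i \<noteq> 0" by auto
    then show ?thesis by (intro sum_pos2[where i = i]) auto
  qed
  have orth: "(\<Sum>i\<le>Suc N. v i * v' i) = 0"
  proof -
    have "\<mu> * (\<Sum>i\<le>Suc N. v i * v' i) = (\<Sum>i\<le>Suc N. (\<Sum>l\<le>Suc N. a i l * v l) * v' i)"
      unfolding sum_distrib_left by (intro sum.cong refl) (simp add: v(2) del: sum.atMost_Suc)
    also have "\<dots> = (\<Sum>i\<le>Suc N. \<Sum>l\<le>Suc N. a i l * v l * v' i)" by (simp only: sum_distrib_right)
    also have "\<dots> = (\<Sum>l\<le>Suc N. \<Sum>i\<le>Suc N. a i l * v l * v' i)" by (rule sum.swap)
    also have "\<dots> = (\<Sum>l\<le>Suc N. v l * (\<Sum>i\<le>Suc N. a l i * v' i))"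
      unfolding sum_distrib_left by (intro sum.cong refl) (simp add: a_sym mult_ac)
    also have "\<dots> = (\<Sum>l\<le>Suc N. \<mu>' * (v l * v' l))"
      by (intro sum.cong refl) (simp add: v'(2) del: sum.atMost_Suc)
    also have "\<dots> = \<mu>' * (\<Sum>i\<le>Suc N. v i * v' i)" by (rule sum_distrib_left[symmetric])
    finally show ?thesis using assms(3) by simp
  qed
  \<comment> \<open>A vector with last entry zero has, in the smaller matrix, a residual that is
    part of its residual in the larger one.\<close>
  have main: "\<exists>\<nu>. toeplitz_eig N \<nu> \<and> \<bar>\<nu> - \<mu>\<bar> \<le> \<bar>\<mu>' - \<mu>\<bar>"
    if w: "w (Suc N) = 0" "\<exists>i\<le>Suc N. w i \<noteq> 0"
      and le: "(\<Sum>i\<le>Suc N. ((\<Sum>j\<le>Suc N. a i j * w j) - \<mu> * w i)\<^sup>2) \<le> (\<mu>' - \<mu>)\<^sup>2 * (\<Sum>i\<le>Suc N. (w i)\<^sup>2)" for w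
  proof -
    have e: "{..<Suc N} = {..N}" by auto
    have "\<exists>\<nu> y. \<bar>\<nu> - \<mu>\<bar> \<le> \<bar>\<mu>' - \<mu>\<bar> \<and> (\<exists>i<Suc N. y i \<noteq> 0) \<and> (\<forall>i<Suc N. (\<Sum>j<Suc N. a i j * y j) = \<nu> * y i)"
    proof (rule symmetric_approx_eigenvalue[where x = w])
      show "\<exists>i<Suc N. w i \<noteq> 0" using w by (metis le_Suc_eq less_Suc_eq_le)
      have "(\<Sum>i\<le>N. ((\<Sum>j\<le>N. a i j * w j) - \<mu> * w i)\<^sup>2) \<le> (\<Sum>i\<le>Suc N. ((\<Sum>j\<le>Suc N. a i j * w j) - \<mu> * w i)\<^sup>2)"
        using w(1) by simp
      also have "\<dots> \<le> \<bar>\<mu>' - \<mu>\<bar>\<^sup>2 * (\<Sum>i\<le>N. (w i)\<^sup>2)" using le w(1) by simp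
      finally show "(\<Sum>i<Suc N. ((\<Sum>j<Suc N. a i j * w j) - \<mu> * w i)\<^sup>2) \<le> \<bar>\<mu>' - \<mu>\<bar>\<^sup>2 * (\<Sum>i<Suc N. (w i)\<^sup>2)"
        unfolding e .
    qed (use a_sym in auto)
    then show ?thesis unfolding e toeplitz_eig_def a_def less_Suc_eq_le by blast
  qed
  show ?thesis
  proof (cases "v (Suc N) = 0 \<and> v' (Suc N) = 0")
    case True
    have "(\<Sum>i\<le>Suc N. ((\<Sum>j\<le>Suc N. a i j * v j) - \<mu> * v i)\<^sup>2) = 0"
      by (rule sum.neutral) (simp add: v(2) del: sum.atMost_Suc)
    moreover have "0 \<le> (\<mu>' - \<mu>)\<^sup>2 * (\<Sum>i\<le>Suc N. (v i)\<^sup>2)" by (intro mult_nonneg_nonneg sum_nonneg) auto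
    ultimately show ?thesis using main[of v] True v(1) by simp
  next
    case False
    define w where "w i = v' (Suc N) * v i - v (Suc N) * v' i" for i
    have sq: "(\<Sum>i\<le>Suc N. (w i)\<^sup>2) = (v' (Suc N))\<^sup>2 * (\<Sum>i\<le>Suc N. (v i)\<^sup>2) + (v (Suc N))\<^sup>2 * (\<Sum>i\<le>Suc N. (v' i)\<^sup>2)"
    proof -
      have "(\<Sum>i\<le>Suc N. (w i)\<^sup>2) = (v' (Suc N))\<^sup>2 * (\<Sum>i\<le>Suc N. (v i)\<^sup>2) + (v (Suc N))\<^sup>2 * (\<Sum>i\<le>Suc N. (v' i)\<^sup>2)
          - 2 * v (Suc N) * v' (Suc N) * (\<Sum>i\<le>Suc N. v i * v' i)"
        unfolding sum_distrib_left sum.distrib[symmetric] sum_subtractf[symmetric]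
        by (intro sum.cong refl) (simp add: w_def power2_eq_square algebra_simps)
      then show ?thesis unfolding orth by simp
    qed
    \<comment> \<open>Relative to \<mu> the v-component of w contributes nothing. The v'-component
      is multiplied by \<mu>' - \<mu>, and by orthogonality it is no longer than w, so the residual
      is at most |\<mu>' - \<mu>| times the norm of w.\<close>
    have "(\<Sum>j\<le>Suc N. a i j * w j) - \<mu> * w i = - (v (Suc N) * ((\<mu>' - \<mu>) * v' i))" if "i \<le> Suc N" for i
    proof -
      have "(\<Sum>j\<le>Suc N. a i j * w j) = v' (Suc N) * (\<Sum>j\<le>Suc N. a i j * v j) - v (Suc N) * (\<Sum>j\<le>Suc N. a i j * v' j)"
        unfolding sum_distrib_left sum_subtractf[symmetric]
        by (intro sum.cong refl) (simp add: w_def algebra_simps)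
      then show ?thesis unfolding v(2)[OF that] v'(2)[OF that] by (simp add: w_def algebra_simps)
    qed
    then have "(\<Sum>i\<le>Suc N. ((\<Sum>j\<le>Suc N. a i j * w j) - \<mu> * w i)\<^sup>2) = (\<Sum>i\<le>Suc N. (v (Suc N) * ((\<mu>' - \<mu>) * v' i))\<^sup>2)"
      by (intro sum.cong refl) (simp del: sum.atMost_Suc)
    also have "\<dots> = (\<mu>' - \<mu>)\<^sup>2 * ((v (Suc N))\<^sup>2 * (\<Sum>i\<le>Suc N. (v' i)\<^sup>2))"
      unfolding sum_distrib_left by (intro sum.cong refl) (simp add: power_mult_distrib)
    also have "\<dots> \<le> (\<mu>' - \<mu>)\<^sup>2 * (\<Sum>i\<le>Suc N. (w i)\<^sup>2)"
      unfolding sq using less_imp_le[OF pos[OF v(1)]] by (intro mult_left_mono) auto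
    finally have le: "(\<Sum>i\<le>Suc N. ((\<Sum>j\<le>Suc N. a i j * w j) - \<mu> * w i)\<^sup>2) \<le> (\<mu>' - \<mu>)\<^sup>2 * (\<Sum>i\<le>Suc N. (w i)\<^sup>2)" .
    have "(\<Sum>i\<le>Suc N. (w i)\<^sup>2) > 0"
      unfolding sq using False pos[OF v(1)] pos[OF v'(1)]
      by (smt (verit) mult_pos_pos mult_nonneg_nonneg zero_le_power2 zero_less_power2)
    then have "\<exists>i\<le>Suc N. w i \<noteq> 0"
      by (rule contrapos_pp) (simp del: sum.atMost_Suc)
    with main[of w] le show ?thesis by (simp add: w_def)
  qed
qed

section \<open>The second order expansion\<close>

text \<open>Here \<sigma> stands for the derivative of \<rho>.\<close>

definition approx :: "(real \<Rightarrow> real) \<Rightarrow> real \<Rightarrow> real \<Rightarrow> real" where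
  "approx \<sigma> n x = f x + deriv f x * rho f x / n
     + (deriv f x * \<sigma> x * rho f x + deriv (deriv f) x * (rho f x)\<^sup>2 / 2) / n\<^sup>2"

text \<open>This identifies the formally differentiated series \<sigma> with the derivative within
  the interval that occurs in \<open>c2\<close>.\<close>

lemma rho_has_derivative:
  assumes R: "\<And>y. y \<in> {\<theta>1..\<theta>2} \<Longrightarrow> \<bar>rho f y - rho f x - s * (y - x)\<bar> \<le> R * (y - x)\<^sup>2"
    and x: "x \<in> {\<theta>1..\<theta>2}"
  shows "(rho f has_real_derivative s) (at x within {\<theta>1..\<theta>2})"
proof -
  have "((\<lambda>y. (rho f y - rho f x) / (y - x) - s) \<longlongrightarrow> 0) (at x within {\<theta>1..\<theta>2})"
  proof (rule Lim_null_comparison)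
    show "\<forall>\<^sub>F y in at x within {\<theta>1..\<theta>2}. norm ((rho f y - rho f x) / (y - x) - s) \<le> R * \<bar>y - x\<bar>"
      unfolding eventually_at_filter
    proof (intro always_eventually allI impI)
      fix y assume y: "y \<noteq> x" "y \<in> {\<theta>1..\<theta>2}"
      have "(rho f y - rho f x) / (y - x) - s = (rho f y - rho f x - s * (y - x)) / (y - x)"
        using y(1) by (simp add: diff_divide_distrib)
      also have "\<bar>\<dots>\<bar> \<le> R * (y - x)\<^sup>2 / \<bar>y - x\<bar>"
        unfolding abs_divide by (intro divide_right_mono R y) auto
      also have "(y - x)\<^sup>2 = \<bar>y - x\<bar> * \<bar>y - x\<bar>" by (metis power2_abs power2_eq_square)
      also have "R * (\<bar>y - x\<bar> * \<bar>y - x\<bar>) / \<bar>y - x\<bar> = R * \<bar>y - x\<bar>"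
      proof -
        have "R * (a * a) / a = R * a" if "a \<noteq> 0" for a :: real using that by simp
        then show ?thesis using y(1) by (metis abs_eq_0 eq_iff_diff_eq_0)
      qed
      finally show "norm ((rho f y - rho f x) / (y - x) - s) \<le> R * \<bar>y - x\<bar>" by simp
    qed
    have "((\<lambda>y. R * \<bar>y - x\<bar>) \<longlongrightarrow> R * \<bar>x - x\<bar>) (at x within {\<theta>1..\<theta>2})" by (intro tendsto_intros)
    then show "((\<lambda>y. R * \<bar>y - x\<bar>) \<longlongrightarrow> 0) (at x within {\<theta>1..\<theta>2})" by simp
  qed
  then show ?thesis unfolding has_field_derivative_iff by (rule LIM_zero_cancel)
qed

lemma lambda_approx_eq:
  assumes \<sigma>: "(rho f has_real_derivative \<sigma> (grid N k)) (at (grid N k) within {\<theta>1..\<theta>2})"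
    and "grid N k \<in> {\<theta>1..\<theta>2}"
  shows "lambda_approx \<theta>1 \<theta>2 f N k = approx \<sigma> (real N + 2) (grid N k)"
proof -
  have "vector_derivative (rho f) (at (grid N k) within {\<theta>1..\<theta>2}) = \<sigma> (grid N k)"
    by (rule vector_derivative_within_closed_interval[OF \<theta>12 assms(2)])
       (use \<sigma> in \<open>simp add: has_real_derivative_iff_has_vector_derivative\<close>)
  then show ?thesis by (simp add: lambda_approx_def approx_def c1_def c2_def)
qed

lemma deriv_bounded:
  assumes "j < 4"
  obtains m where "m > 0" "\<And>x. x \<in> {\<theta>1..\<theta>2} \<Longrightarrow> \<bar>(deriv ^^ j) f x\<bar> \<le> m"
proof -
  have "continuous_on {\<theta>1..\<theta>2} ((deriv ^^ j) f)"
    using DERIV_iterate[OF assms] by (meson DERIV_isCont continuous_at_imp_continuous_on)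
  then have "bounded ((deriv ^^ j) f ` {\<theta>1..\<theta>2})"
    by (intro compact_imp_bounded compact_continuous_image) auto
  then obtain m where "m > 0" "\<forall>x\<in>(deriv ^^ j) f ` {\<theta>1..\<theta>2}. norm x \<le> m" unfolding bounded_pos by auto
  then show ?thesis by (intro that[of m]) auto
qed

lemma taylor_cubic_remainder:
  assumes m: "\<And>x. x \<in> {\<theta>1..\<theta>2} \<Longrightarrow> \<bar>(deriv ^^ 3) f x\<bar> \<le> m" and xy: "x \<in> {\<theta>1..\<theta>2}" "y \<in> {\<theta>1..\<theta>2}"
  shows "\<bar>f y - (f x + deriv f x * (y - x) + deriv (deriv f) x * (y - x)\<^sup>2 / 2)\<bar> \<le> m * \<bar>y - x\<bar> ^ 3"
proof (cases "y = x")
  case False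
  have "\<exists>t. (if y < x then y < t \<and> t < x else x < t \<and> t < y) \<and>
    f y = (\<Sum>i<3. ((deriv ^^ i) f x / fact i) * (y - x) ^ i) + ((deriv ^^ 3) f t / fact 3) * (y - x) ^ 3"
    by (rule Taylor[of 3 "\<lambda>i. (deriv ^^ i) f" f \<theta>1 \<theta>2]) (use DERIV_iterate xy False in auto)
  then obtain t where t': "if y < x then y < t \<and> t < x else x < t \<and> t < y"
    and eq: "f y = (\<Sum>i<3. ((deriv ^^ i) f x / fact i) * (y - x) ^ i) + ((deriv ^^ 3) f t / fact 3) * (y - x) ^ 3"
    by blast
  have t: "t \<in> {\<theta>1..\<theta>2}" using t' xy by (cases "y < x") auto
  have "f y - (f x + deriv f x * (y - x) + deriv (deriv f) x * (y - x)\<^sup>2 / 2) = ((deriv ^^ 3) f t / fact 3) * (y - x) ^ 3"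
    unfolding eq by (simp add: eval_nat_numeral)
  also have "\<bar>\<dots>\<bar> \<le> m * \<bar>y - x\<bar> ^ 3"
    unfolding abs_mult power_abs[symmetric]
  proof (rule mult_right_mono)
    have "\<bar>(deriv ^^ 3) f t\<bar> / 6 \<le> \<bar>(deriv ^^ 3) f t\<bar>" by simp
    with m[OF t] show "\<bar>(deriv ^^ 3) f t / fact 3\<bar> \<le> m" by (simp add: fact_numeral)
  qed simp
  finally show ?thesis .
qed simp

text \<open>With h = \<theta> - x the hypothesis reads n h = \<rho>(x) + \<sigma>(x) h + O(n^(-2)),
  because \<rho> is C^(1,1) and h = O(1/n). Inserting this relation into itself gives h = \<rho>/n +
  O(n^(-2)) and then h = \<rho>/n + \<sigma>\<rho>/n^2 + O(n^(-3)), which goes into the Taylor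
  formula for f at x.\<close>

lemma expansion:
  assumes R: "R > 0" "\<And>x y. x \<in> {\<theta>1..\<theta>2} \<Longrightarrow> y \<in> {\<theta>1..\<theta>2} \<Longrightarrow> \<bar>rho f y - rho f x - \<sigma> x * (y - x)\<bar> \<le> R * (y - x)\<^sup>2"
    "\<And>x. x \<in> {\<theta>1..\<theta>2} \<Longrightarrow> \<bar>rho f x\<bar> \<le> R" "\<And>x. x \<in> {\<theta>1..\<theta>2} \<Longrightarrow> \<bar>\<sigma> x\<bar> \<le> R"
    and C: "C > 0"
  obtains C' where "C' > 0"
    "\<And>n x \<theta>. n \<ge> 1 \<Longrightarrow> x \<in> {\<theta>1..\<theta>2} \<Longrightarrow> \<theta> \<in> {\<theta>1..\<theta>2} \<Longrightarrow> \<bar>n * \<theta> - rho f \<theta> - n * x\<bar> \<le> C / n\<^sup>2 \<Longrightarrow>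
       \<bar>f \<theta> - approx \<sigma> n x\<bar> \<le> C' / n ^ 3"
proof -
  obtain m1 where m1: "m1 > 0" "\<And>x. x \<in> {\<theta>1..\<theta>2} \<Longrightarrow> \<bar>deriv f x\<bar> \<le> m1" using deriv_bounded[of 1] by auto
  obtain m2 where m2: "m2 > 0" "\<And>x. x \<in> {\<theta>1..\<theta>2} \<Longrightarrow> \<bar>deriv (deriv f) x\<bar> \<le> m2"
    using deriv_bounded[of 2] by (auto simp: numeral_2_eq_2)
  obtain m3 where m3: "m3 > 0" "\<And>x. x \<in> {\<theta>1..\<theta>2} \<Longrightarrow> \<bar>(deriv ^^ 3) f x\<bar> \<le> m3" using deriv_bounded[of 3] by auto
  \<comment> \<open>One constant for each stage: \<open>H\<close> bounds n |h|, \<open>K1\<close>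
    the error of the relation for n h times n^2, \<open>K2\<close> and \<open>K3\<close> the errors
    of the first and second approximation of h times n^2 and n^3. The three summands of C' stem from
    the Taylor remainder and from the terms with the first and the second derivative of f.\<close>
  define H where "H = R + C"
  define K1 where "K1 = C + R * H\<^sup>2"
  define K2 where "K2 = R * H + K1"
  define K3 where "K3 = R * K2 + K1"
  define C' where "C' = m3 * H ^ 3 + m1 * K3 + m2 * (K2 * (H + R))"
  have H: "H > 0" and K: "K1 > 0" "K2 > 0" "K3 > 0" "C' > 0"
    unfolding C'_def K3_def K2_def K1_def H_def using R(1) C m1(1) m2(1) m3(1)
    by (simp_all add: add_pos_pos add_pos_nonneg)
  show thesis
  proof (rule that[OF K(4)])
    fix n x \<theta> :: real
    assume n: "n \<ge> 1" and x: "x \<in> {\<theta>1..\<theta>2}" and \<theta>: "\<theta> \<in> {\<theta>1..\<theta>2}" and le: "\<bar>n * \<theta> - rho f \<theta> - n * x\<bar> \<le> C / n\<^sup>2"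
    define h where "h = \<theta> - x"
    define e where "e = n * h - rho f \<theta>"
    have e: "\<bar>e\<bar> \<le> C / n\<^sup>2" using le unfolding e_def h_def by (simp add: algebra_simps)
    have n2: "n\<^sup>2 \<ge> 1" using n by (rule one_le_power)
    have "C / n\<^sup>2 \<le> C / 1" using C n2 by (intro divide_left_mono) auto
    then have "\<bar>n * h\<bar> \<le> H" using e R(3)[OF \<theta>] unfolding e_def H_def by linarith
    then have hb: "\<bar>h\<bar> \<le> H / n" using n by (simp add: abs_mult pos_le_divide_eq mult.commute)
    define q where "q = rho f \<theta> - rho f x - \<sigma> x * h"
    have "h\<^sup>2 \<le> (H / n)\<^sup>2" using power_mono[OF hb, of 2] by simp
    then have "R * h\<^sup>2 \<le> R * (H / n)\<^sup>2" using R(1) by (intro mult_left_mono) auto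
    then have q: "\<bar>q\<bar> \<le> R * H\<^sup>2 / n\<^sup>2" using R(2)[OF x \<theta>] unfolding q_def h_def by (simp add: power_divide)
    have qe: "\<bar>q + e\<bar> \<le> K1 / n\<^sup>2"
      using q e abs_triangle_ineq[of q e] unfolding K1_def add_divide_distrib by linarith
    have nh: "n * h = rho f x + \<sigma> x * h + (q + e)" unfolding q_def e_def by simp
    have sh: "\<bar>\<sigma> x * h\<bar> \<le> R * (H / n)" unfolding abs_mult by (intro mult_mono R(4)[OF x] hb) (use R(1) in auto)
    have "\<bar>n * h - rho f x\<bar> \<le> K2 / n"
    proof -
      have "K1 / n\<^sup>2 \<le> K1 / n" using K n by (intro divide_left_mono) (auto simp: power2_eq_square)
      then have "\<bar>\<sigma> x * h\<bar> + \<bar>q + e\<bar> \<le> R * H / n + K1 / n" using sh qe by simp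
      also have "\<dots> = K2 / n" by (simp add: K2_def add_divide_distrib)
      finally show ?thesis using abs_triangle_ineq[of "\<sigma> x * h" "q + e"] unfolding nh by simp
    qed
    then have d1: "\<bar>h - rho f x / n\<bar> \<le> K2 / n\<^sup>2"
    proof -
      assume "\<bar>n * h - rho f x\<bar> \<le> K2 / n"
      then have "\<bar>n * h - rho f x\<bar> / n \<le> K2 / n / n" using n by (intro divide_right_mono) auto
      moreover have "\<bar>h - rho f x / n\<bar> = \<bar>n * h - rho f x\<bar> / n" using n by (simp add: abs_if field_simps)
      ultimately show ?thesis by (simp add: power2_eq_square)
    qed
    have d2: "\<bar>h - rho f x / n - \<sigma> x * rho f x / n\<^sup>2\<bar> \<le> K3 / n ^ 3"
    proof -
      have eq: "h - rho f x / n - \<sigma> x * rho f x / n\<^sup>2 = (\<sigma> x * (h - rho f x / n) + (q + e)) / n"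
      proof -
        have "h = (rho f x + \<sigma> x * h + (q + e)) / n" using nh n by (simp add: field_simps)
        then have "h - rho f x / n = (\<sigma> x * h + (q + e)) / n" by (simp add: add_divide_distrib)
        moreover have "\<sigma> x * rho f x / n\<^sup>2 = \<sigma> x * (rho f x / n) / n" by (simp add: power2_eq_square)
        ultimately have "h - rho f x / n - \<sigma> x * rho f x / n\<^sup>2 = (\<sigma> x * h + (q + e)) / n - \<sigma> x * (rho f x / n) / n" by (simp only:)
        also have "\<dots> = (\<sigma> x * (h - rho f x / n) + (q + e)) / n"
          unfolding diff_divide_distrib[symmetric] right_diff_distrib by simp
        finally show ?thesis .
      qed
      have "\<bar>\<sigma> x * (h - rho f x / n)\<bar> \<le> R * (K2 / n\<^sup>2)"
        unfolding abs_mult by (intro mult_mono R(4)[OF x] d1) (use R(1) in auto)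
      then have "\<bar>\<sigma> x * (h - rho f x / n) + (q + e)\<bar> \<le> K3 / n\<^sup>2"
        using qe abs_triangle_ineq[of "\<sigma> x * (h - rho f x / n)" "q + e"] by (simp add: K3_def add_divide_distrib)
      then have "\<bar>\<sigma> x * (h - rho f x / n) + (q + e)\<bar> / n \<le> K3 / n\<^sup>2 / n" using n by (intro divide_right_mono) auto
      then show ?thesis unfolding eq using n by (simp add: power3_eq_cube power2_eq_square)
    qed
    have d3: "\<bar>h\<^sup>2 - (rho f x)\<^sup>2 / n\<^sup>2\<bar> \<le> K2 * (H + R) / n ^ 3"
    proof -
      have eq: "h\<^sup>2 - (rho f x)\<^sup>2 / n\<^sup>2 = (h - rho f x / n) * (h + rho f x / n)"
        by (simp add: power2_eq_square algebra_simps)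
      have "\<bar>rho f x / n\<bar> \<le> R / n" using R(3)[OF x] n by (simp add: divide_right_mono)
      then have "\<bar>h + rho f x / n\<bar> \<le> (H + R) / n"
        using hb abs_triangle_ineq[of h "rho f x / n"] by (simp add: add_divide_distrib)
      then have "\<bar>h - rho f x / n\<bar> * \<bar>h + rho f x / n\<bar> \<le> K2 / n\<^sup>2 * ((H + R) / n)"
        using d1 K by (intro mult_mono) auto
      then show ?thesis unfolding eq abs_mult by (simp add: power2_eq_square power3_eq_cube)
    qed
    have tay: "\<bar>f \<theta> - (f x + deriv f x * h + deriv (deriv f) x * h\<^sup>2 / 2)\<bar> \<le> m3 * H ^ 3 / n ^ 3"
    proof -
      have "m3 * \<bar>h\<bar> ^ 3 \<le> m3 * (H / n) ^ 3" using m3(1) hb by (intro mult_left_mono power_mono) auto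
      with taylor_cubic_remainder[OF m3(2) x \<theta>] show ?thesis unfolding h_def[symmetric] by (simp add: power_divide)
    qed
    have t1: "\<bar>deriv f x * (h - rho f x / n - \<sigma> x * rho f x / n\<^sup>2)\<bar> \<le> m1 * (K3 / n ^ 3)"
      unfolding abs_mult by (intro mult_mono m1(2)[OF x] d2) (use m1(1) in auto)
    have t2: "\<bar>deriv (deriv f) x * (h\<^sup>2 - (rho f x)\<^sup>2 / n\<^sup>2)\<bar> \<le> m2 * (K2 * (H + R) / n ^ 3)"
      unfolding abs_mult by (intro mult_mono m2(2)[OF x] d3) (use m2(1) in auto)
    have "f \<theta> - approx \<sigma> n x = (f \<theta> - (f x + deriv f x * h + deriv (deriv f) x * h\<^sup>2 / 2))
      + deriv f x * (h - rho f x / n - \<sigma> x * rho f x / n\<^sup>2) + (1 / 2) * (deriv (deriv f) x * (h\<^sup>2 - (rho f x)\<^sup>2 / n\<^sup>2))"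
      unfolding approx_def by (simp add: algebra_simps add_divide_distrib)
    moreover have "\<bar>u + v + (1 / 2) * w\<bar> \<le> a + b + c" if "\<bar>u\<bar> \<le> a" "\<bar>v\<bar> \<le> b" "\<bar>w\<bar> \<le> c" for u v w a b c :: real
      using that by linarith
    from this[OF tay t1 t2] have "\<bar>(f \<theta> - (f x + deriv f x * h + deriv (deriv f) x * h\<^sup>2 / 2))
      + deriv f x * (h - rho f x / n - \<sigma> x * rho f x / n\<^sup>2) + (1 / 2) * (deriv (deriv f) x * (h\<^sup>2 - (rho f x)\<^sup>2 / n\<^sup>2))\<bar>
      \<le> C' / n ^ 3" unfolding C'_def by (simp add: add_divide_distrib)
    ultimately show "\<bar>f \<theta> - approx \<sigma> n x\<bar> \<le> C' / n ^ 3" by simp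
  qed
qed

section \<open>From complex matrices to real linear systems\<close>

lemma eigenvalue_toeplitz_iff:
  "eigenvalue (toeplitz N (\<lambda>t. complex_of_real (f t))) (complex_of_real \<mu>) \<longleftrightarrow> toeplitz_eig N \<mu>"
proof -
  define T where "T = toeplitz N (\<lambda>t. complex_of_real (f t))"
  have T: "T \<in> carrier_mat (N + 1) (N + 1)" unfolding T_def toeplitz_def by simp
  have Tij: "T $$ (k, l) = complex_of_real (cos_fourier f (int k - int l))" if "k \<le> N" "l \<le> N" for k l
    unfolding T_def toeplitz_def using that by (simp add: fourier_coeff_even[OF f_cont f_reflect])
  have row: "(T *\<^sub>v v) $ k = (\<Sum>l\<le>N. complex_of_real (cos_fourier f (int k - int l)) * v $ l)"
    if "v \<in> carrier_vec (N + 1)" "k \<le> N" for v k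
  proof -
    have "(T *\<^sub>v v) $ k = (\<Sum>l\<in>{0..<N + 1}. T $$ (k, l) * v $ l)"
      using that T by (simp add: scalar_prod_def)
    also have "{0..<N + 1} = {..N}" by auto
    also have "(\<Sum>l\<le>N. T $$ (k, l) * v $ l) = (\<Sum>l\<le>N. complex_of_real (cos_fourier f (int k - int l)) * v $ l)"
      by (intro sum.cong refl) (simp add: Tij that)
    finally show ?thesis .
  qed
  have "eigenvalue T (complex_of_real \<mu>)" if "toeplitz_eig N \<mu>"
  proof -
    obtain x where x: "\<exists>i\<le>N. x i \<noteq> 0" "\<And>k. k \<le> N \<Longrightarrow> (\<Sum>l\<le>N. cos_fourier f (int k - int l) * x l) = \<mu> * x k"
      using \<open>toeplitz_eig N \<mu>\<close> unfolding toeplitz_eig_def by blast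
    define v where "v = Matrix.vec (N + 1) (\<lambda>i. complex_of_real (x i))"
    have v: "v \<in> carrier_vec (N + 1)" and vi: "\<And>i. i \<le> N \<Longrightarrow> v $ i = complex_of_real (x i)" by (auto simp: v_def)
    have "v \<noteq> 0\<^sub>v (N + 1)"
    proof
      assume z: "v = 0\<^sub>v (N + 1)"
      from x(1) obtain i where i: "i \<le> N" "x i \<noteq> 0" by blast
      have "v $ i = 0" unfolding z using i by simp
      then show False using vi[OF i(1)] i by simp
    qed
    moreover have "T *\<^sub>v v = complex_of_real \<mu> \<cdot>\<^sub>v v"
    proof (rule eq_vecI)
      fix k assume "k < dim_vec (complex_of_real \<mu> \<cdot>\<^sub>v v)"
      then have k: "k \<le> N" using v by simp
      have "(T *\<^sub>v v) $ k = (\<Sum>l\<le>N. complex_of_real (cos_fourier f (int k - int l)) * complex_of_real (x l))"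
        unfolding row[OF v k] by (intro sum.cong refl) (simp add: vi)
      also have "\<dots> = complex_of_real (\<Sum>l\<le>N. cos_fourier f (int k - int l) * x l)" by simp
      also have "\<dots> = complex_of_real (\<mu> * x k)" unfolding x(2)[OF k] ..
      finally show "(T *\<^sub>v v) $ k = (complex_of_real \<mu> \<cdot>\<^sub>v v) $ k" using v k by (simp add: vi)
    qed (use T v in auto)
    ultimately show ?thesis unfolding eigenvalue_def eigenvector_def using v T by auto
  qed
  moreover have "toeplitz_eig N \<mu>" if "eigenvalue T (complex_of_real \<mu>)"
  proof -
    obtain v where v: "v \<in> carrier_vec (N + 1)" "v \<noteq> 0\<^sub>v (N + 1)" "T *\<^sub>v v = complex_of_real \<mu> \<cdot>\<^sub>v v"
      using \<open>eigenvalue T (complex_of_real \<mu>)\<close> T unfolding eigenvalue_def eigenvector_def by auto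
    have eq: "(\<Sum>l\<le>N. complex_of_real (cos_fourier f (int k - int l)) * v $ l) = complex_of_real \<mu> * v $ k" if k: "k \<le> N" for k
      unfolding row[OF v(1) k, symmetric] v(3) using v(1) k by simp
    have re: "(\<Sum>l\<le>N. cos_fourier f (int k - int l) * Re (v $ l)) = \<mu> * Re (v $ k)" if k: "k \<le> N" for k
      using arg_cong[OF eq[OF k], of Re] by simp
    have im: "(\<Sum>l\<le>N. cos_fourier f (int k - int l) * Im (v $ l)) = \<mu> * Im (v $ k)" if k: "k \<le> N" for k
      using arg_cong[OF eq[OF k], of Im] by simp
    have "\<exists>i\<le>N. v $ i \<noteq> 0"
    proof (rule ccontr)
      assume "\<not> (\<exists>i\<le>N. v $ i \<noteq> 0)"
      then have "v = 0\<^sub>v (N + 1)" using v(1) by (intro eq_vecI) auto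
      with v(2) show False by simp
    qed
    then obtain i where i: "i \<le> N" "v $ i \<noteq> 0" by blast
    \<comment> \<open>Both the real and the imaginary part of v solve the real system, and at least
      one of them is nonzero.\<close>
    have "Re (v $ i) \<noteq> 0 \<or> Im (v $ i) \<noteq> 0" using i(2) complex_eqI[of "v $ i" 0] by fastforce
    then show ?thesis
    proof
      assume "Re (v $ i) \<noteq> 0"
      then have "\<exists>i\<le>N. Re (v $ i) \<noteq> 0" using i(1) by blast
      with re show ?thesis unfolding toeplitz_eig_def by (intro exI[of _ "\<lambda>l. Re (v $ l)"]) blast
    next
      assume "Im (v $ i) \<noteq> 0"
      then have "\<exists>i\<le>N. Im (v $ i) \<noteq> 0" using i(1) by blast
      with im show ?thesis unfolding toeplitz_eig_def by (intro exI[of _ "\<lambda>l. Im (v $ l)"]) blast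
    qed
  qed
  ultimately show ?thesis unfolding T_def by blast
qed

section \<open>Separation of the approximations and the final argument\<close>

lemma f_growth:
  obtains m where "m > 0" "\<And>x y. x \<in> {\<theta>1..\<theta>2} \<Longrightarrow> y \<in> {\<theta>1..\<theta>2} \<Longrightarrow> x \<le> y \<Longrightarrow> m * (y - x) \<le> f y - f x"
proof -
  have "continuous_on {\<theta>1..\<theta>2} (deriv f)"
    using DERIV_iterate[of 1] by (auto intro!: continuous_at_imp_continuous_on DERIV_isCont)
  then obtain z where z: "z \<in> {\<theta>1..\<theta>2}" "\<And>y. y \<in> {\<theta>1..\<theta>2} \<Longrightarrow> deriv f z \<le> deriv f y"
    using continuous_attains_inf[of "{\<theta>1..\<theta>2}" "deriv f"] \<theta>12 by auto
  show thesis
  proof (rule that[OF deriv_f_pos[OF z(1)]])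
    fix x y assume x: "x \<in> {\<theta>1..\<theta>2}" and y: "y \<in> {\<theta>1..\<theta>2}" and xy: "x \<le> y"
    have "(\<lambda>t. f t - deriv f z * t) x \<le> (\<lambda>t. f t - deriv f z * t) y"
    proof (rule DERIV_nonneg_imp_nondecreasing[OF xy])
      fix t assume "x \<le> t" "t \<le> y"
      then have "0 \<le> deriv f t - deriv f z" using z(2)[of t] x y by simp
      then show "\<exists>d. ((\<lambda>t. f t - deriv f z * t) has_real_derivative d) (at t) \<and> 0 \<le> d"
        by (intro exI[of _ "deriv f t - deriv f z"] conjI) (auto intro!: derivative_eq_intros DERIV_f)
    qed
    then show "deriv f z * (y - x) \<le> f y - f x" by (simp add: algebra_simps)
  qed
qed

text \<open>Between neighbouring grid points f grows by at least a multiple of 1/n. The first order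
  correction is Lipschitz with constant O(1/n) and cannot spoil this, and the second order one is of
  size O(n^(-2)). The approximations for different k are therefore much farther apart than the
  tolerance C/n^3.\<close>

lemma approx_spacing:
  assumes R: "R > 0" "\<And>x. x \<in> {\<theta>1..\<theta>2} \<Longrightarrow> \<bar>rho f x\<bar> \<le> R" "\<And>x. x \<in> {\<theta>1..\<theta>2} \<Longrightarrow> \<bar>\<sigma> x\<bar> \<le> R"
    and L: "L > 0" "\<And>x y. x \<in> {\<theta>1..\<theta>2} \<Longrightarrow> y \<in> {\<theta>1..\<theta>2} \<Longrightarrow> \<bar>rho f y - rho f x\<bar> \<le> L * \<bar>y - x\<bar>"
  obtains c K where "c > 0" "K > 0"
    "eventually (\<lambda>N. \<forall>x\<in>{\<theta>1..\<theta>2}. \<forall>y\<in>{\<theta>1..\<theta>2}. x + pi / (real N + 2) \<le> y \<longrightarrow>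
        c / (real N + 2) \<le> approx \<sigma> (real N + 2) y - approx \<sigma> (real N + 2) x) sequentially"
    "\<And>n x. n \<ge> 1 \<Longrightarrow> x \<in> {\<theta>1..\<theta>2} \<Longrightarrow> \<bar>approx \<sigma> n x - f x\<bar> \<le> K / n"
proof -
  obtain m1 where m1: "m1 > 0" "\<And>x. x \<in> {\<theta>1..\<theta>2} \<Longrightarrow> \<bar>deriv f x\<bar> \<le> m1" using deriv_bounded[of 1] by auto
  obtain m2 where m2: "m2 > 0" "\<And>x. x \<in> {\<theta>1..\<theta>2} \<Longrightarrow> \<bar>deriv (deriv f) x\<bar> \<le> m2"
    using deriv_bounded[of 2] by (auto simp: numeral_2_eq_2)
  obtain m where m: "m > 0" "\<And>x y. x \<in> {\<theta>1..\<theta>2} \<Longrightarrow> y \<in> {\<theta>1..\<theta>2} \<Longrightarrow> x \<le> y \<Longrightarrow> m * (y - x) \<le> f y - f x"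
    by (rule f_growth) blast
  define w where "w x = deriv f x * \<sigma> x * rho f x + deriv (deriv f) x * (rho f x)\<^sup>2 / 2" for x
  define W where "W = m1 * R * R + m2 * R\<^sup>2"
  have W0: "W > 0" unfolding W_def using m1(1) m2(1) R(1) by (simp add: add_pos_pos)
  have w: "\<bar>w x\<bar> \<le> W" if x: "x \<in> {\<theta>1..\<theta>2}" for x
  proof -
    have "\<bar>deriv f x * \<sigma> x * rho f x\<bar> \<le> m1 * R * R"
      unfolding abs_mult by (intro mult_mono m1(2)[OF x] R(2)[OF x] R(3)[OF x]) (use m1(1) R(1) in auto)
    moreover have "\<bar>deriv (deriv f) x * (rho f x)\<^sup>2 / 2\<bar> \<le> m2 * R\<^sup>2"
    proof -
      have "(rho f x)\<^sup>2 \<le> R\<^sup>2" using power_mono[OF R(2)[OF x], of 2] by simp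
      then have "\<bar>deriv (deriv f) x\<bar> * (rho f x)\<^sup>2 \<le> m2 * R\<^sup>2" using m2 x by (intro mult_mono) auto
      moreover have "0 \<le> \<bar>deriv (deriv f) x\<bar> * (rho f x)\<^sup>2" by simp
      moreover have "\<bar>deriv (deriv f) x * (rho f x)\<^sup>2 / 2\<bar> = (\<bar>deriv (deriv f) x\<bar> * (rho f x)\<^sup>2) / 2" by (simp add: abs_mult)
      ultimately show ?thesis by linarith
    qed
    ultimately show ?thesis unfolding w_def W_def by linarith
  qed
  define L1 where "L1 = m1 * L + R * m2"
  have L1: "L1 > 0" unfolding L1_def using m1(1) m2(1) R(1) L(1) by (simp add: add_pos_pos)
  have u: "\<bar>deriv f y * rho f y - deriv f x * rho f x\<bar> \<le> L1 * \<bar>y - x\<bar>" if x: "x \<in> {\<theta>1..\<theta>2}" and y: "y \<in> {\<theta>1..\<theta>2}" for x y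
  proof -
    have "norm (deriv f y - deriv f x) \<le> m2 * norm (y - x)"
    proof (rule field_differentiable_bound[of "{\<theta>1..\<theta>2}" _ "deriv (deriv f)"])
      show "(deriv f has_real_derivative deriv (deriv f) z) (at z within {\<theta>1..\<theta>2})" for z
        using DERIV_iterate[of 1 z] by (simp add: has_field_derivative_at_within)
    qed (use m2 x y in auto)
    then have df: "\<bar>deriv f y - deriv f x\<bar> \<le> m2 * \<bar>y - x\<bar>" by simp
    have "deriv f y * rho f y - deriv f x * rho f x = deriv f y * (rho f y - rho f x) + rho f x * (deriv f y - deriv f x)"
      by (simp add: algebra_simps)
    also have "\<bar>\<dots>\<bar> \<le> \<bar>deriv f y\<bar> * \<bar>rho f y - rho f x\<bar> + \<bar>rho f x\<bar> * \<bar>deriv f y - deriv f x\<bar>"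
      unfolding abs_mult[symmetric] by (rule abs_triangle_ineq)
    also have "\<dots> \<le> m1 * (L * \<bar>y - x\<bar>) + R * (m2 * \<bar>y - x\<bar>)"
      by (intro add_mono mult_mono m1(2)[OF y] L(2)[OF x y] R(2)[OF x] df) (use m1(1) R(1) in auto)
    finally show ?thesis unfolding L1_def by (simp add: algebra_simps)
  qed
  show thesis
  proof (rule that[of "m / 2" "m1 * R + W"])
    show "m / 2 > 0" "m1 * R + W > 0" using m(1) m1(1) R(1) W0 by (simp_all add: add_pos_pos)
    show "\<bar>approx \<sigma> n x - f x\<bar> \<le> (m1 * R + W) / n" if n: "n \<ge> 1" and x: "x \<in> {\<theta>1..\<theta>2}" for n x
    proof -
      have e: "approx \<sigma> n x - f x = deriv f x * rho f x / n + w x / n\<^sup>2" by (simp add: approx_def w_def)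
      have "\<bar>deriv f x * rho f x\<bar> \<le> m1 * R"
        unfolding abs_mult by (intro mult_mono m1(2)[OF x] R(2)[OF x]) (use m1(1) in auto)
      then have "\<bar>deriv f x * rho f x / n\<bar> \<le> m1 * R / n" using n by (simp add: divide_right_mono)
      moreover have "\<bar>w x / n\<^sup>2\<bar> \<le> W / n"
      proof -
        have "\<bar>w x\<bar> / n\<^sup>2 \<le> W / n" using n w[OF x] W0 by (intro frac_le) (auto simp: power2_eq_square)
        then show ?thesis by simp
      qed
      ultimately show ?thesis unfolding e add_divide_distrib
        using abs_triangle_ineq[of "deriv f x * rho f x / n" "w x / n\<^sup>2"] by linarith
    qed
    have "eventually (\<lambda>N. L1 / (real N + 2) < m / 2) sequentially" "eventually (\<lambda>N. 2 * W / (real N + 2) < m) sequentially"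
      using m(1) by (intro eventually_small; simp)+
    then show "eventually (\<lambda>N. \<forall>x\<in>{\<theta>1..\<theta>2}. \<forall>y\<in>{\<theta>1..\<theta>2}. x + pi / (real N + 2) \<le> y \<longrightarrow>
        m / 2 / (real N + 2) \<le> approx \<sigma> (real N + 2) y - approx \<sigma> (real N + 2) x) sequentially"
    proof eventually_elim
      case (elim N)
      define n where "n = real N + 2"
      have n: "n \<ge> 1" by (simp add: n_def)
      show ?case unfolding n_def[symmetric]
      proof (intro ballI impI)
        fix x y assume x: "x \<in> {\<theta>1..\<theta>2}" and y: "y \<in> {\<theta>1..\<theta>2}" and xy: "x + pi / n \<le> y"
        define D where "D = y - x"
        have D: "D \<ge> pi / n" using xy by (simp add: D_def)
        moreover have "pi / n > 0" using n by simp
        ultimately have D0: "D > 0" by linarith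
        have e: "approx \<sigma> n y - approx \<sigma> n x = (f y - f x) + (deriv f y * rho f y - deriv f x * rho f x) / n + (w y - w x) / n\<^sup>2"
          by (simp add: approx_def w_def diff_divide_distrib)
        have t1: "m * D \<le> f y - f x" using m(2)[OF x y] D0 by (simp add: D_def)
        have t2: "- (m / 2 * D) \<le> (deriv f y * rho f y - deriv f x * rho f x) / n"
        proof -
          have "\<bar>(deriv f y * rho f y - deriv f x * rho f x) / n\<bar> \<le> L1 * D / n"
            using u[OF x y] n D0 by (simp add: D_def divide_right_mono)
          also have "L1 * D / n = (L1 / n) * D" by simp
          also have "\<dots> \<le> m / 2 * D" using elim(1) D0 by (intro mult_right_mono) (auto simp: n_def)
          finally show ?thesis by linarith
        qed
        \<comment> \<open>As \<sigma> is only assumed to be bounded here, the second order term is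
          estimated by its size and not by its variation.\<close>
        have t3: "- (m / n) \<le> (w y - w x) / n\<^sup>2"
        proof -
          have "\<bar>w y - w x\<bar> \<le> 2 * W" using w[OF x] w[OF y] by linarith
          then have "\<bar>(w y - w x) / n\<^sup>2\<bar> \<le> 2 * W / n\<^sup>2" by (simp add: divide_right_mono)
          also have "\<dots> = (2 * W / n) / n" by (simp add: power2_eq_square)
          also have "\<dots> \<le> m / n" using elim(2) n by (intro divide_right_mono) (auto simp: n_def)
          finally show ?thesis by linarith
        qed
        \<comment> \<open>The budget in terms of M = m/n and P = mD/2: f contributes 2P, the
          corrections take away at most P and M, and P \<ge> 3M/2 since D \<ge> \<pi>/n and \<pi> >
          3. At least M/2 remains.\<close>
        have gen: "3 / 2 * M \<le> P" if "Q \<le> P" "3 * M \<le> Z" "Q = Z / 2" for M P Q Z :: real using that by simp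
        have "m / 2 * (pi / n) \<le> m / 2 * D" using D m(1) by (intro mult_left_mono) auto
        moreover have "3 * (m / n) \<le> pi * (m / n)" using pi_gt3 m(1) n by (intro mult_right_mono) auto
        moreover have "m / 2 * (pi / n) = pi * (m / n) / 2" using n by (simp add: field_simps)
        ultimately have "3 / 2 * (m / n) \<le> m / 2 * D" by (rule gen)
        moreover have "2 * (m / 2 * D) \<le> f y - f x" using t1 by simp
        moreover have "M / 2 \<le> a + X + Y" if "3 / 2 * M \<le> P" "2 * P \<le> a" "- P \<le> X" "- M \<le> Y" for M P a X Y :: real
          using that by linarith
        ultimately have "(m / n) / 2 \<le> (f y - f x) + (deriv f y * rho f y - deriv f x * rho f x) / n + (w y - w x) / n\<^sup>2"
          using t2 t3 by blast
        then show "m / 2 / n \<le> approx \<sigma> n y - approx \<sigma> n x" unfolding e by simp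
      qed
    qed
  qed
qed

lemma f_preimage:
  assumes "x \<in> {\<theta>1..\<theta>2}" "y \<in> {\<theta>1..\<theta>2}" "x \<le> y" "\<mu> \<in> {f x..f y}"
  obtains \<theta> where "\<theta> \<in> {x..y}" "\<mu> = f \<theta>"
  using IVT'[of f x \<mu> y] assms f_cont by auto

lemma eigenvalue_asymptotics:
  fixes a b :: real
  assumes ab: "a < b" "{a..b} \<subseteq> {\<theta>1<..<\<theta>2}"
  shows "\<exists>C>0. \<exists>N0. \<forall>N\<ge>N0.
     (\<forall>\<mu>. toeplitz_eig N \<mu> \<and> \<mu> \<in> {f a..f b} \<longrightarrow>
        (\<exists>!k. k \<in> {k_min \<theta>1 \<theta>2 N..k_max \<theta>1 \<theta>2 N} \<and> \<bar>\<mu> - lambda_approx \<theta>1 \<theta>2 f N k\<bar> \<le> C / (real N + 2) ^ 3)) \<and>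
     (\<forall>k. k \<in> {k_min a b N..k_max a b N} \<longrightarrow>
        (\<exists>!\<mu>. toeplitz_eig N \<mu> \<and> \<mu> \<in> {f \<theta>1..f \<theta>2} \<and> \<bar>\<mu> - lambda_approx \<theta>1 \<theta>2 f N k\<bar> \<le> C / (real N + 2) ^ 3))"
proof -
  have "a \<in> {a..b}" "b \<in> {a..b}" using ab(1) by auto
  then have "a \<in> {\<theta>1<..<\<theta>2}" "b \<in> {\<theta>1<..<\<theta>2}" using ab(2) by blast+
  then have a: "\<theta>1 < a" and b: "b < \<theta>2" and ab_in: "a \<in> {\<theta>1..\<theta>2}" "b \<in> {\<theta>1..\<theta>2}" by auto
  obtain \<sigma> R where R: "R > 0"
    "\<And>x y. x \<in> {\<theta>1..\<theta>2} \<Longrightarrow> y \<in> {\<theta>1..\<theta>2} \<Longrightarrow> \<bar>rho f y - rho f x - \<sigma> x * (y - x)\<bar> \<le> R * (y - x)\<^sup>2"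
    "\<And>x. x \<in> {\<theta>1..\<theta>2} \<Longrightarrow> \<bar>rho f x\<bar> \<le> R" "\<And>x. x \<in> {\<theta>1..\<theta>2} \<Longrightarrow> \<bar>\<sigma> x\<bar> \<le> R"
    by (rule rho_c11) blast
  \<comment> \<open>The linear term gives R; in the quadratic term one factor |y - x| is bounded by
    \<pi>.\<close>
  define L where "L = R + R * pi"
  have L: "L > 0" unfolding L_def using R(1) by (simp add: add_pos_pos)
  have rho_lip: "\<bar>rho f y - rho f x\<bar> \<le> L * \<bar>y - x\<bar>" if x: "x \<in> {\<theta>1..\<theta>2}" and y: "y \<in> {\<theta>1..\<theta>2}" for x y
  proof -
    have "\<bar>rho f y - rho f x\<bar> \<le> \<bar>\<sigma> x * (y - x)\<bar> + R * (y - x)\<^sup>2" using R(2)[OF x y] by linarith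
    also have "\<bar>\<sigma> x * (y - x)\<bar> \<le> R * \<bar>y - x\<bar>" unfolding abs_mult by (intro mult_right_mono R(4)[OF x]) simp
    also have "(y - x)\<^sup>2 = \<bar>y - x\<bar> * \<bar>y - x\<bar>" by (metis power2_abs power2_eq_square)
    also have "R * (\<bar>y - x\<bar> * \<bar>y - x\<bar>) \<le> R * (pi * \<bar>y - x\<bar>)"
      using x y \<theta>1 \<theta>2 R(1) by (intro mult_left_mono mult_right_mono) auto
    finally show ?thesis by (simp add: L_def algebra_simps)
  qed
  have rho_D: "(rho f has_real_derivative \<sigma> x) (at x within {\<theta>1..\<theta>2})" if "x \<in> {\<theta>1..\<theta>2}" for x
    by (rule rho_has_derivative[OF _ that]) (rule R(2)[OF that])
  have rho_cont: "continuous_on {\<theta>1..\<theta>2} (rho f)"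
    using rho_D by (meson DERIV_continuous continuous_on_eq_continuous_within)
  obtain C1 where C1: "C1 > 0"
    and ph: "eventually (\<lambda>N. \<forall>\<theta>\<in>{\<theta>1..\<theta>2}. toeplitz_eig N (f \<theta>) \<longrightarrow> \<bar>sin ((real N + 2) * \<theta> - rho f \<theta>)\<bar> \<le> C1 / (real N + 2)\<^sup>2) sequentially"
    by (rule phase_bound) blast
  have C1': "2 * C1 > 0" using C1 by simp
  obtain C2 where C2: "C2 > 0"
    and qm: "eventually (\<lambda>N. \<forall>\<theta>\<in>{\<theta>1..\<theta>2}. sin ((real N + 2) * \<theta> - rho f \<theta>) = 0 \<longrightarrow>
       (\<exists>\<mu>. toeplitz_eig N \<mu> \<and> \<bar>\<mu> - f \<theta>\<bar> \<le> C2 / ((real N + 2) * sqrt (real N + 2)))) sequentially"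
    by (rule quasi_mode_eig) blast
  obtain C where C: "C > 0" and expand:
    "\<And>n x \<theta>. n \<ge> 1 \<Longrightarrow> x \<in> {\<theta>1..\<theta>2} \<Longrightarrow> \<theta> \<in> {\<theta>1..\<theta>2} \<Longrightarrow> \<bar>n * \<theta> - rho f \<theta> - n * x\<bar> \<le> 2 * C1 / n\<^sup>2 \<Longrightarrow>
       \<bar>f \<theta> - approx \<sigma> n x\<bar> \<le> C / n ^ 3"
    by (rule expansion[OF R C1']) blast+
  obtain c K where c: "c > 0" "K > 0"
    and spacing: "eventually (\<lambda>N. \<forall>x\<in>{\<theta>1..\<theta>2}. \<forall>y\<in>{\<theta>1..\<theta>2}. x + pi / (real N + 2) \<le> y \<longrightarrow>
        c / (real N + 2) \<le> approx \<sigma> (real N + 2) y - approx \<sigma> (real N + 2) x) sequentially"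
    and approx_f: "\<And>n x. n \<ge> 1 \<Longrightarrow> x \<in> {\<theta>1..\<theta>2} \<Longrightarrow> \<bar>approx \<sigma> n x - f x\<bar> \<le> K / n"
    by (rule approx_spacing[OF R(1,3,4) L rho_lip]) blast+
  obtain m where m: "m > 0" "\<And>x y. x \<in> {\<theta>1..\<theta>2} \<Longrightarrow> y \<in> {\<theta>1..\<theta>2} \<Longrightarrow> x \<le> y \<Longrightarrow> m * (y - x) \<le> f y - f x"
    by (rule f_growth) blast
  have f_inv: "\<bar>y - x\<bar> \<le> \<bar>f y - f x\<bar> / m" if x: "x \<in> {\<theta>1..\<theta>2}" and y: "y \<in> {\<theta>1..\<theta>2}" for x y
  proof (cases "x \<le> y")
    case True
    then have "m * \<bar>y - x\<bar> \<le> \<bar>f y - f x\<bar>" using m(2)[OF x y] by simp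
    then show ?thesis using m(1) by (simp add: pos_le_divide_eq mult.commute)
  next
    case False
    then have "m * \<bar>y - x\<bar> \<le> \<bar>f y - f x\<bar>" using m(2)[OF y x] by simp
    then show ?thesis using m(1) by (simp add: pos_le_divide_eq mult.commute)
  qed
  have f_mono: "f x \<le> f y" if x: "x \<in> {\<theta>1..\<theta>2}" and y: "y \<in> {\<theta>1..\<theta>2}" and "x \<le> y" for x y
  proof -
    have "0 \<le> m * (y - x)" using m(1) that by simp
    with m(2)[OF that] show ?thesis by linarith
  qed
  \<comment> \<open>Half the distance of [a, b] from the end points \<theta>1 and \<theta>2: angles
    within \<open>e0\<close> of [a, b] keep a margin inside the larger interval.\<close>
  define e0 where "e0 = min (a - \<theta>1) (\<theta>2 - b) / 2"
  have e0: "e0 > 0" "\<theta>1 \<le> a - e0" "b + e0 \<le> \<theta>2" "\<theta>1 < a - e0" "b + e0 < \<theta>2" unfolding e0_def using a b by (auto simp: min_def field_simps)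
  \<comment> \<open>The same margin measured in values of f, so that an eigenvalue close enough to
    such a value still lies in [f \<theta>1, f \<theta>2].\<close>
  define gap where "gap = min (f (a - e0) - f \<theta>1) (f \<theta>2 - f (b + e0))"
  have gap: "gap > 0" unfolding gap_def
    using f_strict_mono[of \<theta>1 "a - e0"] f_strict_mono[of "b + e0" \<theta>2] e0 a b \<theta>12 ab(1) by auto
  \<comment> \<open>The distance of [\<theta>1, \<theta>2] from the multiples of \<pi>, to be
    contradicted at the very end.\<close>
  define e1 where "e1 = min \<theta>1 (pi - \<theta>2)"
  have e1: "e1 > 0" unfolding e1_def using \<theta>1 \<theta>2 by simp
  define K5 where "K5 = (1 + L) * (2 * C / m) + 10 * C1"
  \<comment> \<open>The phase condition for the matrix of one size less, needed for the eigenvalue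
    found by interlacing.\<close>
  have ph': "eventually (\<lambda>N. N \<ge> 1 \<and> (\<forall>\<theta>\<in>{\<theta>1..\<theta>2}. toeplitz_eig (N - 1) (f \<theta>) \<longrightarrow> \<bar>sin ((real (N - 1) + 2) * \<theta> - rho f \<theta>)\<bar> \<le> C1 / (real (N - 1) + 2)\<^sup>2)) sequentially"
  proof -
    from ph obtain N0 where N0: "\<And>N. N \<ge> N0 \<Longrightarrow> \<forall>\<theta>\<in>{\<theta>1..\<theta>2}. toeplitz_eig N (f \<theta>) \<longrightarrow> \<bar>sin ((real N + 2) * \<theta> - rho f \<theta>)\<bar> \<le> C1 / (real N + 2)\<^sup>2"
      unfolding eventually_sequentially by blast
    show ?thesis unfolding eventually_sequentially
      by (rule exI[of _ "Suc N0"], intro allI impI conjI) (use N0 in \<open>simp, metis One_nat_def Suc_le_D diff_Suc_1 Suc_le_mono\<close>)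
  qed
  have one: "0 < (1::real)" by simp
  have small: "eventually (\<lambda>N. (R + 2 * C1 + 1) / (real N + 2) < e0) sequentially"
    "eventually (\<lambda>N. (C2 + 3 * C + K) / (real N + 2) < gap) sequentially"
    "eventually (\<lambda>N. ((1 + L) * (C2 / m)) / sqrt (real N + 2) < 1) sequentially"
    "eventually (\<lambda>N. 2 * C1 / (real N + 2) < 1) sequentially"
    "eventually (\<lambda>N. 2 * C / (real N + 2) < c) sequentially"
    "eventually (\<lambda>N. K5 / (real N + 2) < e1) sequentially"
    by (rule eventually_small[OF e0(1)] eventually_small[OF gap] eventually_small[OF c(1)] eventually_small[OF e1]
        eventually_small[OF one] eventually_small_sqrt[OF one])+
  have "eventually (\<lambda>N.
     (\<forall>\<mu>. toeplitz_eig N \<mu> \<and> \<mu> \<in> {f a..f b} \<longrightarrow>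
        (\<exists>!k. k \<in> {k_min \<theta>1 \<theta>2 N..k_max \<theta>1 \<theta>2 N} \<and> \<bar>\<mu> - lambda_approx \<theta>1 \<theta>2 f N k\<bar> \<le> C / (real N + 2) ^ 3)) \<and>
     (\<forall>k. k \<in> {k_min a b N..k_max a b N} \<longrightarrow>
        (\<exists>!\<mu>. toeplitz_eig N \<mu> \<and> \<mu> \<in> {f \<theta>1..f \<theta>2} \<and> \<bar>\<mu> - lambda_approx \<theta>1 \<theta>2 f N k\<bar> \<le> C / (real N + 2) ^ 3))) sequentially"
    using ph ph' qm spacing small k_range_iff[OF \<theta>12] k_range_iff[OF ab(1)]
  proof eventually_elim
    case (elim N)
    define n where "n = real N + 2"
    have n: "n \<ge> 1" "n \<ge> 2" "n > 0" by (simp_all add: n_def)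
    note elim = elim[folded n_def]
    have inv: "Q / n ^ 3 \<le> Q / n" "Q / n\<^sup>2 \<le> Q / n" "Q / n ^ 3 \<le> Q / n\<^sup>2" if "Q \<ge> 0" for Q
      using that n by (auto intro!: divide_left_mono power_increasing self_le_power[of n])
    have grid_n: "n * grid N k = of_int k * pi" for k using n by (simp add: grid_def n_def)
    have phase: "\<exists>k. \<bar>n * \<theta> - rho f \<theta> - n * grid N k\<bar> \<le> 2 * C1 / n\<^sup>2" if "\<theta> \<in> {\<theta>1..\<theta>2}" "toeplitz_eig N (f \<theta>)" for \<theta>
    proof -
      obtain k where "\<bar>(n * \<theta> - rho f \<theta>) - of_int k * pi\<bar> \<le> 2 * \<bar>sin (n * \<theta> - rho f \<theta>)\<bar>"
        by (rule sin_small_imp_near_multiple)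
      also have "\<dots> \<le> 2 * (C1 / n\<^sup>2)" using elim(1) that by (intro mult_left_mono) auto
      finally show ?thesis by (intro exI[of _ k]) (simp add: grid_n)
    qed
    have la: "lambda_approx \<theta>1 \<theta>2 f N k = approx \<sigma> n (grid N k)" if "grid N k \<in> {\<theta>1..\<theta>2}" for k
      unfolding n_def by (rule lambda_approx_eq[of \<sigma>, OF rho_D[OF that] that])
    have near_grid: "\<bar>\<theta> - grid N k\<bar> \<le> (R + 2 * C1) / n" if \<theta>: "\<theta> \<in> {\<theta>1..\<theta>2}" "\<bar>n * \<theta> - rho f \<theta> - n * grid N k\<bar> \<le> 2 * C1 / n\<^sup>2" for \<theta> k
    proof -
      have "2 * C1 / n\<^sup>2 \<le> 2 * C1 / 1" using C1 n by (intro divide_left_mono) (auto intro: one_le_power)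
      then have "\<bar>n * \<theta> - n * grid N k\<bar> \<le> R + 2 * C1" using that(2) R(3)[OF \<theta>(1)] by linarith
      moreover have "\<bar>n * \<theta> - n * grid N k\<bar> = \<bar>\<theta> - grid N k\<bar> * n"
        using n by (simp only: right_diff_distrib[symmetric] abs_mult) simp
      ultimately have "\<bar>\<theta> - grid N k\<bar> * n \<le> R + 2 * C1" by simp
      then show ?thesis using n by (simp add: pos_le_divide_eq)
    qed
    \<comment> \<open>Two different indices would put their approximations at least c/n apart, yet
      both lie within C/n^3 of the same eigenvalue.\<close>
    have k_unique: "k = k'" if kin: "grid N k \<in> {\<theta>1..\<theta>2}" "grid N k' \<in> {\<theta>1..\<theta>2}"
      and le: "\<bar>\<mu> - approx \<sigma> n (grid N k)\<bar> \<le> C / n ^ 3" "\<bar>\<mu> - approx \<sigma> n (grid N k')\<bar> \<le> C / n ^ 3" for k k' \<mu>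
    proof -
      have no: False if "j < j'" "grid N j \<in> {\<theta>1..\<theta>2}" "grid N j' \<in> {\<theta>1..\<theta>2}"
        "\<bar>\<mu> - approx \<sigma> n (grid N j)\<bar> \<le> C / n ^ 3" "\<bar>\<mu> - approx \<sigma> n (grid N j')\<bar> \<le> C / n ^ 3" for j j'
      proof -
        have "(of_int j + 1) * (pi / n) \<le> of_int j' * (pi / n)" using that(1) n by (intro mult_right_mono) auto
        then have "grid N j + pi / n \<le> grid N j'" by (simp add: grid_def n_def add_divide_distrib distrib_right)
        then have "c / n \<le> approx \<sigma> n (grid N j') - approx \<sigma> n (grid N j)" using elim(4) that(2,3) by blast
        also have "\<dots> \<le> 2 * C / n ^ 3" using that(4,5) by (simp add: abs_le_iff)
        also have "\<dots> \<le> 2 * C / n\<^sup>2" using C by (intro inv) auto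
        also have "\<dots> = (2 * C / n) / n" by (simp add: power2_eq_square)
        also have "\<dots> < c / n" using elim(9) n by (intro divide_strict_right_mono) auto
        finally show False by simp
      qed
      show ?thesis using no[of k k'] no[of k' k] kin le by (meson linorder_neqE)
    qed
    show ?case unfolding n_def[symmetric]
    proof (intro conjI allI impI)
      fix \<mu> assume "toeplitz_eig N \<mu> \<and> \<mu> \<in> {f a..f b}"
      then have \<mu>: "toeplitz_eig N \<mu>" "\<mu> \<in> {f a..f b}" by blast+
      obtain \<theta> where \<theta>: "\<theta> \<in> {a..b}" "\<mu> = f \<theta>" using f_preimage[OF ab_in less_imp_le[OF ab(1)] \<mu>(2)] by blast
      have \<theta>': "\<theta> \<in> {\<theta>1..\<theta>2}" using \<theta>(1) a b by auto
      obtain k where k: "\<bar>n * \<theta> - rho f \<theta> - n * grid N k\<bar> \<le> 2 * C1 / n\<^sup>2" using phase[OF \<theta>'] \<mu>(1) \<theta>(2) by blast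
      have "(R + 2 * C1) / n \<le> (R + 2 * C1 + 1) / n" using n by (intro divide_right_mono) auto
      then have "\<bar>\<theta> - grid N k\<bar> \<le> e0" using near_grid[OF \<theta>' k] elim(5) by linarith
      then have kin: "grid N k \<in> {\<theta>1..\<theta>2}" using \<theta>(1) e0(2,3) by (auto simp: abs_le_iff)
      show "\<exists>!k. k \<in> {k_min \<theta>1 \<theta>2 N..k_max \<theta>1 \<theta>2 N} \<and> \<bar>\<mu> - lambda_approx \<theta>1 \<theta>2 f N k\<bar> \<le> C / n ^ 3"
      proof (rule ex1I[of _ k])
        show "k \<in> {k_min \<theta>1 \<theta>2 N..k_max \<theta>1 \<theta>2 N} \<and> \<bar>\<mu> - lambda_approx \<theta>1 \<theta>2 f N k\<bar> \<le> C / n ^ 3"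
          using elim(11) kin expand[OF n(1) kin \<theta>' k] unfolding la[OF kin] \<theta>(2) by blast
        fix k' assume k': "k' \<in> {k_min \<theta>1 \<theta>2 N..k_max \<theta>1 \<theta>2 N} \<and> \<bar>\<mu> - lambda_approx \<theta>1 \<theta>2 f N k'\<bar> \<le> C / n ^ 3"
        then have kin': "grid N k' \<in> {\<theta>1..\<theta>2}" using elim(11) by blast
        show "k' = k"
          by (rule k_unique[OF kin' kin, of \<mu>]) (use k' la[OF kin'] expand[OF n(1) kin \<theta>' k] \<theta>(2) in auto)
      qed
    next
      fix k assume "k \<in> {k_min a b N..k_max a b N}"
      then have kab: "grid N k \<in> {a..b}" using elim(12) by blast
      define x where "x = grid N k"
      have x: "x \<in> {a..b}" "x \<in> {\<theta>1..\<theta>2}" using kab a b by (auto simp: x_def)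
      note lax = la[of k, folded x_def, OF x(2)]
      have fx: "f \<theta>1 + gap \<le> f x" "f x \<le> f \<theta>2 - gap"
      proof -
        have "f (a - e0) \<le> f x" "f x \<le> f (b + e0)" using x e0 ab(1) by (auto intro!: f_mono)
        then show "f \<theta>1 + gap \<le> f x" "f x \<le> f \<theta>2 - gap" unfolding gap_def by (auto simp: min_def)
      qed
      \<comment> \<open>Chosen so that n h = R + 1 exceeds |\<rho>|: the continuous function
        n\<theta> - \<rho>(\<theta>) then passes the value n x between x - h and x + h.\<close>
      define h where "h = (R + 1) / n"
      have h: "0 < h" "h < e0"
      proof -
        show "0 < h" unfolding h_def using R(1) n by simp
        have "h \<le> (R + 2 * C1 + 1) / n" unfolding h_def using n C1 by (intro divide_right_mono) auto
        then show "h < e0" using elim(5) by linarith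
      qed
      have xh: "x - h \<in> {\<theta>1..\<theta>2}" "x + h \<in> {\<theta>1..\<theta>2}" using x(1) h e0 by auto
      have "\<exists>\<theta>\<ge>x - h. \<theta> \<le> x + h \<and> n * \<theta> - rho f \<theta> = n * x"
      proof (rule IVT')
        have nh: "n * h = R + 1" unfolding h_def using n by simp
        show "n * (x - h) - rho f (x - h) \<le> n * x" using R(3)[OF xh(1)] nh by (simp add: right_diff_distrib abs_le_iff)
        show "n * x \<le> n * (x + h) - rho f (x + h)" using R(3)[OF xh(2)] nh by (simp add: distrib_left abs_le_iff)
        show "x - h \<le> x + h" using h by simp
        show "continuous_on {x - h..x + h} (\<lambda>\<theta>. n * \<theta> - rho f \<theta>)"
          using xh by (intro continuous_intros continuous_on_subset[OF rho_cont]) auto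
      qed
      then obtain \<theta> where \<theta>: "\<theta> \<in> {x - h..x + h}" "n * \<theta> - rho f \<theta> = n * x" by auto
      have \<theta>': "\<theta> \<in> {\<theta>1..\<theta>2}" using \<theta>(1) xh by auto
      have "sin (n * \<theta> - rho f \<theta>) = 0" unfolding \<theta>(2) x_def grid_n using sin_zero_iff_int2 by blast
      then obtain \<mu> where \<mu>: "toeplitz_eig N \<mu>" "\<bar>\<mu> - f \<theta>\<bar> \<le> C2 / (n * sqrt n)" using elim(3) \<theta>' by blast
      have sq: "sqrt n \<ge> 1" using n by simp
      have "C2 / (n * sqrt n) \<le> C2 / n" using C2 n sq by (intro divide_left_mono) auto
      also have "\<dots> \<le> (C2 + 3 * C + K) / n" using C c n by (intro divide_right_mono) auto
      finally have "\<bar>\<mu> - f \<theta>\<bar> < gap" using \<mu>(2) elim(6) by linarith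
      moreover have "f (a - e0) \<le> f \<theta>" "f \<theta> \<le> f (b + e0)" using \<theta> x h e0 \<theta>' ab(1) by (auto intro!: f_mono)
      ultimately have "\<mu> \<in> {f \<theta>1..f \<theta>2}" unfolding gap_def by (auto simp: abs_less_iff)
      then obtain \<phi> where \<phi>: "\<phi> \<in> {\<theta>1..\<theta>2}" "\<mu> = f \<phi>" using f_preimage[of \<theta>1 \<theta>2 \<mu>] \<theta>12 by auto
      obtain k' where k': "\<bar>n * \<phi> - rho f \<phi> - n * grid N k'\<bar> \<le> 2 * C1 / n\<^sup>2" using phase[OF \<phi>(1)] \<mu>(1) \<phi>(2) by blast
      have d: "\<bar>\<phi> - \<theta>\<bar> \<le> C2 / m / (n * sqrt n)"
      proof -
        have "\<bar>\<phi> - \<theta>\<bar> \<le> \<bar>f \<phi> - f \<theta>\<bar> / m" by (rule f_inv[OF \<theta>' \<phi>(1)])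
        also have "\<dots> \<le> C2 / (n * sqrt n) / m" using \<mu>(2) \<phi>(2) m(1) by (intro divide_right_mono) auto
        finally show ?thesis by (simp add: mult_ac)
      qed
      \<comment> \<open>A priori the eigenvalue near the quasi-mode could satisfy the phase
        condition with another multiple of \<pi>. Since n |\<phi> - \<theta>| is O(n^(-1/2)), the
        two multiples differ by less than 2, hence by less than \<pi>.\<close>
      have kk': "k' = k"
      proof -
        have "n * grid N k' - n * x = - (n * \<phi> - rho f \<phi> - n * grid N k') + n * (\<phi> - \<theta>) - (rho f \<phi> - rho f \<theta>)"
          using \<theta>(2) by (simp add: algebra_simps)
        then have "\<bar>n * grid N k' - n * x\<bar> \<le> \<bar>n * \<phi> - rho f \<phi> - n * grid N k'\<bar> + \<bar>n * (\<phi> - \<theta>)\<bar> + \<bar>rho f \<phi> - rho f \<theta>\<bar>"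
          by linarith
        also have "\<dots> \<le> 2 * C1 / n\<^sup>2 + n * \<bar>\<phi> - \<theta>\<bar> + L * \<bar>\<phi> - \<theta>\<bar>"
          using k' rho_lip[OF \<theta>' \<phi>(1)] n by (simp add: abs_mult)
        also have "\<dots> \<le> 2 * C1 / n + (1 + L) * (n * \<bar>\<phi> - \<theta>\<bar>)"
        proof -
          have "L * (1 * \<bar>\<phi> - \<theta>\<bar>) \<le> L * (n * \<bar>\<phi> - \<theta>\<bar>)" using L n by (intro mult_left_mono mult_right_mono) auto
          moreover have "2 * C1 / n\<^sup>2 \<le> 2 * C1 / n" using C1 by (intro inv) auto
          ultimately show ?thesis by (simp add: distrib_right)
        qed
        also have "n * \<bar>\<phi> - \<theta>\<bar> \<le> n * (C2 / m / (n * sqrt n))" using n by (intro mult_left_mono d) auto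
        also have "n * (C2 / m / (n * sqrt n)) = C2 / m / sqrt n" using n by simp
        also have "2 * C1 / n + (1 + L) * (C2 / m / sqrt n) < 1 + 1" using elim(7,8) by (intro add_strict_mono) auto
        finally have "\<bar>n * grid N k' - n * x\<bar> < 2" using L by simp
        moreover have "\<bar>n * grid N k' - n * x\<bar> = \<bar>of_int (k' - k)\<bar> * pi"
          unfolding x_def grid_n left_diff_distrib[symmetric] abs_mult by simp
        ultimately have "\<bar>of_int (k' - k)\<bar> * pi < 1 * pi" using pi_gt3 by linarith
        then have "\<bar>of_int (k' - k) :: real\<bar> < 1" by (rule mult_right_less_imp_less) simp
        then show ?thesis by linarith
      qed
      have \<mu>le: "\<bar>\<mu> - approx \<sigma> n x\<bar> \<le> C / n ^ 3"
        unfolding \<phi>(2) by (rule expand[OF n(1) x(2) \<phi>(1)]) (use k' kk' in \<open>simp add: x_def\<close>)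
      show "\<exists>!\<mu>. toeplitz_eig N \<mu> \<and> \<mu> \<in> {f \<theta>1..f \<theta>2} \<and> \<bar>\<mu> - lambda_approx \<theta>1 \<theta>2 f N k\<bar> \<le> C / n ^ 3"
        unfolding lax
      proof (rule ex1I[of _ \<mu>])
        show "toeplitz_eig N \<mu> \<and> \<mu> \<in> {f \<theta>1..f \<theta>2} \<and> \<bar>\<mu> - approx \<sigma> n x\<bar> \<le> C / n ^ 3"
          using \<mu>(1) \<open>\<mu> \<in> {f \<theta>1..f \<theta>2}\<close> \<mu>le by blast
        fix \<mu>' assume \<mu>': "toeplitz_eig N \<mu>' \<and> \<mu>' \<in> {f \<theta>1..f \<theta>2} \<and> \<bar>\<mu>' - approx \<sigma> n x\<bar> \<le> C / n ^ 3"
        show "\<mu>' = \<mu>"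
        proof (rule ccontr)
          assume ne: "\<mu>' \<noteq> \<mu>"
          obtain N' where N': "N = Suc N'" using elim(2) by (cases N) auto
          obtain \<nu> where \<nu>: "toeplitz_eig N' \<nu>" "\<bar>\<nu> - \<mu>\<bar> \<le> \<bar>\<mu>' - \<mu>\<bar>"
            using interlacing[of N' \<mu> \<mu>'] \<mu>(1) \<mu>' ne unfolding N' by auto
          have "\<bar>y - z\<bar> \<le> 2 * E" if "\<bar>y - z\<bar> \<le> \<bar>z' - z\<bar>" "\<bar>z' - A\<bar> \<le> E" "\<bar>z - A\<bar> \<le> E" for y z z' A E :: real
            using that by linarith
          then have "\<bar>\<nu> - \<mu>\<bar> \<le> 2 * (C / n ^ 3)" using \<nu>(2) \<mu>' \<mu>le by blast
          then have \<nu>\<mu>: "\<bar>\<nu> - \<mu>\<bar> \<le> 2 * C / n ^ 3" by simp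
          \<comment> \<open>The interlacing eigenvalue has to stay in the range of f on
            [\<theta>1, \<theta>2] before the phase condition applies to it; this accounts for the
            constant C2 + 3C + K compared with \<open>gap\<close>.\<close>
          have "\<bar>\<nu> - f x\<bar> \<le> \<bar>\<nu> - \<mu>\<bar> + \<bar>\<mu> - approx \<sigma> n x\<bar> + \<bar>approx \<sigma> n x - f x\<bar>" by linarith
          also have "\<dots> \<le> 2 * C / n + C / n + K / n"
            using \<nu>\<mu> \<mu>le approx_f[OF n(1) x(2)] inv(1)[of "2 * C"] inv(1)[of C] C by linarith
          also have "\<dots> \<le> (C2 + 3 * C + K) / n" using C2 n by (simp add: add_divide_distrib[symmetric] divide_right_mono)
          finally have "\<bar>\<nu> - f x\<bar> < gap" using elim(6) by linarith
          then have "\<nu> \<in> {f \<theta>1..f \<theta>2}" using fx by (simp add: abs_less_iff)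
          then obtain \<psi> where \<psi>: "\<psi> \<in> {\<theta>1..\<theta>2}" "\<nu> = f \<psi>" using f_preimage[of \<theta>1 \<theta>2 \<nu>] \<theta>12 by auto
          have d': "\<bar>\<phi> - \<psi>\<bar> \<le> 2 * C / m / n ^ 3"
          proof -
            have "\<bar>\<phi> - \<psi>\<bar> \<le> \<bar>f \<phi> - f \<psi>\<bar> / m" by (rule f_inv[OF \<psi>(1) \<phi>(1)])
            also have "\<dots> \<le> 2 * C / n ^ 3 / m" using \<nu>\<mu> \<psi>(2) \<phi>(2) m(1) by (intro divide_right_mono) (auto simp: abs_minus_commute)
            finally show ?thesis by (simp add: mult_ac)
          qed
          have nN': "real N' + 2 = n - 1" "N - 1 = N'" unfolding n_def N' by simp_all
          have "\<bar>sin ((n - 1) * \<psi> - rho f \<psi>)\<bar> \<le> C1 / (n - 1)\<^sup>2"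
            using conjunct2[OF elim(2), unfolded nN', THEN bspec, OF \<psi>(1), THEN mp] \<nu>(1) unfolding \<psi>(2) by simp
          moreover obtain j where "\<bar>((n - 1) * \<psi> - rho f \<psi>) - of_int j * pi\<bar> \<le> 2 * \<bar>sin ((n - 1) * \<psi> - rho f \<psi>)\<bar>"
            by (rule sin_small_imp_near_multiple)
          ultimately have j: "\<bar>((n - 1) * \<psi> - rho f \<psi>) - of_int j * pi\<bar> \<le> 2 * C1 / (n - 1)\<^sup>2" by simp
          have n1: "2 * C1 / (n - 1)\<^sup>2 \<le> 8 * C1 / n"
          proof -
            have "(n / 2)\<^sup>2 \<le> (n - 1)\<^sup>2" using n by (intro power_mono) auto
            then have "2 * C1 / (n - 1)\<^sup>2 \<le> 2 * C1 / (n / 2)\<^sup>2" using C1 n by (intro divide_left_mono) auto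
            also have "\<dots> = 8 * C1 / n\<^sup>2" by (simp add: power_divide)
            also have "\<dots> \<le> 8 * C1 / n" using C1 by (intro inv) auto
            finally show ?thesis .
          qed
          \<comment> \<open>The difference of the conditions n\<phi> - \<rho>(\<phi>) = k'\<pi> and
            (n - 1)\<psi> - \<rho>(\<psi>) = j\<pi>, both up to O(1/n). As |\<phi> - \<psi>| is
            O(n^(-3)), a single \<phi> remains on the left.\<close>
          have "\<phi> - of_int (k' - j) * pi = (n * \<phi> - rho f \<phi> - n * grid N k') - (((n - 1) * \<psi> - rho f \<psi>) - of_int j * pi)
             - (n - 1) * (\<phi> - \<psi>) + (rho f \<phi> - rho f \<psi>)"
            unfolding grid_n by (simp add: algebra_simps)
          then have "\<bar>\<phi> - of_int (k' - j) * pi\<bar> \<le> \<bar>n * \<phi> - rho f \<phi> - n * grid N k'\<bar> + \<bar>((n - 1) * \<psi> - rho f \<psi>) - of_int j * pi\<bar>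
             + \<bar>(n - 1) * (\<phi> - \<psi>)\<bar> + \<bar>rho f \<phi> - rho f \<psi>\<bar>" by linarith
          also have "\<dots> \<le> 2 * C1 / n + 8 * C1 / n + n * \<bar>\<phi> - \<psi>\<bar> + L * (n * \<bar>\<phi> - \<psi>\<bar>)"
          proof (intro add_mono)
            show "\<bar>n * \<phi> - rho f \<phi> - n * grid N k'\<bar> \<le> 2 * C1 / n" using k' inv(2)[of "2 * C1"] C1 by simp
            show "\<bar>((n - 1) * \<psi> - rho f \<psi>) - of_int j * pi\<bar> \<le> 8 * C1 / n" using j n1 by linarith
            show "\<bar>(n - 1) * (\<phi> - \<psi>)\<bar> \<le> n * \<bar>\<phi> - \<psi>\<bar>" using n by (simp add: abs_mult mult_right_mono)
            have "L * (1 * \<bar>\<phi> - \<psi>\<bar>) \<le> L * (n * \<bar>\<phi> - \<psi>\<bar>)" using L n by (intro mult_left_mono mult_right_mono) auto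
            with rho_lip[OF \<psi>(1) \<phi>(1)] show "\<bar>rho f \<phi> - rho f \<psi>\<bar> \<le> L * (n * \<bar>\<phi> - \<psi>\<bar>)" by simp
          qed
          also have "\<dots> = 10 * C1 / n + (1 + L) * (n * \<bar>\<phi> - \<psi>\<bar>)" by (simp add: distrib_right)
          also have "\<dots> \<le> 10 * C1 / n + (1 + L) * (2 * C / m / n)"
          proof (intro add_left_mono mult_left_mono)
            have "n * \<bar>\<phi> - \<psi>\<bar> \<le> n * (2 * C / m / n ^ 3)" using n by (intro mult_left_mono d') auto
            also have "\<dots> = 2 * C / m / n\<^sup>2" using n by (simp add: power2_eq_square power3_eq_cube)
            also have "\<dots> \<le> 2 * C / m / n" using C m(1) by (intro inv) auto
            finally show "n * \<bar>\<phi> - \<psi>\<bar> \<le> 2 * C / m / n" .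
          qed (use L in auto)
          also have "\<dots> = K5 / n" by (simp add: K5_def add_divide_distrib)
          also have "\<dots> < e1" by (rule elim(10))
          finally have fin: "\<bar>\<phi> - of_int (k' - j) * pi\<bar> < e1" .
          \<comment> \<open>A multiple of \<pi> is at most 0 or at least \<pi>, and both are at
            distance at least \<open>e1\<close> from \<phi>.\<close>
          show False
          proof (cases "k' - j \<le> 0")
            case True
            then have "of_int (k' - j) * pi \<le> 0 * pi" by (intro mult_right_mono) auto
            moreover have "\<theta>1 \<le> \<phi>" "e1 \<le> \<theta>1" using \<phi>(1) by (simp_all add: e1_def)
            ultimately show False using fin by linarith
          next
            case False
            then have "1 \<le> k' - j" by simp
            then have "1 \<le> (of_int (k' - j) :: real)" by linarith
            then have "1 * pi \<le> of_int (k' - j) * pi" by (intro mult_right_mono) auto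
            moreover have "\<phi> \<le> \<theta>2" "e1 \<le> pi - \<theta>2" using \<phi>(1) by (simp_all add: e1_def)
            ultimately show False using fin by linarith
          qed
        qed
      qed
    qed
  qed
  then show ?thesis using C unfolding eventually_sequentially by blast
qed

end

theorem theorem1:
  fixes f :: "real \<Rightarrow> real" and \<theta>1 \<theta>2 a b :: real
  assumes "0 < \<theta>1" and "\<theta>1 < \<theta>2" and "\<theta>2 < pi"
    and "\<And>x. f (- x) = f x" and "\<And>x. f (x + 2 * pi) = f x"
    and "C_class 4 f" and "f \<in> A_plus \<theta>1 \<theta>2"
    and "a < b" and "{a..b} \<subseteq> {\<theta>1<..<\<theta>2}"
  shows "\<exists>(C::real) > 0. \<exists>N0::nat. \<forall>N\<ge>N0.
     (\<forall>\<mu>::real. eigenvalue (toeplitz N (\<lambda>t. complex_of_real (f t))) (complex_of_real \<mu>)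
          \<and> \<mu> \<in> {f a..f b} \<longrightarrow>
        (\<exists>!k::int. k \<in> {k_min \<theta>1 \<theta>2 N..k_max \<theta>1 \<theta>2 N} \<and>
           \<bar>\<mu> - lambda_approx \<theta>1 \<theta>2 f N k\<bar> \<le> C / (real N + 2) ^ 3)) \<and>
     (\<forall>k::int. k \<in> {k_min a b N..k_max a b N} \<longrightarrow>
        (\<exists>!\<mu>::real. eigenvalue (toeplitz N (\<lambda>t. complex_of_real (f t))) (complex_of_real \<mu>)
           \<and> \<mu> \<in> {f \<theta>1..f \<theta>2} \<and>
           \<bar>\<mu> - lambda_approx \<theta>1 \<theta>2 f N k\<bar> \<le> C / (real N + 2) ^ 3))"
proof -
  interpret smooth_symbol f \<theta>1 \<theta>2 by unfold_locales (use assms in auto)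
  show ?thesis unfolding eigenvalue_toeplitz_iff by (rule eigenvalue_asymptotics[OF assms(8,9)])
qed

end
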